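(* Let $G$ be a countable discrete amenable group acting continuously on a compact metric space $X$. Then $(X, G)$ is asymptotically $h$-expansive if and only if $h^{a, *} (G, X)= 0$. Similarly, $(X, G)$ is $h$-expansive if and only if $h^a (G, X| \mathcal{V})= 0$ for some $\mathcal{V}\in \mathcal{C}_X^o$.
   Context: Setting: $G$ is a countable discrete amenable group (hence sofic), acting continuously on a compact metric space $(X,\rho)$, with a fixed sofic approximation $\Sigma=\{\sigma_i: G \rightarrow \mathrm{Sym}(d_i),\ g\mapsto \sigma_{i, g}\}_{i\in \mathbb{N}}$, where $d_i\in\mathbb{N}$, $d_i\to\infty$, $\mathrm{Sym}(d)$ is the permutation group of $\{1,\dots,d\}$, and $\lim_{i} \frac{1}{d_i} |\{a: \sigma_{i,s}\sigma_{i,t}(a)=\sigma_{i,st}(a)\}|=1$ for all $s,t\in G$, $\lim_{i} \frac{1}{d_i} |\{a: \sigma_{i,s}(a)\neq \sigma_{i,t}(a)\}|=1$ for all distinct $s,t\in G$. $\mathcal{C}_X$ and $\mathcal{C}_X^o$ are the sets of finite Borel covers and of finite open covers of $X$. For a cover $\mathcal{V}$ and a set $K$, $N(\mathcal{V},K)$ is the minimal cardinality of sub-families of $\mathcal{V}$ covering $K$ ($N(\mathcal{V},\emptyset)=0$). For $\mathcal{U}\in\mathcal{C}_X$, $\mathcal{U}^d$ is the cover of $X^d$ consisting of all products $U_1\times\cdots\times U_d$ with $U_j\in\mathcal{U}$. Convention: $\log 0=-\infty$. $\mathfrak{F}_G$ is the set of non-empty finite subsets of $G$. Sofic notions: for $F\in\mathfrak{F}_G$,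 $\delta>0$, $\sigma:G\to\mathrm{Sym}(d)$, put $$X^d_{F,\delta,\sigma}=\left\{(x_1,\dots,x_d)\in X^d:\max_{s\in F}\sqrt{\sum_{j=1}^d\frac1d\rho^2(sx_j,x_{\sigma_s(j)})}<\delta\right\}.$$ For $\mathcal{U}_1,\mathcal{U}_2\in\mathcal{C}_X$ define $$h(G,\mathcal{U}_1|\mathcal{U}_2)=\inf_{F\in\mathfrak{F}_G}\inf_{\delta>0}\limsup_{i\to\infty}\frac1{d_i}\log\max_{V\in\mathcal{U}_2^{d_i}}N\left(\mathcal{U}_1^{d_i},X^{d_i}_{F,\delta,\sigma_i}\cap V\right),$$ $h(G,X|\mathcal{U}_2)=\sup_{\mathcal{U}_1\in\mathcal{C}_X^o}h(G,\mathcal{U}_1|\mathcal{U}_2)$ and $h^*(G,X)=\inf_{\mathcal{U}_2\in\mathcal{C}_X^o}h(G,X|\mathcal{U}_2)$. $(X,G)$ is $h$-expansive if $h(G,X|\mathcal{U})\le0$ for some $\mathcal{U}\in\mathcal{C}_X^o$, and asymptotically $h$-expansive if $h^*(G,X)\le0$. Amenable notions: for $\mathcal{W}\in\mathcal{C}_X$ and $F\in\mathfrak{F}_G$, $\mathcal{W}_F=\bigvee_{g\in F}g^{-1}\mathcal{W}$, where the join of covers is the family of all intersections of one element from each. For $\mathcal{W}_1,\mathcal{W}_2\in\mathcal{C}_X$ let $m_{\mathcal{W}_1,\mathcal{W}_2}(F)=\max_{K\in(\mathcal{W}_2)_F}\log N((\mathcal{W}_1)_F,K)$ and $$h^a(G,\mathcal{W}_1|\mathcal{W}_2)=\lim_{n\to\infty}\frac1{|F_n|}m_{\mathcal{W}_1,\mathcal{W}_2}(F_n),$$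 where $\{F_n\}\subset\mathfrak{F}_G$ is a Følner sequence ($|gF_n\Delta F_n|/|F_n|\to0$ for all $g\in G$); by the Ornstein–Weiss lemma the limit exists and is independent of the Følner sequence. Put $h^a(G,X|\mathcal{W}_2)=\sup_{\mathcal{U}\in\mathcal{C}_X^o}h^a(G,\mathcal{U}|\mathcal{W}_2)$ and the tail entropy $h^{a,*}(G,X)=\inf_{\mathcal{V}\in\mathcal{C}_X^o}h^a(G,X|\mathcal{V})$. *)

theory Defs
  imports "HOL-Analysis.Analysis" "HOL-Algebra.Group_Action" "HOL-Library.FuncSet"
begin

definition finite_open_covers :: "'x::topological_space set set set" where
  "finite_open_covers = {\<U>. finite \<U> \<and> (\<forall>U\<in>\<U>. open U) \<and> \<Union>\<U> = UNIV}"

definition cover_number :: "'x set set \<Rightarrow> 'x set \<Rightarrow> nat" where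
  "cover_number \<V> K = (LEAST n. \<exists>\<S>\<subseteq>\<V>. finite \<S> \<and> card \<S> = n \<and> K \<subseteq> \<Union>\<S>)"

text \<open>Natural logarithm of a counting number, with the convention that the logarithm
  of \<open>0\<close> is \<open>-\<infinity>\<close> (the library's real-valued \<^term>\<open>ln\<close> is \<open>0\<close> there).\<close>

definition log_card :: "nat \<Rightarrow> ereal" where
  "log_card n = (if n = 0 then -\<infinity> else ereal (ln (real n)))"

definition finite_nonempty_subsets :: "('g, 'b) monoid_scheme \<Rightarrow> 'g set set" where
  "finite_nonempty_subsets G = {F. F \<subseteq> carrier G \<and> finite F \<and> F \<noteq> {}}"

text \<open>A point of \<open>X\<^sup>d\<close> is an extensional function on \<open>{1..d}\<close>, and \<open>\<sigma> i g\<close> acts on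
  \<open>{1..d i}\<close>. As usual for sofic approximations, the \<open>\<sigma> i\<close> need not be homomorphisms.\<close>

definition sofic_approximation ::
    "('g, 'b) monoid_scheme \<Rightarrow> (nat \<Rightarrow> nat) \<Rightarrow> (nat \<Rightarrow> 'g \<Rightarrow> nat \<Rightarrow> nat) \<Rightarrow> bool" where
  "sofic_approximation G d \<sigma> \<longleftrightarrow>
     filterlim d at_top sequentially \<and>
     (\<forall>i. \<forall>g\<in>carrier G. \<sigma> i g permutes {1..d i}) \<and>
     (\<forall>s\<in>carrier G. \<forall>t\<in>carrier G.
        (\<lambda>i. real (card {a \<in> {1..d i}. \<sigma> i s (\<sigma> i t a) = \<sigma> i (s \<otimes>\<^bsub>G\<^esub> t) a}) / real (d i))
          \<longlonglongrightarrow> 1) \<and>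
     (\<forall>s\<in>carrier G. \<forall>t\<in>carrier G. s \<noteq> t \<longrightarrow>
        (\<lambda>i. real (card {a \<in> {1..d i}. \<sigma> i s a \<noteq> \<sigma> i t a}) / real (d i)) \<longlonglongrightarrow> 1)"

definition cover_power :: "'x set set \<Rightarrow> nat \<Rightarrow> (nat \<Rightarrow> 'x) set set" where
  "cover_power \<U> d = (\<lambda>U. Pi\<^sub>E {1..d} U) ` ({1..d} \<rightarrow>\<^sub>E \<U>)"

definition sofic_model ::
    "('g \<Rightarrow> 'x \<Rightarrow> 'x) \<Rightarrow> 'g set \<Rightarrow> real \<Rightarrow> nat \<Rightarrow> ('g \<Rightarrow> nat \<Rightarrow> nat) \<Rightarrow> (nat \<Rightarrow> 'x::metric_space) set"
  where
  "sofic_model \<phi> F \<delta> d \<tau> =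
     {x \<in> {1..d} \<rightarrow>\<^sub>E UNIV.
        (MAX s\<in>F. sqrt (\<Sum>j=1..d. 1 / real d * (dist (\<phi> s (x j)) (x (\<tau> s j)))\<^sup>2)) < \<delta>}"

definition sofic_cond_entropy ::
    "('g, 'b) monoid_scheme \<Rightarrow> ('g \<Rightarrow> 'x \<Rightarrow> 'x) \<Rightarrow> (nat \<Rightarrow> nat) \<Rightarrow> (nat \<Rightarrow> 'g \<Rightarrow> nat \<Rightarrow> nat)
       \<Rightarrow> 'x::metric_space set set \<Rightarrow> 'x set set \<Rightarrow> ereal" where
  "sofic_cond_entropy G \<phi> d \<sigma> \<U>\<^sub>1 \<U>\<^sub>2 =
     (INF F\<in>finite_nonempty_subsets G. INF \<delta>\<in>{0<..}.
        limsup (\<lambda>i. ereal (1 / real (d i)) *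
          log_card (MAX V\<in>cover_power \<U>\<^sub>2 (d i).
            cover_number (cover_power \<U>\<^sub>1 (d i)) (sofic_model \<phi> F \<delta> (d i) (\<sigma> i) \<inter> V))))"

definition sofic_cover_entropy ::
    "('g, 'b) monoid_scheme \<Rightarrow> ('g \<Rightarrow> 'x \<Rightarrow> 'x) \<Rightarrow> (nat \<Rightarrow> nat) \<Rightarrow> (nat \<Rightarrow> 'g \<Rightarrow> nat \<Rightarrow> nat)
       \<Rightarrow> 'x::metric_space set set \<Rightarrow> ereal" where
  "sofic_cover_entropy G \<phi> d \<sigma> \<U>\<^sub>2 =
     (SUP \<U>\<^sub>1\<in>finite_open_covers. sofic_cond_entropy G \<phi> d \<sigma> \<U>\<^sub>1 \<U>\<^sub>2)"

definition sofic_tail_entropy ::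
    "('g, 'b) monoid_scheme \<Rightarrow> ('g \<Rightarrow> 'x::metric_space \<Rightarrow> 'x) \<Rightarrow> (nat \<Rightarrow> nat)
       \<Rightarrow> (nat \<Rightarrow> 'g \<Rightarrow> nat \<Rightarrow> nat) \<Rightarrow> ereal" where
  "sofic_tail_entropy G \<phi> d \<sigma> = (INF \<U>\<^sub>2\<in>finite_open_covers. sofic_cover_entropy G \<phi> d \<sigma> \<U>\<^sub>2)"

definition h_expansive ::
    "('g, 'b) monoid_scheme \<Rightarrow> ('g \<Rightarrow> 'x::metric_space \<Rightarrow> 'x) \<Rightarrow> (nat \<Rightarrow> nat)
       \<Rightarrow> (nat \<Rightarrow> 'g \<Rightarrow> nat \<Rightarrow> nat) \<Rightarrow> bool" where
  "h_expansive G \<phi> d \<sigma> \<longleftrightarrow> (\<exists>\<U>\<in>finite_open_covers. sofic_cover_entropy G \<phi> d \<sigma> \<U> \<le> 0)"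

definition asymptotically_h_expansive ::
    "('g, 'b) monoid_scheme \<Rightarrow> ('g \<Rightarrow> 'x::metric_space \<Rightarrow> 'x) \<Rightarrow> (nat \<Rightarrow> nat)
       \<Rightarrow> (nat \<Rightarrow> 'g \<Rightarrow> nat \<Rightarrow> nat) \<Rightarrow> bool" where
  "asymptotically_h_expansive G \<phi> d \<sigma> \<longleftrightarrow> sofic_tail_entropy G \<phi> d \<sigma> \<le> 0"

text \<open>A countable group is amenable if and only if it admits such a sequence.\<close>

definition folner_sequence :: "('g, 'b) monoid_scheme \<Rightarrow> (nat \<Rightarrow> 'g set) \<Rightarrow> bool" where
  "folner_sequence G Fs \<longleftrightarrow>
     (\<forall>n. Fs n \<in> finite_nonempty_subsets G) \<and>
     (\<forall>g\<in>carrier G.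
        (\<lambda>n. real (card (sym_diff (g <#\<^bsub>G\<^esub> Fs n) (Fs n))) / real (card (Fs n))) \<longlonglongrightarrow> 0)"

text \<open>The join of the covers \<open>g\<^sup>-\<^sup>1\<W>\<close> over \<open>g \<in> F\<close>; for a group action, \<open>g\<^sup>-\<^sup>1W\<close> is the preimage
  of \<open>W\<close> under the map given by \<open>g\<close>.\<close>

definition cover_join :: "('g \<Rightarrow> 'x \<Rightarrow> 'x) \<Rightarrow> 'x set set \<Rightarrow> 'g set \<Rightarrow> 'x set set" where
  "cover_join \<phi> \<W> F = (\<lambda>W. \<Inter>g\<in>F. \<phi> g -` W g) ` (F \<rightarrow>\<^sub>E \<W>)"

definition max_log_cover_number ::
    "('g \<Rightarrow> 'x \<Rightarrow> 'x) \<Rightarrow> 'x set set \<Rightarrow> 'x set set \<Rightarrow> 'g set \<Rightarrow> ereal" where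
  "max_log_cover_number \<phi> \<W>\<^sub>1 \<W>\<^sub>2 F =
     (MAX K\<in>cover_join \<phi> \<W>\<^sub>2 F. log_card (cover_number (cover_join \<phi> \<W>\<^sub>1 F) K))"

text \<open>The entropies below are taken along a given Folner sequence. By the Ornstein-Weiss lemma
  the limit exists and does not depend on that sequence.\<close>

definition amenable_cond_entropy ::
    "('g \<Rightarrow> 'x \<Rightarrow> 'x) \<Rightarrow> (nat \<Rightarrow> 'g set) \<Rightarrow> 'x set set \<Rightarrow> 'x set set \<Rightarrow> ereal" where
  "amenable_cond_entropy \<phi> Fs \<W>\<^sub>1 \<W>\<^sub>2 =
     lim (\<lambda>n. ereal (1 / real (card (Fs n))) * max_log_cover_number \<phi> \<W>\<^sub>1 \<W>\<^sub>2 (Fs n))"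

definition amenable_cover_entropy ::
    "('g \<Rightarrow> 'x::topological_space \<Rightarrow> 'x) \<Rightarrow> (nat \<Rightarrow> 'g set) \<Rightarrow> 'x set set \<Rightarrow> ereal" where
  "amenable_cover_entropy \<phi> Fs \<W>\<^sub>2 = (SUP \<U>\<in>finite_open_covers. amenable_cond_entropy \<phi> Fs \<U> \<W>\<^sub>2)"

definition amenable_tail_entropy ::
    "('g \<Rightarrow> 'x::topological_space \<Rightarrow> 'x) \<Rightarrow> (nat \<Rightarrow> 'g set) \<Rightarrow> ereal" where
  "amenable_tail_entropy \<phi> Fs = (INF \<V>\<in>finite_open_covers. amenable_cover_entropy \<phi> Fs \<V>)"

end

theory Submission
  imports Defs
begin

text \<open>Both entropies are computed from covering numbers of tuples of coordinates: along \<open>g \<mapsto> g x\<close>,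
  \<open>g \<in> F\<close>, on the amenable side, and along the \<open>d\<close> coordinates of a sofic model on the sofic side.
  A large part of \<open>{1..d}\<close> is quasi-tiled by almost disjoint copies \<open>{\<sigma>\<^sub>s c : s \<in> F}\<close> of Folner
  sets \<open>F\<close>. On such a copy a point \<open>x\<close> of the model is close to the orbit piece \<open>(s x\<^sub>c)\<close>, \<open>s \<in> F\<close>, so
  covering numbers of the model are at most products of those of orbit pieces, after passing to
  covers with a uniform margin. Conversely, arbitrary orbit pieces placed on disjoint tiles form
  a point of the model, and separated sets of orbit pieces multiply; star refinements turn covering
  numbers into separated sets. This gives \<open>h\<^sup>a(G, X | \<V>) \<le> h(G, X | \<V>)\<close> for all \<open>\<V>\<close>, and for every
  \<open>\<V>\<close> some \<open>\<U>\<close> with \<open>h(G, X | \<U>) \<le> h\<^sup>a(G, X | \<V>)\<close>. The same quasi-tilings, applied to the left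
  multiplication of \<open>G\<close> on a Folner set, give the existence of the limit \<open>h\<^sup>a\<close>.\<close>

section \<open>Covering numbers along coordinate maps\<close>

text \<open>The two comparisons are asymmetric because a point of a model follows orbits only up to
  a mean square error: it may leave its orbit pieces at a few coordinates, and which ones depends on
  the point. The upper bound therefore splits the model by the set of bad coordinates; the number of
  candidates for that set grows exponentially in \<open>d\<close>, but with arbitrarily small rate.
  At good coordinates an error below a fixed margin remains, which both covers must absorb, so there
  the conditioning cover has to be refined. For the lower bound the constructed points are exact
  orbit pieces on the tiles and break equivariance at few coordinates only, so the conditioning
  cover is kept. The covering number of a product may be smaller than the product of the covering
  numbers, whereas separated sets do multiply; hence the detour through separation on that side.

  A second obstacle is that conditional covering numbers need not grow with the set
  \<open>F\<close>: fewer elements also mean weaker conditions and larger cells. Trimmed tiles are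
  therefore never compared with full shapes by monotonicity. Upper bounds use the full shapes, lower
  bounds use subadditivity.\<close>

definition joint_cover_number :: "('j \<Rightarrow> 'a \<Rightarrow> 'x) \<Rightarrow> 'x set set \<Rightarrow> 'j set \<Rightarrow> 'a set \<Rightarrow> nat" where
  "joint_cover_number \<pi> \<U> J S =
     (LEAST n. \<exists>Q \<subseteq> Pi J (\<lambda>_. \<U>). finite Q \<and> card Q = n \<and> (\<forall>x\<in>S. \<exists>q\<in>Q. \<forall>j\<in>J. \<pi> j x \<in> q j))"

lemma joint_cover_number_le:
  assumes "finite Q" "Q \<subseteq> Pi J (\<lambda>_. \<U>)" "\<And>x. x \<in> S \<Longrightarrow> \<exists>q\<in>Q. \<forall>j\<in>J. \<pi> j x \<in> q j"
  shows "joint_cover_number \<pi> \<U> J S \<le> card Q"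
  unfolding joint_cover_number_def by (rule Least_le) (use assms in blast)

lemma cover_choice:
  assumes "\<Union>\<U> = UNIV"
  shows "\<exists>u. \<forall>y. y \<in> u y \<and> u y \<in> \<U>"
  using assms by (intro choice) blast

text \<open>Joins and powers of a cover become one notion: the coordinates \<open>\<pi> j\<close>
  are the maps \<open>\<phi> g\<close> or the evaluations at \<open>j\<close>. Counting index
  functions instead of the sets they define makes gluing and reindexing of coordinates immediate.
  Several index functions may define the same set; so one function is chosen for each set of a
  family, and in the other direction the count can only drop.\<close>

lemma cover_number_image_eq_joint_cover_number:
  assumes "\<And>W x. x \<in> S \<Longrightarrow> x \<in> E W \<longleftrightarrow> (\<forall>j\<in>J. \<pi> j x \<in> W j)"
  shows "cover_number (E ` (J \<rightarrow>\<^sub>E \<U>)) S = joint_cover_number \<pi> \<U> J S"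
proof -
  define P where "P = (\<lambda>n. \<exists>\<S>\<subseteq>E ` (J \<rightarrow>\<^sub>E \<U>). finite \<S> \<and> card \<S> = n \<and> S \<subseteq> \<Union>\<S>)"
  define R where "R = (\<lambda>n. \<exists>Q \<subseteq> Pi J (\<lambda>_. \<U>). finite Q \<and> card Q = n \<and> (\<forall>x\<in>S. \<exists>q\<in>Q. \<forall>j\<in>J. \<pi> j x \<in> q j))"
  have PR: "\<exists>m\<le>n. R m" if Pn: "P n" for n
  proof -
    obtain \<S> where S: "\<S>\<subseteq>E ` (J \<rightarrow>\<^sub>E \<U>)" "finite \<S>" "card \<S> = n" "S \<subseteq> \<Union>\<S>" using Pn unfolding P_def by (elim exE conjE) (rule that)
    obtain Q where Q: "Q \<subseteq> J \<rightarrow>\<^sub>E \<U>" "\<S> = E ` Q" "inj_on E Q"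
      using S(1) unfolding subset_image_inj by (elim exE conjE) (rule that)
    have "R n" unfolding R_def
    proof (intro exI conjI ballI)
      show "Q \<subseteq> Pi J (\<lambda>_. \<U>)" using Q(1) by auto
      show "finite Q" using S(2) Q(2,3) by (simp add: finite_image_iff)
      show "card Q = n" using S(3) Q(2,3) by (simp add: card_image)
      fix x assume "x \<in> S"
      then obtain q where "q \<in> Q" "x \<in> E q" using S(4) Q(2) by auto
      then show "\<exists>q\<in>Q. \<forall>j\<in>J. \<pi> j x \<in> q j" using assms \<open>x \<in> S\<close> by blast
    qed
    then show ?thesis by (intro exI[of _ n] conjI order_refl)
  qed
  have RP: "\<exists>m\<le>n. P m" if Rn: "R n" for n
  proof -
    obtain Q where Q: "Q \<subseteq> Pi J (\<lambda>_. \<U>)" "finite Q" "card Q = n"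
        "\<And>x. x \<in> S \<Longrightarrow> \<exists>q\<in>Q. \<forall>j\<in>J. \<pi> j x \<in> q j" using Rn unfolding R_def by (elim exE conjE) (rule that, assumption+, erule (1) bspec)
    let ?\<S> = "(\<lambda>q. E (restrict q J)) ` Q"
    have "P (card ?\<S>)" unfolding P_def
    proof (intro exI conjI subsetI)
      show "finite ?\<S>" using Q by simp
      fix B assume "B \<in> ?\<S>"
      then obtain q where "q \<in> Q" "B = E (restrict q J)" by blast
      moreover from this have "restrict q J \<in> J \<rightarrow>\<^sub>E \<U>" using Q(1) by auto
      ultimately show "B \<in> E ` (J \<rightarrow>\<^sub>E \<U>)" by blast
    next
      fix x assume x: "x \<in> S"
      then obtain q where "q \<in> Q" "\<forall>j\<in>J. \<pi> j x \<in> q j" using Q(4) by blast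
      then have "x \<in> E (restrict q J)" using assms[OF x] by auto
      then show "x \<in> \<Union>?\<S>" using \<open>q \<in> Q\<close> by blast
    qed auto
    moreover have "card ?\<S> \<le> n" using Q(2,3) card_image_le by blast
    ultimately show ?thesis by (intro exI[of _ "card ?\<S>"] conjI)
  qed
  \<comment> \<open>Nothing forces a finite covering family to exist here. Without one, both
    predicates are empty, hence equal, and \<open>LEAST\<close> yields the same unspecified
    number.\<close>
  have "(LEAST n. P n) = (LEAST n. R n)"
  proof (cases "\<exists>n. P n")
    case True
    then have exR: "\<exists>n. R n" using PR by blast
    show ?thesis
    proof (rule antisym)
      show "(LEAST n. P n) \<le> (LEAST n. R n)"
        using RP[OF LeastI_ex[OF exR]] by (metis Least_le le_trans)
      show "(LEAST n. R n) \<le> (LEAST n. P n)"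
        using PR[OF LeastI_ex[OF True]] by (metis Least_le le_trans)
    qed
  next
    case False
    then have "P = R" using RP by blast
    then show ?thesis by simp
  qed
  then show ?thesis unfolding cover_number_def joint_cover_number_def P_def R_def .
qed

lemma cover_number_cover_join:
  "cover_number (cover_join \<phi> \<U> F) S = joint_cover_number \<phi> \<U> F S"
  unfolding cover_join_def by (rule cover_number_image_eq_joint_cover_number) auto

lemma cover_number_cover_power:
  assumes "S \<subseteq> {1..d} \<rightarrow>\<^sub>E UNIV"
  shows "cover_number (cover_power \<U> d) S = joint_cover_number (\<lambda>j x. x j) \<U> {1..d} S"
  unfolding cover_power_def
  by (rule cover_number_image_eq_joint_cover_number) (use assms in \<open>auto simp: PiE_iff\<close>)

locale finite_cover =
  fixes \<U> :: "'x set set"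
  assumes finite_cover: "finite \<U>" and covers: "\<Union>\<U> = UNIV"
begin

lemma cover_nonempty: "\<U> \<noteq> {}" using covers by auto

lemma card_cover_ge_1: "1 \<le> card \<U>"
  using cover_nonempty finite_cover by (simp add: Suc_le_eq card_gt_0_iff)

lemma joint_cover_number_witness:
  assumes "finite J"
  shows "\<exists>Q. finite Q \<and> Q \<subseteq> Pi J (\<lambda>_. \<U>) \<and> card Q = joint_cover_number \<pi> \<U> J S \<and>
    (\<forall>x\<in>S. \<exists>q\<in>Q. \<forall>j\<in>J. \<pi> j x \<in> q j)"
proof -
  obtain u where u: "\<And>y. y \<in> u y" "\<And>y. u y \<in> \<U>" using cover_choice[OF covers] by blast
  let ?Q = "J \<rightarrow>\<^sub>E \<U>"
  have "\<exists>n. \<exists>Q \<subseteq> Pi J (\<lambda>_. \<U>). finite Q \<and> card Q = n \<and> (\<forall>x\<in>S. \<exists>q\<in>Q. \<forall>j\<in>J. \<pi> j x \<in> q j)"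
  proof (intro exI conjI ballI)
    show "?Q \<subseteq> Pi J (\<lambda>_. \<U>)" by auto
    show "finite ?Q" using assms finite_cover by (simp add: finite_PiE)
    show "card ?Q = card ?Q" ..
    fix x assume "x \<in> S"
    show "\<exists>q\<in>?Q. \<forall>j\<in>J. \<pi> j x \<in> q j"
      by (rule bexI[of _ "restrict (\<lambda>j. u (\<pi> j x)) J"]) (use u in auto)
  qed
  from LeastI_ex[OF this, folded joint_cover_number_def] show ?thesis by auto
qed

text \<open>An optimal family on \<open>K\<close> is pulled back: points travel along
  \<open>f\<close>, the coordinate \<open>s\<close> becomes \<open>h s\<close>, and a cover element
  \<open>A\<close> is replaced by \<open>r A\<close>. This serves for smaller sets of points, for
  right translates of a set of group elements, and for the passage from orbit pieces to tiles of a
  model, where \<open>r\<close> absorbs the error.\<close>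

lemma joint_cover_number_transfer:
  assumes "finite F" "finite_cover \<V>" "T \<subseteq> F" "inj_on h T" "\<And>x. x \<in> S \<Longrightarrow> f x \<in> K"
    and "\<And>A. A \<in> \<V> \<Longrightarrow> r A \<in> \<U>"
    and "\<And>x s A. x \<in> S \<Longrightarrow> s \<in> T \<Longrightarrow> A \<in> \<V> \<Longrightarrow> \<pi>' s (f x) \<in> A \<Longrightarrow> \<pi> (h s) x \<in> r A"
  shows "joint_cover_number \<pi> \<U> (h ` T) S \<le> joint_cover_number \<pi>' \<V> F K"
proof -
  obtain Q where Q: "finite Q" "Q \<subseteq> Pi F (\<lambda>_. \<V>)" "card Q = joint_cover_number \<pi>' \<V> F K"
      "\<And>x. x \<in> K \<Longrightarrow> \<exists>q\<in>Q. \<forall>j\<in>F. \<pi>' j x \<in> q j"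
    using finite_cover.joint_cover_number_witness[OF assms(2,1), of \<pi>' K]
    by (elim exE conjE) (rule that, assumption+, erule (1) bspec)
  let ?g = "\<lambda>q j. r (q (the_inv_into T h j))"
  have "joint_cover_number \<pi> \<U> (h ` T) S \<le> card (?g ` Q)"
  proof (rule joint_cover_number_le)
    show "finite (?g ` Q)" using Q by simp
    show "?g ` Q \<subseteq> Pi (h ` T) (\<lambda>_. \<U>)"
      using Q(2) assms(3,4,6) by (auto simp: the_inv_into_f_f) blast
    fix x assume x: "x \<in> S"
    then obtain q where q: "q \<in> Q" "\<forall>j\<in>F. \<pi>' j (f x) \<in> q j" using Q(4) assms(5) by blast
    have "\<pi> (h s) x \<in> r (q s)" if "s \<in> T" for s
    proof (rule assms(7)[OF x that])
      show "q s \<in> \<V>" using q(1) Q(2) that assms(3) by blast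
      show "\<pi>' s (f x) \<in> q s" using q(2) that assms(3) by blast
    qed
    then show "\<exists>q\<in>?g ` Q. \<forall>j\<in>h ` T. \<pi> j x \<in> q j"
      using q(1) assms(4) by (auto simp: the_inv_into_f_f)
  qed
  also have "\<dots> \<le> card Q" using Q(1) by (rule card_image_le)
  finally show ?thesis using Q(3) by simp
qed

lemma joint_cover_number_mono:
  assumes "finite J" "S \<subseteq> S'"
  shows "joint_cover_number \<pi> \<U> J S \<le> joint_cover_number \<pi> \<U> J S'"
  using joint_cover_number_transfer[of J \<U> J "\<lambda>j. j" S "\<lambda>x. x" S' "\<lambda>A. A" \<pi> \<pi>] assms
  finite_cover_axioms by (auto simp: inj_on_def)

lemma joint_cover_number_Un:
  assumes "finite J" "finite J'"
  shows "joint_cover_number \<pi> \<U> (J \<union> J') S \<le> joint_cover_number \<pi> \<U> J S * joint_cover_number \<pi> \<U> J' S"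
proof -
  obtain Q where Q: "finite Q" "Q \<subseteq> Pi J (\<lambda>_. \<U>)" "card Q = joint_cover_number \<pi> \<U> J S"
      "\<And>x. x \<in> S \<Longrightarrow> \<exists>q\<in>Q. \<forall>j\<in>J. \<pi> j x \<in> q j"
    using joint_cover_number_witness[OF assms(1), of \<pi> S]
    by (elim exE conjE) (rule that, assumption+, erule (1) bspec)
  obtain Q' where Q': "finite Q'" "Q' \<subseteq> Pi J' (\<lambda>_. \<U>)" "card Q' = joint_cover_number \<pi> \<U> J' S"
      "\<And>x. x \<in> S \<Longrightarrow> \<exists>q\<in>Q'. \<forall>j\<in>J'. \<pi> j x \<in> q j"
    using joint_cover_number_witness[OF assms(2), of \<pi> S]
    by (elim exE conjE) (rule that, assumption+, erule (1) bspec)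
  \<comment> \<open>\<open>J\<close> and \<open>J'\<close> may overlap; there the choice of
    \<open>q\<close> is kept, which is good enough since both choices contain the point.\<close>
  let ?g = "\<lambda>(q, q') j. if j \<in> J then q j else q' j"
  have "joint_cover_number \<pi> \<U> (J \<union> J') S \<le> card (?g ` (Q \<times> Q'))"
  proof (rule joint_cover_number_le)
    show "finite (?g ` (Q \<times> Q'))" using Q Q' by simp
    show "?g ` (Q \<times> Q') \<subseteq> Pi (J \<union> J') (\<lambda>_. \<U>)" using Q(2) Q'(2) by (auto; blast)
    fix x assume x: "x \<in> S"
    obtain q q' where q: "q \<in> Q" "\<forall>j\<in>J. \<pi> j x \<in> q j" "q' \<in> Q'" "\<forall>j\<in>J'. \<pi> j x \<in> q' j"
      using Q(4)[OF x] Q'(4)[OF x] by blast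
    then show "\<exists>q\<in>?g ` (Q \<times> Q'). \<forall>j\<in>J \<union> J'. \<pi> j x \<in> q j"
      by (intro bexI[of _ "?g (q, q')"]) auto
  qed
  also have "\<dots> \<le> card (Q \<times> Q')" using Q(1) Q'(1) by (intro card_image_le) simp
  finally show ?thesis using Q(3) Q'(3) by (simp add: card_cartesian_product)
qed

lemma joint_cover_number_empty: "joint_cover_number \<pi> \<U> {} S \<le> 1"
  using joint_cover_number_le[of "{undefined}" "{}" \<U> S \<pi>] by simp

lemma joint_cover_number_UNION:
  assumes "finite I" "\<And>i. i \<in> I \<Longrightarrow> finite (J i)"
  shows "joint_cover_number \<pi> \<U> (\<Union>i\<in>I. J i) S \<le> (\<Prod>i\<in>I. joint_cover_number \<pi> \<U> (J i) S)"
  using assms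
proof (induction I)
  case empty
  then show ?case using joint_cover_number_empty by simp
next
  case (insert i I)
  have "joint_cover_number \<pi> \<U> (\<Union>i\<in>insert i I. J i) S
      \<le> joint_cover_number \<pi> \<U> (J i) S * joint_cover_number \<pi> \<U> (\<Union>i\<in>I. J i) S"
    using joint_cover_number_Un[of "J i" "\<Union>i\<in>I. J i"] insert by simp
  also have "\<dots> \<le> joint_cover_number \<pi> \<U> (J i) S * (\<Prod>i\<in>I. joint_cover_number \<pi> \<U> (J i) S)"
    using insert by (intro mult_left_mono) auto
  finally show ?case using insert by simp
qed

lemma joint_cover_number_le_power:
  assumes "finite J"
  shows "joint_cover_number \<pi> \<U> J S \<le> card \<U> ^ card J"
proof -
  obtain u where u: "\<And>y. y \<in> u y" "\<And>y. u y \<in> \<U>" using cover_choice[OF covers] by blast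
  have "joint_cover_number \<pi> \<U> J S \<le> card (J \<rightarrow>\<^sub>E \<U>)"
  proof (rule joint_cover_number_le)
    fix x show "\<exists>q\<in>J \<rightarrow>\<^sub>E \<U>. \<forall>j\<in>J. \<pi> j x \<in> q j"
      by (rule bexI[of _ "restrict (\<lambda>j. u (\<pi> j x)) J"]) (use u in auto)
  qed (use assms finite_cover in \<open>auto simp: finite_PiE\<close>)
  then show ?thesis using assms by (simp add: card_funcsetE)
qed

lemma joint_cover_number_Union_points:
  assumes "finite I" "finite J"
  shows "joint_cover_number \<pi> \<U> J (\<Union>i\<in>I. S i) \<le> (\<Sum>i\<in>I. joint_cover_number \<pi> \<U> J (S i))"
proof -
  have "\<forall>i. \<exists>Q. finite Q \<and> Q \<subseteq> Pi J (\<lambda>_. \<U>) \<and> card Q = joint_cover_number \<pi> \<U> J (S i) \<and>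
      (\<forall>x\<in>S i. \<exists>q\<in>Q. \<forall>j\<in>J. \<pi> j x \<in> q j)"
    using joint_cover_number_witness[OF assms(2)] by blast
  from choice[OF this] obtain Q where Q': "\<forall>i. finite (Q i) \<and> Q i \<subseteq> Pi J (\<lambda>_. \<U>) \<and>
      card (Q i) = joint_cover_number \<pi> \<U> J (S i) \<and> (\<forall>x\<in>S i. \<exists>q\<in>Q i. \<forall>j\<in>J. \<pi> j x \<in> q j)" ..
  have Q: "finite (Q i)" "Q i \<subseteq> Pi J (\<lambda>_. \<U>)" "card (Q i) = joint_cover_number \<pi> \<U> J (S i)"
      "x \<in> S i \<Longrightarrow> \<exists>q\<in>Q i. \<forall>j\<in>J. \<pi> j x \<in> q j" for i x
    using spec[OF Q', of i] by simp_all
  have "joint_cover_number \<pi> \<U> J (\<Union>i\<in>I. S i) \<le> card (\<Union>i\<in>I. Q i)"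
  proof (rule joint_cover_number_le)
    show "finite (\<Union>i\<in>I. Q i)" using assms Q(1) by simp
    show "(\<Union>i\<in>I. Q i) \<subseteq> Pi J (\<lambda>_. \<U>)" using Q(2) by blast
    fix x assume "x \<in> (\<Union>i\<in>I. S i)"
    then obtain i where i: "i \<in> I" "x \<in> S i" by blast
    then show "\<exists>q\<in>\<Union>i\<in>I. Q i. \<forall>j\<in>J. \<pi> j x \<in> q j" using Q(4)[OF i(2)] by blast
  qed
  also have "\<dots> \<le> (\<Sum>i\<in>I. card (Q i))" using assms by (intro card_UN_le) simp
  finally show ?thesis using Q(3) by simp
qed

text \<open>Pigeonhole: a member of an optimal family accommodates at most one point of
  \<open>Y\<close>. Finiteness is a separate conclusion because \<open>card\<close> is
  \<open>0\<close> on infinite sets. The map \<open>z\<close> allows \<open>Y\<close> to be a mere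
  index set, later a product of separated sets.\<close>

lemma joint_cover_number_ge_separated:
  assumes "finite J" "\<And>y. y \<in> Y \<Longrightarrow> z y \<in> S"
    and sep: "\<And>y y' q. y \<in> Y \<Longrightarrow> y' \<in> Y \<Longrightarrow> q \<in> Pi J (\<lambda>_. \<U>) \<Longrightarrow>
      (\<And>j. j \<in> J \<Longrightarrow> \<pi> j (z y) \<in> q j \<and> \<pi> j (z y') \<in> q j) \<Longrightarrow> y = y'"
  shows "card Y \<le> joint_cover_number \<pi> \<U> J S" and "finite Y"
proof -
  obtain Q where Q: "finite Q" "Q \<subseteq> Pi J (\<lambda>_. \<U>)" "card Q = joint_cover_number \<pi> \<U> J S"
      "\<And>x. x \<in> S \<Longrightarrow> \<exists>q\<in>Q. \<forall>j\<in>J. \<pi> j x \<in> q j"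
    using joint_cover_number_witness[OF assms(1), of \<pi> S]
    by (elim exE conjE) (rule that, assumption+, erule (1) bspec)
  have "\<forall>y\<in>Y. \<exists>q\<in>Q. \<forall>j\<in>J. \<pi> j (z y) \<in> q j" using Q(4) assms(2) by blast
  then obtain f where f: "\<And>y. y \<in> Y \<Longrightarrow> f y \<in> Q" "\<And>y j. y \<in> Y \<Longrightarrow> j \<in> J \<Longrightarrow> \<pi> j (z y) \<in> f y j"
    by metis
  have inj: "inj_on f Y"
  proof (rule inj_onI)
    fix y y' assume y: "y \<in> Y" "y' \<in> Y" "f y = f y'"
    show "y = y'" using sep[OF y(1,2), of "f y"] f y Q(2) by (metis subsetD)
  qed
  have "f ` Y \<subseteq> Q" using f by blast
  then show "card Y \<le> joint_cover_number \<pi> \<U> J S" "finite Y"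
    using card_inj_on_le[OF inj _ Q(1)] Q(3) inj_on_finite[OF inj _ Q(1)] by auto
qed

lemma joint_cover_number_pos:
  assumes "finite J" "S \<noteq> {}"
  shows "1 \<le> joint_cover_number \<pi> \<U> J S"
proof -
  obtain x where "x \<in> S" using assms by blast
  then show ?thesis
    using joint_cover_number_ge_separated(1)[OF assms(1), of "{x}" "\<lambda>x. x" S \<pi>] by simp
qed

end

section \<open>Quasi-tilings\<close>

text \<open>Take a family of centres that is maximal under inclusion, with union \<open>A\<close> of
  its tiles. If the tile at some centre met \<open>A\<close> in less than the fraction \<epsilon>,
  the rest of it could be added; so every tile meets \<open>A\<close> at least that often. Counting
  the pairs \<open>(s, c)\<close> with \<open>act s c \<in> A\<close> by \<open>s\<close> instead,
  where \<open>act s\<close> is injective on \<open>B\<close>, gives at most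
  \<open>card F * card A\<close> of them.\<close>

lemma greedy_tiling:
  fixes act :: "'g \<Rightarrow> 'd \<Rightarrow> 'e" and \<epsilon> :: real
  assumes "finite B" "finite F" "F \<noteq> {}" "0 < \<epsilon>" "\<epsilon> \<le> 1/2"
    and inj_F: "\<And>c. c \<in> B \<Longrightarrow> inj_on (\<lambda>s. act s c) F"
    and inj_B: "\<And>s. s \<in> F \<Longrightarrow> inj_on (act s) B"
  shows "\<exists>C T. C \<subseteq> B \<and> (\<forall>c\<in>C. T c \<subseteq> F \<and> (1 - \<epsilon>) * card F \<le> card (T c)) \<and>
    disjoint_family_on (\<lambda>c. (\<lambda>s. act s c) ` T c) C \<and>
    \<epsilon> * card B \<le> card (\<Union>c\<in>C. (\<lambda>s. act s c) ` T c)"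
proof -
  define admissible where "admissible C T \<longleftrightarrow> C \<subseteq> B \<and>
    (\<forall>c\<in>C. T c \<subseteq> F \<and> (1 - \<epsilon>) * card F \<le> card (T c)) \<and>
    disjoint_family_on (\<lambda>c. (\<lambda>s. act s c) ` T c) C" for C T
  define \<C> where "\<C> = {C. \<exists>T. admissible C T}"
  have "{} \<in> \<C>" by (simp add: \<C>_def admissible_def disjoint_family_on_def)
  then have "\<C> \<noteq> {}" by blast
  moreover have "finite \<C>"
    by (rule finite_subset[of _ "Pow B"]) (use assms(1) in \<open>auto simp: \<C>_def admissible_def\<close>)
  ultimately have "\<exists>C\<in>\<C>. \<forall>C'\<in>\<C>. C \<subseteq> C' \<longrightarrow> C = C'" by (intro finite_has_maximal)
  then obtain C where "C \<in> \<C>" and max: "\<And>C'. C' \<in> \<C> \<Longrightarrow> C \<subseteq> C' \<Longrightarrow> C = C'" by blast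
  then obtain T where T: "admissible C T" unfolding \<C>_def by blast
  define A where "A = (\<Union>c\<in>C. (\<lambda>s. act s c) ` T c)"
  have CB: "C \<subseteq> B" and TF: "\<And>c. c \<in> C \<Longrightarrow> T c \<subseteq> F"
    and Tcard: "\<And>c. c \<in> C \<Longrightarrow> (1 - \<epsilon>) * card F \<le> card (T c)"
    using T by (auto simp: admissible_def)
  have finA: "finite A"
    unfolding A_def using CB TF assms(1,2) by (meson finite_UN finite_imageI finite_subset)
  have hit: "\<epsilon> * card F \<le> card {s\<in>F. act s c \<in> A}" if c: "c \<in> B" for c
  proof (cases "c \<in> C")
    case True
    \<comment> \<open>A chosen tile contributes at least the fraction \<open>1 - \<epsilon>\<close>
      of its shape to \<open>A\<close>, and this is at least \<epsilon>.\<close>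
    have "\<epsilon> * card F \<le> (1 - \<epsilon>) * card F" using assms(5) by (intro mult_right_mono) auto
    also have "\<dots> \<le> card (T c)" using Tcard[OF True] .
    also have "card (T c) \<le> card {s\<in>F. act s c \<in> A}"
      using assms(2) TF[OF True] True by (intro card_mono) (auto simp: A_def)
    finally show ?thesis by simp
  next
    case False
    define R where "R = {s\<in>F. act s c \<notin> A}"
    have cards: "card F = card {s\<in>F. act s c \<in> A} + card R"
      unfolding R_def using assms(2)
      by (subst card_Un_disjoint[symmetric]) (auto intro!: arg_cong[where f=card])
    show ?thesis
    proof (rule ccontr)
      assume "\<not> ?thesis"
      then have R: "(1 - \<epsilon>) * card F \<le> card R" using cards by (simp add: algebra_simps)
      have "admissible (insert c C) (T(c := R))"
        unfolding admissible_def
      proof (intro conjI ballI)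
        show "insert c C \<subseteq> B" using CB c by simp
        show "(T(c := R)) x \<subseteq> F" "(1 - \<epsilon>) * card F \<le> card ((T(c := R)) x)"
          if "x \<in> insert c C" for x
          using that TF Tcard R by (auto simp: R_def)
        have "disjoint_family_on (\<lambda>c. (\<lambda>s. act s c) ` T c) C" using T by (simp add: admissible_def)
        moreover have "(\<lambda>s. act s x) ` (T(c := R)) x = (\<lambda>s. act s x) ` T x" if "x \<in> C" for x
          using that False by auto
        moreover have "(\<lambda>s. act s c) ` R \<inter> (\<lambda>s. act s x) ` T x = {}" if "x \<in> C" for x
          using that by (auto simp: R_def A_def)
        moreover from this have "(\<lambda>s. act s x) ` T x \<inter> (\<lambda>s. act s c) ` R = {}" if "x \<in> C" for x
          using that by blast
        ultimately show "disjoint_family_on (\<lambda>x. (\<lambda>s. act s x) ` (T(c := R)) x) (insert c C)"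
          using False by (simp add: disjoint_family_on_insert disjoint_family_on_def)
      qed
      then have "insert c C \<in> \<C>" unfolding \<C>_def by blast
      then have "C = insert c C" by (rule max) auto
      then show False using False by blast
    qed
  qed
  have "card F * (\<epsilon> * card B) = (\<Sum>c\<in>B. \<epsilon> * card F)" by simp
  also have "\<dots> \<le> (\<Sum>c\<in>B. real (card {s\<in>F. act s c \<in> A}))" using hit by (rule sum_mono)
  also have "\<dots> = real (\<Sum>c\<in>B. card {s\<in>F. act s c \<in> A})" by simp
  also have "(\<Sum>c\<in>B. card {s\<in>F. act s c \<in> A}) = (\<Sum>s\<in>F. card {c\<in>B. act s c \<in> A})"
    using assms(1,2) by (intro sum_multicount_gen) auto
  also have "real \<dots> \<le> real (\<Sum>s\<in>F. card A)"
  proof (intro of_nat_mono sum_mono)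
    fix s assume s: "s \<in> F"
    show "card {c\<in>B. act s c \<in> A} \<le> card A"
      by (rule card_inj_on_le[of "act s"]) (use inj_B[OF s] finA in \<open>auto intro: inj_on_subset\<close>)
  qed
  finally have "card F * (\<epsilon> * card B) \<le> card F * real (card A)" by simp
  then have "\<epsilon> * card B \<le> card A" using assms(2,3) by (simp add: mult_le_cancel_left card_gt_0_iff)
  then show ?thesis using T unfolding admissible_def A_def by blast
qed

text \<open>A pair \<open>(i, c)\<close> in \<open>I\<close> is a tile of shape \<open>F i\<close>
  centred at \<open>c\<close>, and \<open>T\<close> keeps the part of the shape that makes the tiles
  disjoint. \<epsilon> is the loss within each tile, \<rho> the uncovered fraction of
  \<open>D\<close>.\<close>

definition quasi_tiling ::
    "('g \<Rightarrow> 'd \<Rightarrow> 'd) \<Rightarrow> 'd set \<Rightarrow> 'd set \<Rightarrow> (nat \<Rightarrow> 'g set) \<Rightarrow> nat \<Rightarrow> real \<Rightarrow> real \<Rightarrow>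
      (nat \<times> 'd) set \<Rightarrow> (nat \<times> 'd \<Rightarrow> 'g set) \<Rightarrow> bool" where
  "quasi_tiling act D B F n \<epsilon> \<rho> I T \<longleftrightarrow>
     I \<subseteq> {..<n} \<times> B \<and>
     (\<forall>p\<in>I. T p \<subseteq> F (fst p) \<and> (1 - \<epsilon>) * card (F (fst p)) \<le> card (T p)) \<and>
     disjoint_family_on (\<lambda>p. (\<lambda>s. act s (snd p)) ` T p) I \<and>
     (1 - \<rho>) * card D \<le> card (\<Union>p\<in>I. (\<lambda>s. act s (snd p)) ` T p)"

text \<open>The elements of \<open>B\<close> are the admissible centres \<open>c\<close> of tiles \<open>{act s c : s \<in> F i}\<close>. The shapes are
  listed so that \<open>F i\<close> is almost invariant under all later ones, and are used in this order.\<close>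

locale tileable =
  fixes G :: "('g, 'b) monoid_scheme" (structure)
    and act :: "'g \<Rightarrow> 'd \<Rightarrow> 'd" and D B :: "'d set" and F :: "nat \<Rightarrow> 'g set" and n :: nat and \<epsilon> :: real
  assumes \<epsilon>: "0 < \<epsilon>" "\<epsilon> \<le> 1/2"
    and finD: "finite D" and BD: "B \<subseteq> D" and cardB: "(1 - \<epsilon>) * card D \<le> card B"
    and F: "\<And>i. i < n \<Longrightarrow> finite (F i)" "\<And>i. i < n \<Longrightarrow> F i \<noteq> {}"
    and act_in: "\<And>i s c. i < n \<Longrightarrow> s \<in> F i \<Longrightarrow> c \<in> B \<Longrightarrow> act s c \<in> D"
    and inj_F: "\<And>i c. i < n \<Longrightarrow> c \<in> B \<Longrightarrow> inj_on (\<lambda>s. act s c) (F i)"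
    and inj_B: "\<And>i s. i < n \<Longrightarrow> s \<in> F i \<Longrightarrow> inj_on (act s) B"
    and act_inv: "\<And>i j s t c c'. i < j \<Longrightarrow> j < n \<Longrightarrow> s \<in> F j \<Longrightarrow> t \<in> F i \<Longrightarrow> c \<in> B \<Longrightarrow> c' \<in> B \<Longrightarrow>
      act s c = act t c' \<Longrightarrow> c = act (inv s \<otimes> t) c'"
    and invariant: "\<And>i j. i < j \<Longrightarrow> j < n \<Longrightarrow>
      card ((\<lambda>(s, t). inv s \<otimes> t) ` (F j \<times> F i) - F i) \<le> \<epsilon> * card (F i)"
begin

lemma finite_B: "finite B" using finD BD by (rule rev_finite_subset)

context
  fixes m \<rho> I T
  assumes tiling: "quasi_tiling act D B F m \<epsilon> \<rho> I T" and mn: "m \<le> n"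
begin

lemma I_subset: "I \<subseteq> {..<m} \<times> B" and finite_I: "finite I"
proof -
  show I: "I \<subseteq> {..<m} \<times> B" using tiling by (simp add: quasi_tiling_def)
  then show "finite I" using finite_B by (meson finite_SigmaI finite_lessThan finite_subset)
qed

lemma I_less: "p \<in> I \<Longrightarrow> fst p < n" and I_centre: "p \<in> I \<Longrightarrow> snd p \<in> B"
  using I_subset mn by auto

lemma T_subset: "p \<in> I \<Longrightarrow> T p \<subseteq> F (fst p)"
  and card_T: "p \<in> I \<Longrightarrow> (1 - \<epsilon>) * card (F (fst p)) \<le> card (T p)"
  and disjoint_tiles: "disjoint_family_on (\<lambda>p. (\<lambda>s. act s (snd p)) ` T p) I"
  and covered_ge: "(1 - \<rho>) * card D \<le> card (\<Union>p\<in>I. (\<lambda>s. act s (snd p)) ` T p)"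
  using tiling by (auto simp: quasi_tiling_def)

lemma finite_T: "p \<in> I \<Longrightarrow> finite (T p)"
  using T_subset F(1) I_less by (meson finite_subset)

lemma inj_T: "p \<in> I \<Longrightarrow> inj_on (\<lambda>s. act s (snd p)) (T p)"
  using inj_F T_subset I_less I_centre by (meson inj_on_subset)

lemma covered_subset: "(\<Union>p\<in>I. (\<lambda>s. act s (snd p)) ` T p) \<subseteq> D"
  using T_subset act_in I_less I_centre by blast

lemma card_covered: "card (\<Union>p\<in>I. (\<lambda>s. act s (snd p)) ` T p) = (\<Sum>p\<in>I. card (T p))"
proof -
  have "card (\<Union>p\<in>I. (\<lambda>s. act s (snd p)) ` T p) = (\<Sum>p\<in>I. card ((\<lambda>s. act s (snd p)) ` T p))"
    using finite_I finite_T disjoint_tiles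
    by (intro card_UN_disjoint) (auto simp: disjoint_family_on_def)
  also have "\<dots> = (\<Sum>p\<in>I. card (T p))" using inj_T by (intro sum.cong card_image) auto
  finally show ?thesis .
qed

lemma sum_card_F_le: "(1 - \<epsilon>) * (\<Sum>p\<in>I. card (F (fst p))) \<le> card D"
proof -
  have "(1 - \<epsilon>) * (\<Sum>p\<in>I. card (F (fst p))) = (\<Sum>p\<in>I. (1 - \<epsilon>) * card (F (fst p)))"
    by (simp add: sum_distrib_left)
  also have "\<dots> \<le> (\<Sum>p\<in>I. real (card (T p)))" using card_T by (rule sum_mono)
  also have "\<dots> = card (\<Union>p\<in>I. (\<lambda>s. act s (snd p)) ` T p)" by (simp add: card_covered)
  also have "\<dots> \<le> card D" using card_mono[OF finD covered_subset] by simp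
  finally show ?thesis .
qed

lemma sum_card_F_le_double: "(\<Sum>p\<in>I. card (F (fst p))) \<le> 2 * real (card D)"
proof -
  have "1/2 * real (\<Sum>p\<in>I. card (F (fst p))) \<le> (1 - \<epsilon>) * (\<Sum>p\<in>I. card (F (fst p)))"
    using \<epsilon> by (intro mult_right_mono) (auto simp: sum_nonneg)
  with sum_card_F_le show ?thesis by simp
qed

lemma sum_card_F_le_add: "(\<Sum>p\<in>I. card (F (fst p))) \<le> (1 + 2 * \<epsilon>) * card D"
proof -
  \<comment> \<open>\<open>(1 + 2 * \<epsilon>) * (1 - \<epsilon>) = 1 + \<epsilon> * (1 - 2 *
    \<epsilon>)\<close>, which is at least \<open>1\<close> for
    \<open>\<epsilon> \<le> 1/2\<close>.\<close>
  have "1 * real (\<Sum>p\<in>I. card (F (fst p))) \<le> ((1 + 2 * \<epsilon>) * (1 - \<epsilon>)) * (\<Sum>p\<in>I. card (F (fst p)))"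
    using \<epsilon> by (intro mult_right_mono) (auto simp: algebra_simps sum_nonneg mult_left_le)
  also have "\<dots> \<le> (1 + 2 * \<epsilon>) * card D"
    using sum_card_F_le \<epsilon> by (simp add: mult.assoc)
  finally show ?thesis by simp
qed

lemma sum_card_F_ge: "(1 - \<rho>) * card D \<le> (\<Sum>p\<in>I. card (F (fst p)))"
proof -
  have "(\<Sum>p\<in>I. card (T p)) \<le> (\<Sum>p\<in>I. card (F (fst p)))"
    using T_subset F I_less by (intro sum_mono card_mono) auto
  then show ?thesis using covered_ge card_covered by linarith
qed

lemma card_uncovered: "card (D - (\<Union>p\<in>I. (\<lambda>s. act s (snd p)) ` T p)) \<le> \<rho> * card D"
proof -
  let ?A = "\<Union>p\<in>I. (\<lambda>s. act s (snd p)) ` T p"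
  have "card (D - ?A) = real (card D) - card ?A"
    using card_Diff_subset[OF finite_subset[OF covered_subset finD] covered_subset]
      card_mono[OF finD covered_subset] by (simp add: of_nat_diff)
  then show ?thesis using covered_ge by (simp add: algebra_simps)
qed

lemma card_F_Diff_T:
  assumes "p \<in> I"
  shows "card (F (fst p) - T p) \<le> \<epsilon> * card (F (fst p))"
proof -
  have "card (F (fst p) - T p) = real (card (F (fst p))) - card (T p)"
    using card_Diff_subset[OF finite_T T_subset] card_mono[OF F(1)[OF I_less] T_subset] assms
    by (simp add: of_nat_diff)
  then show ?thesis using card_T[OF assms] by (simp add: algebra_simps)
qed

text \<open>A tile of shape \<open>F m\<close> can only meet the covered set \<open>A\<close> if its centre lies in \<open>A\<close> or in the
  \<open>F m\<close>-boundary of one of the earlier tiles, and these are almost invariant under \<open>F m\<close>.\<close>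

lemma quasi_tiling_extend:
  assumes "m < n"
  shows "\<exists>I' T'. quasi_tiling act D B F (Suc m) \<epsilon> ((1 - \<epsilon>) * \<rho> + 5 * \<epsilon>\<^sup>2) I' T'"
proof -
  define A where "A = (\<Union>p\<in>I. (\<lambda>s. act s (snd p)) ` T p)"
  \<comment> \<open>Tiles of shape \<open>F m\<close> at these centres avoid all earlier tiles, so
    the greedy selection has only conflicts within one shape to resolve.\<close>
  define B' where "B' = {c\<in>B. \<forall>s\<in>F m. act s c \<notin> A}"
  define X where "X p = (\<lambda>(s, t). inv s \<otimes> t) ` (F m \<times> F (fst p)) - T p" for p
  have AD: "A \<subseteq> D" unfolding A_def by (rule covered_subset)
  then have finA: "finite A" using finD finite_subset by blast
  have finX: "finite (X p)" if "p \<in> I" for p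
    unfolding X_def using F(1) assms I_less[OF that] by (intro finite_Diff finite_imageI) auto
  \<comment> \<open>One \<epsilon> is the invariance of the full shape, the other the part of the
    shape that \<open>T p\<close> has lost.\<close>
  have cardX: "card (X p) \<le> 2 * \<epsilon> * card (F (fst p))" if p: "p \<in> I" for p
  proof -
    let ?Y = "(\<lambda>(s, t). inv s \<otimes> t) ` (F m \<times> F (fst p)) - F (fst p)"
    have "fst p < m" using I_subset p by auto
    have fin: "finite ?Y" using F(1) assms I_less[OF p] by (intro finite_Diff finite_imageI) auto
    have "card (X p) \<le> card (?Y \<union> (F (fst p) - T p))"
      using fin F(1)[OF I_less[OF p]] by (intro card_mono) (auto simp: X_def)
    also have "\<dots> \<le> card ?Y + card (F (fst p) - T p)" by (rule card_Un_le)
    finally show ?thesis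
      using invariant[OF \<open>fst p < m\<close> assms] card_F_Diff_T[OF p] by linarith
  qed
  have "B - B' \<subseteq> A \<union> (\<Union>p\<in>I. (\<lambda>u. act u (snd p)) ` X p)"
  proof
    fix c assume c: "c \<in> B - B'"
    then obtain s where s: "s \<in> F m" "act s c \<in> A" by (auto simp: B'_def)
    then obtain p t where p: "p \<in> I" "t \<in> T p" "act s c = act t (snd p)" by (auto simp: A_def)
    have "fst p < m" using I_subset p by auto
    have t: "t \<in> F (fst p)" using T_subset p by blast
    have ceq: "c = act (inv s \<otimes> t) (snd p)"
      using act_inv[OF \<open>fst p < m\<close> assms s(1) t _ I_centre[OF p(1)] p(3)] c by simp
    show "c \<in> A \<union> (\<Union>p\<in>I. (\<lambda>u. act u (snd p)) ` X p)"
    proof (cases "inv s \<otimes> t \<in> T p")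
      case True
      then show ?thesis using ceq p(1) unfolding A_def by blast
    next
      case False
      then have "inv s \<otimes> t \<in> X p" using s t by (auto simp: X_def)
      then show ?thesis using ceq p(1) by blast
    qed
  qed
  then have "card (B - B') \<le> card (A \<union> (\<Union>p\<in>I. (\<lambda>u. act u (snd p)) ` X p))"
    using finA finite_I finX by (intro card_mono) auto
  also have "\<dots> \<le> card A + card (\<Union>p\<in>I. (\<lambda>u. act u (snd p)) ` X p)" by (rule card_Un_le)
  also have "card (\<Union>p\<in>I. (\<lambda>u. act u (snd p)) ` X p) \<le> (\<Sum>p\<in>I. card ((\<lambda>u. act u (snd p)) ` X p))"
    using finite_I by (rule card_UN_le)
  also have "\<dots> \<le> (\<Sum>p\<in>I. card (X p))" using finX by (intro sum_mono card_image_le) auto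
  finally have BB': "real (card (B - B')) \<le> card A + (\<Sum>p\<in>I. real (card (X p)))"
    by (simp flip: of_nat_sum)
  have "(\<Sum>p\<in>I. real (card (X p))) \<le> (\<Sum>p\<in>I. 2 * \<epsilon> * card (F (fst p)))" using cardX by (rule sum_mono)
  also have "\<dots> = 2 * \<epsilon> * (\<Sum>p\<in>I. card (F (fst p)))" by (simp add: sum_distrib_left)
  also have "\<dots> \<le> 2 * \<epsilon> * (2 * real (card D))"
    using sum_card_F_le_double \<epsilon> by (intro mult_left_mono) auto
  finally have "real (card (B - B')) \<le> card A + 4 * \<epsilon> * card D" using BB' by simp
  moreover have "card B \<le> card (B - B') + card B'"
    using card_Un_le[of "B - B'" B'] by (simp add: B'_def Un_absorb2 subset_iff)
  \<comment> \<open>The \<open>5\<close> is \<open>4\<close> for the boundaries, of relative size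
    \<open>2 * \<epsilon>\<close> for shapes of total size at most \<open>2 * card D\<close>, plus
    \<open>1\<close> for the points of \<open>D\<close> outside \<open>B\<close>.\<close>
  ultimately have cardB': "card B' \<ge> (1 - 5 * \<epsilon>) * card D - card A"
    using cardB by (simp add: algebra_simps)
  have B'B: "B' \<subseteq> B" by (auto simp: B'_def)
  have "\<exists>C S. C \<subseteq> B' \<and> (\<forall>c\<in>C. S c \<subseteq> F m \<and> (1 - \<epsilon>) * card (F m) \<le> card (S c)) \<and>
    disjoint_family_on (\<lambda>c. (\<lambda>s. act s c) ` S c) C \<and>
    \<epsilon> * card B' \<le> card (\<Union>c\<in>C. (\<lambda>s. act s c) ` S c)"
  proof (rule greedy_tiling)
    show "finite B'" using B'B finite_B by (rule finite_subset)
    show "inj_on (act s) B'" if "s \<in> F m" for s using inj_B[OF assms that] B'B by (rule inj_on_subset)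
  qed (use F assms \<epsilon> inj_F B'B in auto)
  then obtain C S where C: "C \<subseteq> B'" "\<And>c. c \<in> C \<Longrightarrow> S c \<subseteq> F m"
      "\<And>c. c \<in> C \<Longrightarrow> (1 - \<epsilon>) * card (F m) \<le> card (S c)"
      "disjoint_family_on (\<lambda>c. (\<lambda>s. act s c) ` S c) C"
      "\<epsilon> * card B' \<le> card (\<Union>c\<in>C. (\<lambda>s. act s c) ` S c)" by blast
  define A1 where "A1 = (\<Union>c\<in>C. (\<lambda>s. act s c) ` S c)"
  have A1D: "A1 \<subseteq> D" unfolding A1_def using C(1,2) act_in[OF assms] B'B by blast
  have A1A: "A1 \<inter> A = {}" unfolding A1_def using C(1,2) by (auto simp: B'_def)
  define I' where "I' = I \<union> {m} \<times> C"
  define T' where "T' p = (if fst p = m then S (snd p) else T p)" for p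
  have fst_I: "fst p \<noteq> m" if "p \<in> I" for p using I_subset that by auto
  have cover: "(\<Union>p\<in>I'. (\<lambda>s. act s (snd p)) ` T' p) = A \<union> A1"
    using fst_I by (auto simp: I'_def T'_def A_def A1_def)
  have "quasi_tiling act D B F (Suc m) \<epsilon> ((1 - \<epsilon>) * \<rho> + 5 * \<epsilon>\<^sup>2) I' T'"
    unfolding quasi_tiling_def
  proof (intro conjI ballI)
    show "I' \<subseteq> {..<Suc m} \<times> B" using I_subset C(1) B'B by (auto simp: I'_def)
    have T': "T' p \<subseteq> F (fst p) \<and> (1 - \<epsilon>) * card (F (fst p)) \<le> card (T' p)" if p: "p \<in> I'" for p
    proof (cases "p \<in> I")
      case True
      then show ?thesis using T_subset card_T fst_I[OF True] by (simp add: T'_def)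
    next
      case False
      then have "fst p = m" "snd p \<in> C" using p by (auto simp: I'_def)
      then show ?thesis using C(2,3) by (simp add: T'_def)
    qed
    show "T' p \<subseteq> F (fst p)" "(1 - \<epsilon>) * card (F (fst p)) \<le> card (T' p)" if "p \<in> I'" for p
      using T'[OF that] by simp_all
    show "disjoint_family_on (\<lambda>p. (\<lambda>s. act s (snd p)) ` T' p) I'"
      unfolding disjoint_family_on_def
    proof (intro ballI impI)
      fix p q assume pq: "p \<in> I'" "q \<in> I'" "p \<noteq> q"
      have old: "(\<lambda>s. act s (snd p)) ` T' p \<subseteq> A" if "p \<in> I" for p
        using that fst_I by (auto simp: T'_def A_def)
      have new: "(\<lambda>s. act s (snd p)) ` T' p \<subseteq> A1" if "p \<in> {m} \<times> C" for p
        using that by (auto simp: T'_def A1_def)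
      consider "p \<in> I" "q \<in> I" | "p \<in> I" "q \<in> {m} \<times> C" | "p \<in> {m} \<times> C" "q \<in> I" |
        "p \<in> {m} \<times> C" "q \<in> {m} \<times> C" using pq by (auto simp: I'_def)
      then show "(\<lambda>s. act s (snd p)) ` T' p \<inter> (\<lambda>s. act s (snd q)) ` T' q = {}"
      proof cases
        case 1
        then show ?thesis using disjoint_tiles pq(3) fst_I by (auto simp: T'_def disjoint_family_on_def)
      next
        case 2
        then show ?thesis using old new A1A by blast
      next
        case 3
        then show ?thesis using old new A1A by blast
      next
        case 4
        then have "snd p \<in> C" "snd q \<in> C" "snd p \<noteq> snd q" "fst p = m" "fst q = m"
          using pq(3) by auto
        then show ?thesis using C(4) by (simp add: T'_def disjoint_family_on_def)
      qed
    qed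
    \<comment> \<open>The covered part is now at least \<open>(1 - \<epsilon>) * card A + \<epsilon>
      * (1 - 5 * \<epsilon>) * card D\<close>; inserting
      \<open>card A \<ge> (1 - \<rho>) * card D\<close> gives the new uncovered fraction.\<close>
    have "real (card (A \<union> A1)) = card A + card A1"
      using finA finite_subset[OF A1D finD] A1A by (subst card_Un_disjoint) auto
    moreover have "card A1 \<ge> \<epsilon> * ((1 - 5 * \<epsilon>) * card D - card A)"
      using C(5) cardB' \<epsilon> by (auto simp: A1_def intro: order_trans[OF mult_left_mono])
    moreover have "(1 - \<epsilon>) * ((1 - \<rho>) * card D) \<le> (1 - \<epsilon>) * card A"
      using covered_ge \<epsilon> by (intro mult_left_mono) (auto simp: A_def)
    ultimately show "(1 - ((1 - \<epsilon>) * \<rho> + 5 * \<epsilon>\<^sup>2)) * card D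
        \<le> card (\<Union>p\<in>I'. (\<lambda>s. act s (snd p)) ` T' p)"
      unfolding cover by (simp add: algebra_simps power2_eq_square)
  qed
  then show ?thesis by blast
qed

end

text \<open>The map \<open>\<rho> \<mapsto> (1 - \<epsilon>) * \<rho> + 5 *
  \<epsilon>\<^sup>2\<close> has the fixed point \<open>5 * \<epsilon>\<close>, and the distance to
  it shrinks by the factor \<open>1 - \<epsilon>\<close> with each shape. The empty tiling starts at
  \<open>1 + 5 * \<epsilon>\<close>, where the covering condition is trivial.\<close>

lemma quasi_tiling_exists:
  assumes "m \<le> n"
  shows "\<exists>I T. quasi_tiling act D B F m \<epsilon> ((1 - \<epsilon>) ^ m + 5 * \<epsilon>) I T"
  using assms
proof (induction m)
  case 0
  have "quasi_tiling act D B F 0 \<epsilon> ((1 - \<epsilon>) ^ 0 + 5 * \<epsilon>) {} (\<lambda>_. {})"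
    using \<epsilon> by (simp add: quasi_tiling_def disjoint_family_on_def mult_nonpos_nonneg)
  then show ?case by blast
next
  case (Suc m)
  then obtain I T where "quasi_tiling act D B F m \<epsilon> ((1 - \<epsilon>) ^ m + 5 * \<epsilon>) I T" by auto
  from quasi_tiling_extend[OF this] Suc.prems
  have "\<exists>I T. quasi_tiling act D B F (Suc m) \<epsilon>
      ((1 - \<epsilon>) * ((1 - \<epsilon>) ^ m + 5 * \<epsilon>) + 5 * \<epsilon>\<^sup>2) I T" by simp
  moreover have "(1 - \<epsilon>) * ((1 - \<epsilon>) ^ m + 5 * \<epsilon>) + 5 * \<epsilon>\<^sup>2 = (1 - \<epsilon>) ^ Suc m + 5 * \<epsilon>"
    by (simp add: algebra_simps power2_eq_square)
  ultimately show ?case by simp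
qed

end

section \<open>Folner tiles and the Ornstein-Weiss limit\<close>

definition product_boundary :: "('g, 'b) monoid_scheme \<Rightarrow> 'g set \<Rightarrow> 'g set \<Rightarrow> 'g set" where
  "product_boundary G K F = (\<lambda>(s, t). s \<otimes>\<^bsub>G\<^esub> t) ` (K \<times> F) - F"

lemma folner_sequence_finite:
  assumes "folner_sequence G Fs"
  shows "finite (Fs n)" "Fs n \<noteq> {}" "Fs n \<subseteq> carrier G" "0 < card (Fs n)"
  using assms by (auto simp: folner_sequence_def finite_nonempty_subsets_def card_gt_0_iff)

lemma folner_translates_small:
  fixes \<epsilon> :: real
  assumes "folner_sequence G Fs" "finite K" "K \<subseteq> carrier G" "0 < \<epsilon>"
  shows "\<forall>\<^sub>F n in sequentially.
    (\<Sum>s\<in>K. real (card ((s <#\<^bsub>G\<^esub> Fs n) - Fs n))) \<le> \<epsilon> * card (Fs n)"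
proof -
  let ?f = "\<lambda>n. \<Sum>s\<in>K. real (card (sym_diff (s <#\<^bsub>G\<^esub> Fs n) (Fs n))) / real (card (Fs n))"
  have "?f \<longlonglongrightarrow> (\<Sum>s\<in>K. 0)"
    using assms by (intro tendsto_sum) (auto simp: folner_sequence_def)
  then have "\<forall>\<^sub>F n in sequentially. ?f n < \<epsilon>" using assms(4) by (auto dest: order_tendstoD)
  then show ?thesis
  proof (rule eventually_mono)
    fix n assume n: "?f n < \<epsilon>"
    have pos: "0 < real (card (Fs n))" using folner_sequence_finite[OF assms(1)] by simp
    have "finite (s <#\<^bsub>G\<^esub> Fs n)" for s
      using folner_sequence_finite(1)[OF assms(1)] by (simp add: l_coset_def)
    then have "(\<Sum>s\<in>K. real (card ((s <#\<^bsub>G\<^esub> Fs n) - Fs n)))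
        \<le> (\<Sum>s\<in>K. real (card (sym_diff (s <#\<^bsub>G\<^esub> Fs n) (Fs n))))"
      using folner_sequence_finite(1)[OF assms(1)] by (intro sum_mono of_nat_mono card_mono) auto
    also have "\<dots> = ?f n * card (Fs n)" using pos by (simp add: sum_divide_distrib[symmetric])
    also have "\<dots> \<le> \<epsilon> * card (Fs n)" using n pos by (intro mult_right_mono) auto
    finally show "(\<Sum>s\<in>K. real (card ((s <#\<^bsub>G\<^esub> Fs n) - Fs n))) \<le> \<epsilon> * card (Fs n)" .
  qed
qed

lemma folner_boundary_small:
  fixes \<epsilon> :: real
  assumes "folner_sequence G Fs" "finite K" "K \<subseteq> carrier G" "0 < \<epsilon>"
  shows "\<forall>\<^sub>F n in sequentially. card (product_boundary G K (Fs n)) \<le> \<epsilon> * card (Fs n)"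
  using folner_translates_small[OF assms]
proof (rule eventually_mono)
  fix n assume n: "(\<Sum>s\<in>K. real (card ((s <#\<^bsub>G\<^esub> Fs n) - Fs n))) \<le> \<epsilon> * card (Fs n)"
  have "product_boundary G K (Fs n) = (\<Union>s\<in>K. (s <#\<^bsub>G\<^esub> Fs n) - Fs n)"
    by (auto simp: product_boundary_def l_coset_def)
  then have "card (product_boundary G K (Fs n)) \<le> (\<Sum>s\<in>K. card ((s <#\<^bsub>G\<^esub> Fs n) - Fs n))"
    using card_UN_le[OF assms(2)] by metis
  then show "card (product_boundary G K (Fs n)) \<le> \<epsilon> * card (Fs n)"
    using n by (simp flip: of_nat_sum)
qed

lemma folner_sequence_subseq:
  assumes "folner_sequence G Fs" "strict_mono r"
  shows "folner_sequence G (Fs \<circ> r)"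
  using assms by (auto simp: folner_sequence_def o_def
      intro: LIMSEQ_subseq_LIMSEQ[where f=r, unfolded o_def])

text \<open>The first conjunct says that there are enough shapes to push the uncovered fraction down
  to \<open>6 * \<epsilon>\<close>. Inverses occur because tiles at \<open>c\<close> and
  \<open>c'\<close> collide when \<open>c\<close> is moved from \<open>c'\<close> by
  \<open>inv s \<otimes> t\<close>.\<close>

definition invariant_tiles :: "('g, 'b) monoid_scheme \<Rightarrow> (nat \<Rightarrow> 'g set) \<Rightarrow> nat \<Rightarrow> real \<Rightarrow> bool" where
  "invariant_tiles G F n \<epsilon> \<longleftrightarrow> (1 - \<epsilon>) ^ n \<le> \<epsilon> \<and> (\<forall>i<n. F i \<in> finite_nonempty_subsets G) \<and>
     (\<forall>i j. i < j \<longrightarrow> j < n \<longrightarrow>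
       real (card (product_boundary G (m_inv G ` F j) (F i))) \<le> \<epsilon> * card (F i))"

text \<open>The Folner sets are selected from the smallest one upwards, each of them almost invariant
  under the previous ones, and then listed in the opposite order, the order of the tiling.\<close>

lemma folner_invariant_tiles:
  fixes \<epsilon> :: real
  assumes "group G" "folner_sequence G Fs" "0 < \<epsilon>" "\<epsilon> \<le> 1/2" "eventually P sequentially"
  shows "\<exists>n F. invariant_tiles G F n \<epsilon> \<and> (\<forall>i<n. \<exists>k. P k \<and> F i = Fs k)"
proof -
  interpret group G by fact
  let ?inv = "\<lambda>i k. card (product_boundary G (m_inv G ` Fs i) (Fs k)) \<le> \<epsilon> * card (Fs k)"
  obtain n0 where n0: "\<And>k. n0 \<le> k \<Longrightarrow> P k" using assms(5) by (auto simp: eventually_sequentially)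
  obtain n where n: "(1 - \<epsilon>) ^ n < \<epsilon>" using real_arch_pow_inv[of \<epsilon> "1 - \<epsilon>"] assms(3) by auto
  have "\<forall>\<^sub>F k in sequentially. ?inv i k" for i
    using folner_sequence_finite[OF assms(2)] assms(3)
    by (intro folner_boundary_small[OF assms(2)]) (auto intro!: inv_closed)
  then have "\<forall>\<^sub>F k in sequentially. \<forall>i\<in>{..M}. ?inv i k" for M by (intro eventually_ball_finite) auto
  then have "\<forall>M. \<exists>N. \<forall>k\<ge>N. \<forall>i\<in>{..M}. ?inv i k" by (simp add: eventually_sequentially)
  then obtain \<psi> where \<psi>: "\<And>M k i. \<psi> M \<le> k \<Longrightarrow> i \<le> M \<Longrightarrow> ?inv i k" by (metis atMost_iff)
  \<comment> \<open>Beyond \<open>\<psi> M\<close> the Folner sets are almost invariant under every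
    \<open>Fs i\<close> with \<open>i \<le> M\<close>. So each index only has to pass the threshold
    of its predecessor, and starting at \<open>n0\<close> secures \<open>P\<close>.\<close>
  define \<kappa> where "\<kappa> = rec_nat n0 (\<lambda>_ k. max (Suc k) (\<psi> k))"
  have \<kappa>_Suc: "\<kappa> (Suc j) = max (Suc (\<kappa> j)) (\<psi> (\<kappa> j))" and \<kappa>_0: "\<kappa> 0 = n0" for j
    by (simp_all add: \<kappa>_def)
  have mono: "\<kappa> i \<le> \<kappa> j" if "i \<le> j" for i j
    by (rule lift_Suc_mono_le[OF _ that]) (simp add: \<kappa>_Suc)
  have inv: "?inv (\<kappa> i) (\<kappa> j)" if "i < j" for i j
  proof -
    obtain j' where j': "j = Suc j'" using \<open>i < j\<close> by (cases j) auto
    show ?thesis by (rule \<psi>[of "\<kappa> j'"]) (use that mono[of i j'] in \<open>auto simp: j' \<kappa>_Suc\<close>)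
  qed
  let ?F = "\<lambda>i. Fs (\<kappa> (n - 1 - i))"
  have "invariant_tiles G ?F n \<epsilon>"
    unfolding invariant_tiles_def
    using n assms(2) inv by (auto simp: folner_sequence_def)
  moreover have "\<exists>k. P k \<and> ?F i = Fs k" for i
    using n0[of "\<kappa> (n - 1 - i)"] mono[of 0 "n - 1 - i"] \<kappa>_0 by auto
  ultimately show ?thesis by blast
qed

text \<open>Left multiplication does not preserve \<open>Fs k\<close>, so the centres are the points
  that no element of any shape moves out. Those excluded by \<open>s\<close> are mapped injectively
  by \<open>s\<close> into \<open>(s <# Fs k) - Fs k\<close>, which the Folner condition makes
  small; the remaining conditions are cancellation in the group.\<close>

lemma folner_tileable:
  fixes \<epsilon> :: real
  assumes "group G" "folner_sequence G Fs" "0 < \<epsilon>" "\<epsilon> \<le> 1/2" "invariant_tiles G F n \<epsilon>"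
  shows "\<forall>\<^sub>F k in sequentially. \<exists>B. tileable G (\<lambda>s c. s \<otimes>\<^bsub>G\<^esub> c) (Fs k) B F n \<epsilon>"
proof -
  interpret group G by fact
  define K where "K = (\<Union>i<n. F i)"
  have F: "finite (F i)" "F i \<noteq> {}" "F i \<subseteq> carrier G" if "i < n" for i
    using assms(5) that by (auto simp: invariant_tiles_def finite_nonempty_subsets_def)
  have K: "finite K" "K \<subseteq> carrier G" using F by (auto simp: K_def)
  show ?thesis using folner_translates_small[OF assms(2) K assms(3)]
  proof (rule eventually_mono)
    fix k assume k: "(\<Sum>s\<in>K. real (card ((s <#\<^bsub>G\<^esub> Fs k) - Fs k))) \<le> \<epsilon> * card (Fs k)"
    define B where "B = {c\<in>Fs k. \<forall>s\<in>K. s \<otimes>\<^bsub>G\<^esub> c \<in> Fs k}"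
    note Fk = folner_sequence_finite[OF assms(2), of k]
    have BC: "c \<in> carrier G" if "c \<in> B" for c using that Fk by (auto simp: B_def)
    have "card (Fs k - B) \<le> card (\<Union>s\<in>K. {c\<in>Fs k. s \<otimes>\<^bsub>G\<^esub> c \<notin> Fs k})"
      using Fk K by (intro card_mono) (auto simp: B_def)
    also have "\<dots> \<le> (\<Sum>s\<in>K. card {c\<in>Fs k. s \<otimes>\<^bsub>G\<^esub> c \<notin> Fs k})" using K by (intro card_UN_le)
    also have "\<dots> \<le> (\<Sum>s\<in>K. card ((s <#\<^bsub>G\<^esub> Fs k) - Fs k))"
    proof (rule sum_mono)
      fix s assume s: "s \<in> K"
      show "card {c\<in>Fs k. s \<otimes>\<^bsub>G\<^esub> c \<notin> Fs k} \<le> card ((s <#\<^bsub>G\<^esub> Fs k) - Fs k)"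
      proof (rule card_inj_on_le[where f="\<lambda>c. s \<otimes>\<^bsub>G\<^esub> c"])
        show "inj_on (\<lambda>c. s \<otimes>\<^bsub>G\<^esub> c) {c\<in>Fs k. s \<otimes>\<^bsub>G\<^esub> c \<notin> Fs k}"
          by (rule inj_on_subset[OF inj_on_cmult]) (use s K Fk in auto)
      qed (use Fk in \<open>auto simp: l_coset_def\<close>)
    qed
    finally have "card (Fs k - B) \<le> \<epsilon> * card (Fs k)" using k by (simp flip: of_nat_sum)
    moreover have "card (Fs k) = card (Fs k - B) + card B"
      using Fk by (subst card_Un_disjoint[symmetric]) (auto simp: B_def intro!: arg_cong[where f=card])
    ultimately have cardB: "(1 - \<epsilon>) * card (Fs k) \<le> card B" by (simp add: algebra_simps)
    have "tileable G (\<lambda>s c. s \<otimes>\<^bsub>G\<^esub> c) (Fs k) B F n \<epsilon>"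
    proof
      show "s \<otimes>\<^bsub>G\<^esub> c \<in> Fs k" if "i < n" "s \<in> F i" "c \<in> B" for i s c
        using that by (auto simp: B_def K_def)
      show "inj_on (\<lambda>s. s \<otimes>\<^bsub>G\<^esub> c) (F i)" if "i < n" "c \<in> B" for i c
        using inj_on_multc[OF BC[OF that(2)]] F(3)[OF that(1)] by (rule inj_on_subset)
      show "inj_on ((\<otimes>\<^bsub>G\<^esub>) s) B" if "i < n" "s \<in> F i" for i s
        by (rule inj_on_subset[OF inj_on_cmult]) (use F(3)[OF that(1)] that(2) BC in auto)
      show "c = inv\<^bsub>G\<^esub> s \<otimes>\<^bsub>G\<^esub> t \<otimes>\<^bsub>G\<^esub> c'" if "i < j" "j < n" "s \<in> F j" "t \<in> F i" "c \<in> B" "c' \<in> B"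
          "s \<otimes>\<^bsub>G\<^esub> c = t \<otimes>\<^bsub>G\<^esub> c'" for i j s t c c'
      proof -
        have "s \<in> carrier G" "t \<in> carrier G" using F(3)[of i] F(3)[of j] that by auto
        then show ?thesis using that BC by (metis inv_closed inv_solve_left m_assoc m_closed)
      qed
      show "card ((\<lambda>(s, t). inv\<^bsub>G\<^esub> s \<otimes>\<^bsub>G\<^esub> t) ` (F j \<times> F i) - F i) \<le> \<epsilon> * card (F i)"
        if "i < j" "j < n" for i j
      proof -
        have "(\<lambda>(s, t). inv\<^bsub>G\<^esub> s \<otimes>\<^bsub>G\<^esub> t) ` (F j \<times> F i) = (\<lambda>(s, t). s \<otimes>\<^bsub>G\<^esub> t) ` (m_inv G ` F j \<times> F i)"
          by force
        then show ?thesis using assms(5) that by (simp add: invariant_tiles_def product_boundary_def)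
      qed
    qed (use assms Fk F cardB in \<open>auto simp: B_def\<close>)
    then show "\<exists>B. tileable G (\<lambda>s c. s \<otimes>\<^bsub>G\<^esub> c) (Fs k) B F n \<epsilon>" by blast
  qed
qed

lemma (in tileable) quasi_tiling_exists_small:
  assumes "(1 - \<epsilon>) ^ n \<le> \<epsilon>"
  shows "\<exists>I T. quasi_tiling act D B F n \<epsilon> (6 * \<epsilon>) I T"
proof -
  obtain I T where IT: "quasi_tiling act D B F n \<epsilon> ((1 - \<epsilon>) ^ n + 5 * \<epsilon>) I T"
    using quasi_tiling_exists by blast
  have "(1 - 6 * \<epsilon>) * card D \<le> (1 - ((1 - \<epsilon>) ^ n + 5 * \<epsilon>)) * card D"
    using assms by (intro mult_right_mono) auto
  then have "quasi_tiling act D B F n \<epsilon> (6 * \<epsilon>) I T"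
    using IT unfolding quasi_tiling_def by linarith
  then show ?thesis by blast
qed

lemma mono_log_card: "mono log_card"
  by (auto simp: log_card_def intro!: monoI)

text \<open>Written with \<open>exp\<close>, upper bounds need no separate case for an empty model,
  whose logarithm is \<open>-\<infinity>\<close>.\<close>

lemma log_card_le_iff_exp: "log_card k \<le> ereal y \<longleftrightarrow> real k \<le> exp y"
  using ln_ge_iff[of "real k" y] exp_le_cancel_iff[of "ln (real k)" y]
  by (cases "k = 0") (auto simp: log_card_def)

section \<open>Conditional covering numbers of orbit pieces\<close>

locale covered_action =
  fixes G :: "('g, 'b) monoid_scheme" (structure)
    and \<phi> :: "'g \<Rightarrow> 'x \<Rightarrow> 'x" and \<W>\<^sub>1 \<W>\<^sub>2 :: "'x set set"
  assumes group_action: "group_action G UNIV \<phi>"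
    and cover\<^sub>1: "finite_cover \<W>\<^sub>1" and cover\<^sub>2: "finite_cover \<W>\<^sub>2"
begin

sublocale c1: finite_cover \<W>\<^sub>1 by (rule cover\<^sub>1)
sublocale c2: finite_cover \<W>\<^sub>2 by (rule cover\<^sub>2)

lemma is_group: "group G"
  using group_action group_action.group_hom group_hom.axioms(1) by blast

lemma \<phi>_mult: "s \<in> carrier G \<Longrightarrow> t \<in> carrier G \<Longrightarrow> \<phi> (s \<otimes> t) x = \<phi> s (\<phi> t x)"
  using group_action.composition_rule[OF group_action] by simp

definition cell :: "'g set \<Rightarrow> ('g \<Rightarrow> 'x set) \<Rightarrow> 'x set" where
  "cell F w = {x. \<forall>g\<in>F. \<phi> g x \<in> w g}"

definition max_cover_number :: "'g set \<Rightarrow> nat" where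
  "max_cover_number F = (MAX w\<in>F \<rightarrow>\<^sub>E \<W>\<^sub>2. joint_cover_number \<phi> \<W>\<^sub>1 F (cell F w))"

abbreviation m :: "'g set \<Rightarrow> real" where
  "m F \<equiv> ln (max_cover_number F)"

lemma PiE_cover_nonempty: "F \<rightarrow>\<^sub>E \<W>\<^sub>2 \<noteq> {}"
  using c2.cover_nonempty by (simp add: PiE_eq_empty_iff)

lemma joint_cover_number_le_max:
  assumes "finite F" "w \<in> Pi F (\<lambda>_. \<W>\<^sub>2)"
  shows "joint_cover_number \<phi> \<W>\<^sub>1 F (cell F w) \<le> max_cover_number F"
proof -
  have "joint_cover_number \<phi> \<W>\<^sub>1 F (cell F (restrict w F)) \<le> max_cover_number F"
    unfolding max_cover_number_def using assms c2.finite_cover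
    by (intro Max_ge) (auto simp: finite_PiE)
  moreover have "cell F (restrict w F) = cell F w" by (auto simp: cell_def)
  ultimately show ?thesis by simp
qed

lemma max_cover_number_attained:
  assumes "finite F"
  shows "\<exists>w\<in>F \<rightarrow>\<^sub>E \<W>\<^sub>2. joint_cover_number \<phi> \<W>\<^sub>1 F (cell F w) = max_cover_number F"
proof -
  have "max_cover_number F \<in> (\<lambda>w. joint_cover_number \<phi> \<W>\<^sub>1 F (cell F w)) ` (F \<rightarrow>\<^sub>E \<W>\<^sub>2)"
    unfolding max_cover_number_def using assms c2.finite_cover PiE_cover_nonempty
    by (intro Max_in) (auto simp: finite_PiE)
  then show ?thesis by auto
qed

text \<open>The cell that follows the orbit of an arbitrary point is non-empty. So empty cells, with
  logarithm \<open>-\<infinity>\<close>, never determine the maximum, and \<open>m\<close> is a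
  non-negative real.\<close>

lemma max_cover_number_ge_1:
  assumes "finite F"
  shows "1 \<le> max_cover_number F"
proof -
  obtain u where u: "\<And>y. y \<in> u y" "\<And>y. u y \<in> \<W>\<^sub>2" using cover_choice[OF c2.covers] by blast
  define w where "w g = u (\<phi> g undefined)" for g
  have "undefined \<in> cell F w" by (simp add: cell_def w_def u)
  then have "cell F w \<noteq> {}" by blast
  with assms have "1 \<le> joint_cover_number \<phi> \<W>\<^sub>1 F (cell F w)" by (rule c1.joint_cover_number_pos)
  also have "\<dots> \<le> max_cover_number F"
    using assms u by (intro joint_cover_number_le_max) (auto simp: w_def)
  finally show ?thesis .
qed

lemma m_nonneg: "finite F \<Longrightarrow> 0 \<le> m F"
  using max_cover_number_ge_1 by (simp add: ln_ge_zero)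

lemma max_cover_number_le_max_cover_number:
  assumes "finite F" "\<And>w. w \<in> F \<rightarrow>\<^sub>E \<W>\<^sub>2 \<Longrightarrow> joint_cover_number \<phi> \<W>\<^sub>1 F (cell F w) \<le> n"
  shows "max_cover_number F \<le> n"
  using max_cover_number_attained[OF assms(1)] assms(2) by (metis (lifting))

lemma max_cover_number_Un:
  assumes "finite F" "finite F'"
  shows "max_cover_number (F \<union> F') \<le> max_cover_number F * max_cover_number F'"
proof (rule max_cover_number_le_max_cover_number)
  fix w assume w: "w \<in> F \<union> F' \<rightarrow>\<^sub>E \<W>\<^sub>2"
  have "joint_cover_number \<phi> \<W>\<^sub>1 (F \<union> F') (cell (F \<union> F') w)
      \<le> joint_cover_number \<phi> \<W>\<^sub>1 F (cell (F \<union> F') w) * joint_cover_number \<phi> \<W>\<^sub>1 F' (cell (F \<union> F') w)"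
    using assms by (rule c1.joint_cover_number_Un)
  also have "\<dots> \<le> joint_cover_number \<phi> \<W>\<^sub>1 F (cell F w) * joint_cover_number \<phi> \<W>\<^sub>1 F' (cell F' w)"
    using assms by (intro mult_le_mono c1.joint_cover_number_mono) (auto simp: cell_def)
  also have "\<dots> \<le> max_cover_number F * max_cover_number F'"
    using assms w by (intro mult_le_mono joint_cover_number_le_max) auto
  finally show "joint_cover_number \<phi> \<W>\<^sub>1 (F \<union> F') (cell (F \<union> F') w)
      \<le> max_cover_number F * max_cover_number F'" .
qed (use assms in simp)

lemma m_Un:
  assumes "finite F" "finite F'"
  shows "m (F \<union> F') \<le> m F + m F'"
proof -
  have pos: "0 < max_cover_number F" "0 < max_cover_number F'" "0 < max_cover_number (F \<union> F')"
    using max_cover_number_ge_1[of F] max_cover_number_ge_1[of F'] max_cover_number_ge_1[of "F \<union> F'"]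
      assms by auto
  have "m (F \<union> F') \<le> ln (real (max_cover_number F * max_cover_number F'))"
    using max_cover_number_Un[OF assms] pos by (subst ln_le_cancel_iff) (auto simp del: of_nat_mult)
  also have "\<dots> = m F + m F'" using pos by (simp add: ln_mult)
  finally show ?thesis .
qed

lemma m_le_card:
  assumes "finite F"
  shows "m F \<le> card F * ln (card \<W>\<^sub>1)"
proof -
  have "max_cover_number F \<le> card \<W>\<^sub>1 ^ card F"
    using assms by (intro max_cover_number_le_max_cover_number c1.joint_cover_number_le_power)
  then have "m F \<le> ln (real (card \<W>\<^sub>1 ^ card F))"
    using max_cover_number_ge_1[OF assms] c1.card_cover_ge_1
    by (subst ln_le_cancel_iff) (auto simp del: of_nat_power)
  also have "\<dots> = card F * ln (card \<W>\<^sub>1)" using c1.card_cover_ge_1 by (simp add: ln_realpow)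
  finally show ?thesis .
qed

lemma m_UNION:
  assumes "finite I" "\<And>i. i \<in> I \<Longrightarrow> finite (F i)"
  shows "m (\<Union>i\<in>I. F i) \<le> (\<Sum>i\<in>I. m (F i))"
  using assms
proof (induction I)
  case empty
  then show ?case using m_le_card[of "{}"] by simp
next
  case (insert i I)
  then have "m (F i \<union> (\<Union>i\<in>I. F i)) \<le> m (F i) + m (\<Union>i\<in>I. F i)" by (intro m_Un) auto
  then show ?case using insert by simp
qed

text \<open>The orbit of \<open>x\<close> along the translate of \<open>F\<close> by
  \<open>c\<close> is the orbit of \<open>\<phi> c x\<close> along \<open>F\<close>. Tiles of a
  Folner set under left multiplication are such right translates of their shapes.\<close>

lemma m_right_translate:
  assumes "finite F" "F \<subseteq> carrier G" "c \<in> carrier G"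
  shows "m ((\<lambda>s. s \<otimes> c) ` F) \<le> m F"
proof -
  interpret group G by (rule is_group)
  have "max_cover_number ((\<lambda>s. s \<otimes> c) ` F) \<le> max_cover_number F"
  proof (rule max_cover_number_le_max_cover_number)
    fix w assume w: "w \<in> (\<lambda>s. s \<otimes> c) ` F \<rightarrow>\<^sub>E \<W>\<^sub>2"
    let ?w = "\<lambda>s. w (s \<otimes> c)"
    have act: "\<phi> (s \<otimes> c) x = \<phi> s (\<phi> c x)" if "s \<in> F" for s x
      using that assms by (intro \<phi>_mult) auto
    have "joint_cover_number \<phi> \<W>\<^sub>1 ((\<lambda>s. s \<otimes> c) ` F) (cell ((\<lambda>s. s \<otimes> c) ` F) w)
        \<le> joint_cover_number \<phi> \<W>\<^sub>1 F (cell F ?w)"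
    proof (rule c1.joint_cover_number_transfer[where f="\<phi> c" and r="\<lambda>A. A"])
      show "inj_on (\<lambda>s. s \<otimes> c) F" using inj_on_multc[OF assms(3)] assms(2) by (rule inj_on_subset)
    qed (use assms cover\<^sub>1 act in \<open>auto simp: cell_def\<close>)
    also have "\<dots> \<le> max_cover_number F" using assms w by (intro joint_cover_number_le_max) auto
    finally show "joint_cover_number \<phi> \<W>\<^sub>1 ((\<lambda>s. s \<otimes> c) ` F) (cell ((\<lambda>s. s \<otimes> c) ` F) w)
        \<le> max_cover_number F" .
  qed (use assms in simp)
  then show ?thesis using max_cover_number_ge_1[of "(\<lambda>s. s \<otimes> c) ` F"] assms by simp
qed

lemma max_log_cover_number_eq:
  assumes "finite F"
  shows "max_log_cover_number \<phi> \<W>\<^sub>1 \<W>\<^sub>2 F = ereal (m F)"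
proof -
  let ?f = "\<lambda>w. joint_cover_number \<phi> \<W>\<^sub>1 F (cell F w)"
  have "cell F w = (\<Inter>g\<in>F. \<phi> g -` w g)" for w by (auto simp: cell_def)
  then have "max_log_cover_number \<phi> \<W>\<^sub>1 \<W>\<^sub>2 F = Max (log_card ` ?f ` (F \<rightarrow>\<^sub>E \<W>\<^sub>2))"
    by (simp add: max_log_cover_number_def cover_number_cover_join cover_join_def[of _ \<W>\<^sub>2] image_image)
  also have "\<dots> = log_card (Max (?f ` (F \<rightarrow>\<^sub>E \<W>\<^sub>2)))"
    using assms c2.finite_cover PiE_cover_nonempty
    by (intro mono_Max_commute[OF mono_log_card, symmetric]) (auto simp: finite_PiE)
  also have "\<dots> = ereal (m F)"
    using max_cover_number_ge_1[OF assms] by (auto simp: max_cover_number_def log_card_def)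
  finally show ?thesis .
qed

text \<open>Tiles taken from \<open>Hs\<close> cost at most \<open>a\<close> per element and have
  total size at most \<open>1 + 2 * \<epsilon>\<close> times that of \<open>Fs k\<close>; each of
  the few uncovered elements costs at most the logarithm of
  \<open>card \<W>\<^sub>1\<close>.\<close>

lemma eventually_m_le:
  fixes a \<delta> :: real
  assumes fol: "folner_sequence G Hs" "folner_sequence G Fs"
    and Hs: "\<And>k. m (Hs k) \<le> a * card (Hs k)" and a: "0 \<le> a" and \<delta>: "0 < \<delta>"
  shows "\<forall>\<^sub>F k in sequentially. m (Fs k) \<le> (a + \<delta>) * card (Fs k)"
proof -
  interpret group G by (rule is_group)
  define L where "L = ln (card \<W>\<^sub>1)"
  have L: "0 \<le> L" using c1.card_cover_ge_1 by (simp add: L_def)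
  \<comment> \<open>The total error is \<open>2 * a * \<epsilon> + 6 * L * \<epsilon>\<close>; the
    summand \<open>1\<close> keeps the denominator positive when \<open>a\<close> and
    \<open>L\<close> vanish.\<close>
  define \<epsilon> where "\<epsilon> = min (1/2) (\<delta> / (2 * a + 6 * L + 1))"
  have den: "0 < 2 * a + 6 * L + 1" using a L by simp
  have "0 < \<epsilon>" using \<delta> den by (simp add: \<epsilon>_def)
  moreover have "\<epsilon> \<le> 1/2" and \<epsilon>_le: "\<epsilon> \<le> \<delta> / (2 * a + 6 * L + 1)"
    unfolding \<epsilon>_def by (rule min.cobounded1, rule min.cobounded2)
  ultimately have \<epsilon>: "0 < \<epsilon>" "\<epsilon> \<le> 1/2" by auto
  have "\<epsilon> * (2 * a + 6 * L + 1) \<le> \<delta>" using \<epsilon>_le den by (simp add: pos_le_divide_eq)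
  then have \<epsilon>\<delta>: "2 * a * \<epsilon> + 6 * L * \<epsilon> \<le> \<delta>" using \<epsilon> by (simp add: algebra_simps)
  obtain n F where tiles: "invariant_tiles G F n \<epsilon>" "\<And>i. i < n \<Longrightarrow> \<exists>k. F i = Hs k"
    using folner_invariant_tiles[OF is_group fol(1) \<epsilon>, of "\<lambda>_. True"] by auto
  have mF: "m (F i) \<le> a * card (F i)" if "i < n" for i using tiles(2)[OF that] Hs by auto
  have "\<forall>\<^sub>F k in sequentially. \<exists>B. tileable G (\<lambda>s c. s \<otimes> c) (Fs k) B F n \<epsilon>"
    using folner_tileable[OF is_group fol(2) \<epsilon> tiles(1)] .
  then show ?thesis
  proof (rule eventually_mono)
    fix k assume "\<exists>B. tileable G (\<lambda>s c. s \<otimes> c) (Fs k) B F n \<epsilon>"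
    then obtain B where "tileable G (\<lambda>s c. s \<otimes> c) (Fs k) B F n \<epsilon>" by blast
    then interpret tileable G "\<lambda>s c. s \<otimes> c" "Fs k" B F n \<epsilon> .
    obtain I T where qt: "quasi_tiling (\<lambda>s c. s \<otimes> c) (Fs k) B F n \<epsilon> (6 * \<epsilon>) I T"
      using quasi_tiling_exists_small tiles(1) by (auto simp: invariant_tiles_def)
    note I = I_less[OF qt le_refl] I_centre[OF qt le_refl] T_subset[OF qt le_refl] finite_I[OF qt le_refl]
    define R where "R = Fs k - (\<Union>p\<in>I. (\<lambda>s. s \<otimes> snd p) ` T p)"
    \<comment> \<open>The whole translated shapes are used although they may overlap: subadditivity
      does not ask for disjointness, and \<open>m\<close> of a trimmed tile is not controlled by
      \<open>m\<close> of its shape.\<close>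
    define F' where "F' p = (\<lambda>s. s \<otimes> snd p) ` F (fst p)" for p
    have finF': "finite (F' p)" if "p \<in> I" for p using F(1) I that by (simp add: F'_def)
    have FsC: "Fs k \<subseteq> carrier G" using folner_sequence_finite[OF fol(2)] by simp
    have FC: "F i \<subseteq> carrier G" if "i < n" for i
      using tiles(1) that by (auto simp: invariant_tiles_def finite_nonempty_subsets_def)
    have mF': "m (F' p) \<le> a * card (F (fst p))" if p: "p \<in> I" for p
    proof -
      have "m (F' p) \<le> m (F (fst p))" unfolding F'_def
        using F(1) I(1,2)[OF p] FC FsC BD by (intro m_right_translate) auto
      then show ?thesis using mF[OF I(1)[OF p]] by simp
    qed
    have "F' p \<subseteq> Fs k" if "p \<in> I" for p using act_in[OF I(1)[OF that] _ I(2)[OF that]] by (auto simp: F'_def)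
    moreover have "(\<lambda>s. s \<otimes> snd p) ` T p \<subseteq> F' p" if "p \<in> I" for p
      using I(3)[OF that] by (auto simp: F'_def)
    ultimately have Fs_eq: "Fs k = (\<Union>p\<in>I. F' p) \<union> R" unfolding R_def by blast
    have "m (Fs k) \<le> m (\<Union>p\<in>I. F' p) + m R"
      unfolding Fs_eq using I(4) finF' finD by (intro m_Un) (auto simp: R_def)
    also have "m (\<Union>p\<in>I. F' p) \<le> (\<Sum>p\<in>I. m (F' p))" using I(4) finF' by (rule m_UNION)
    also have "\<dots> \<le> (\<Sum>p\<in>I. a * card (F (fst p)))" using mF' by (rule sum_mono)
    also have "\<dots> = a * (\<Sum>p\<in>I. card (F (fst p)))" by (simp add: sum_distrib_left)
    also have "\<dots> \<le> a * ((1 + 2 * \<epsilon>) * card (Fs k))"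
      using sum_card_F_le_add[OF qt le_refl] a by (rule mult_left_mono)
    also have "m R \<le> card R * L" using finD by (simp add: m_le_card L_def R_def)
    also have "\<dots> \<le> (6 * \<epsilon> * card (Fs k)) * L"
      using card_uncovered[OF qt le_refl] L by (intro mult_right_mono) (auto simp: R_def)
    finally have "m (Fs k) \<le> (a + (2 * a * \<epsilon> + 6 * L * \<epsilon>)) * card (Fs k)"
      by (simp add: algebra_simps)
    also have "\<dots> \<le> (a + \<delta>) * card (Fs k)" using \<epsilon>\<delta> by (intro mult_right_mono) auto
    finally show "m (Fs k) \<le> (a + \<delta>) * card (Fs k)" .
  qed
qed

text \<open>The Ornstein-Weiss lemma: tiling \<open>Fs k\<close> by members of a subsequence along which the lower limit
  is attained shows that the upper limit is not larger.\<close>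

lemma amenable_cond_entropy_limit:
  assumes fol: "folner_sequence G Fs"
  obtains h where "(\<lambda>k. m (Fs k) / card (Fs k)) \<longlonglongrightarrow> h" "0 \<le> h"
    "amenable_cond_entropy \<phi> Fs \<W>\<^sub>1 \<W>\<^sub>2 = ereal h"
proof -
  note Fs = folner_sequence_finite[OF fol]
  define a where "a k = m (Fs k) / card (Fs k)" for k
  define l where "l = liminf (\<lambda>k. ereal (a k))"
  have a0: "0 \<le> a k" for k using Fs m_nonneg by (simp add: a_def)
  have aL: "a k \<le> ln (card \<W>\<^sub>1)" for k
    using m_le_card[OF Fs(1), of k] Fs(4)[of k] by (simp add: a_def field_simps)
  have l0: "0 \<le> l" unfolding l_def using a0 by (intro Liminf_bounded) auto
  have "limsup (\<lambda>k. ereal (a k)) \<le> l"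
  proof (rule ereal_le_real)
    fix z :: real assume lz: "l \<le> ereal z"
    show "limsup (\<lambda>k. ereal (a k)) \<le> ereal z"
    proof (rule ereal_le_epsilon2)
      fix \<delta> :: real assume "0 < \<delta>"
      then have "l < ereal (z + \<delta> / 2)" using lz by (auto intro: order_le_less_trans)
      \<comment> \<open>Otherwise the lower limit would itself be at least
        \<open>z + \<delta> / 2\<close>. So infinitely many values lie below this number, and they
        supply the tiles.\<close>
      then have "\<not> (\<forall>\<^sub>F k in sequentially. ereal (z + \<delta> / 2) \<le> ereal (a k))"
        using Liminf_bounded[of "ereal (z + \<delta> / 2)" "\<lambda>k. ereal (a k)" sequentially]
        by (auto simp: l_def)
      then have "infinite {k. a k < z + \<delta> / 2}"
        by (simp add: eventually_cofinite not_le flip: cofinite_eq_sequentially)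
      then obtain r :: "nat \<Rightarrow> nat" where r: "strict_mono r" "\<And>k. a (r k) < z + \<delta> / 2"
        using infinite_enumerate by blast
      have z0: "0 \<le> z + \<delta> / 2" using r(2) a0 by (meson less_eq_real_def order_trans)
      have "\<forall>\<^sub>F k in sequentially. m (Fs k) \<le> (z + \<delta> / 2 + \<delta> / 2) * card (Fs k)"
      proof (rule eventually_m_le[OF folner_sequence_subseq[OF fol r(1)] fol _ z0])
        show "m ((Fs \<circ> r) k) \<le> (z + \<delta> / 2) * card ((Fs \<circ> r) k)" for k
          using r(2)[of k] Fs(4)[of "r k"] by (simp add: a_def field_simps)
      qed (use \<open>0 < \<delta>\<close> in simp)
      then have "\<forall>\<^sub>F k in sequentially. ereal (a k) \<le> ereal z + ereal \<delta>"
      proof (rule eventually_mono)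
        fix k assume "m (Fs k) \<le> (z + \<delta> / 2 + \<delta> / 2) * card (Fs k)"
        then show "ereal (a k) \<le> ereal z + ereal \<delta>" using Fs(4)[of k] by (simp add: a_def field_simps)
      qed
      then show "limsup (\<lambda>k. ereal (a k)) \<le> ereal z + ereal \<delta>" by (rule Limsup_bounded)
    qed
  qed
  then have lim: "(\<lambda>k. ereal (a k)) \<longlonglongrightarrow> l"
    using Liminf_le_Limsup[of sequentially "\<lambda>k. ereal (a k)"]
    by (simp add: tendsto_iff_Liminf_eq_Limsup l_def)
  have "l \<le> ereal (ln (card \<W>\<^sub>1))" using lim aL by (intro LIMSEQ_le_const2) auto
  then obtain h where h: "l = ereal h" using l0 by (cases l) auto
  have "amenable_cond_entropy \<phi> Fs \<W>\<^sub>1 \<W>\<^sub>2 = lim (\<lambda>k. ereal (a k))"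
    using Fs by (simp add: amenable_cond_entropy_def max_log_cover_number_eq a_def)
  also have "\<dots> = ereal h" using lim h by (simp add: limI)
  finally show ?thesis using that lim h l0 by (simp add: a_def)
qed

end

section \<open>Sofic approximations and open covers\<close>

lemma card_filter_add_card_filter_not:
  assumes "finite A"
  shows "card {a\<in>A. P a} + card {a\<in>A. \<not> P a} = card A"
proof -
  have "card ({a\<in>A. P a} \<union> {a\<in>A. \<not> P a}) = card {a\<in>A. P a} + card {a\<in>A. \<not> P a}"
    using assms by (intro card_Un_disjoint) auto
  moreover have "{a\<in>A. P a} \<union> {a\<in>A. \<not> P a} = A" by blast
  ultimately show ?thesis by simp
qed

text \<open>Density one, expressed through the exceptional set: finite conjunctions then follow from
  a union bound, and an index with \<open>d i = 0\<close> causes no division by zero.\<close>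

definition almost_everywhere :: "(nat \<Rightarrow> nat) \<Rightarrow> (nat \<Rightarrow> nat \<Rightarrow> bool) \<Rightarrow> bool" where
  "almost_everywhere d P \<longleftrightarrow>
     (\<forall>\<eta>. 0 < (\<eta> :: real) \<longrightarrow> (\<forall>\<^sub>F i in sequentially. real (card {a\<in>{1..d i}. \<not> P i a}) \<le> \<eta> * d i))"

lemma almost_everywhereI_density:
  assumes "filterlim d at_top sequentially"
    and "(\<lambda>i. real (card {a\<in>{1..d i}. P i a}) / d i) \<longlonglongrightarrow> 1"
  shows "almost_everywhere d P"
  unfolding almost_everywhere_def
proof (intro allI impI)
  fix \<eta> :: real assume "0 < \<eta>"
  then have "\<forall>\<^sub>F i in sequentially. 1 - \<eta> < real (card {a\<in>{1..d i}. P i a}) / d i"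
    using assms(2) by (intro order_tendstoD) auto
  moreover have "\<forall>\<^sub>F i in sequentially. 1 \<le> d i" using assms(1) by (simp add: filterlim_at_top)
  ultimately show "\<forall>\<^sub>F i in sequentially. real (card {a\<in>{1..d i}. \<not> P i a}) \<le> \<eta> * d i"
  proof eventually_elim
    case (elim i)
    have "card {a\<in>{1..d i}. P i a} + card {a\<in>{1..d i}. \<not> P i a} = card {1..d i}"
      by (rule card_filter_add_card_filter_not) simp
    then have "real (card {a\<in>{1..d i}. \<not> P i a}) = d i - real (card {a\<in>{1..d i}. P i a})" by simp
    then show ?case using elim by (simp add: field_simps)
  qed
qed

lemma almost_everywhere_ball:
  assumes "finite K" "\<And>k. k \<in> K \<Longrightarrow> almost_everywhere d (P k)"
  shows "almost_everywhere d (\<lambda>i a. \<forall>k\<in>K. P k i a)"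
  unfolding almost_everywhere_def
proof (intro allI impI)
  fix \<eta> :: real assume \<eta>: "0 < \<eta>"
  let ?\<eta> = "\<eta> / (1 + card K)"
  have "\<forall>\<^sub>F i in sequentially. \<forall>k\<in>K. real (card {a\<in>{1..d i}. \<not> P k i a}) \<le> ?\<eta> * d i"
  proof (intro eventually_ball_finite ballI assms(1))
    fix k assume "k \<in> K"
    moreover have "0 < ?\<eta>" using \<eta> by (simp add: add_pos_nonneg)
    ultimately show "\<forall>\<^sub>F i in sequentially. real (card {a\<in>{1..d i}. \<not> P k i a}) \<le> ?\<eta> * d i"
      using assms(2) unfolding almost_everywhere_def by blast
  qed
  then show "\<forall>\<^sub>F i in sequentially. real (card {a\<in>{1..d i}. \<not> (\<forall>k\<in>K. P k i a)}) \<le> \<eta> * d i"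
  proof (rule eventually_mono)
    fix i assume i: "\<forall>k\<in>K. real (card {a\<in>{1..d i}. \<not> P k i a}) \<le> ?\<eta> * d i"
    have "{a\<in>{1..d i}. \<not> (\<forall>k\<in>K. P k i a)} = (\<Union>k\<in>K. {a\<in>{1..d i}. \<not> P k i a})" by auto
    then have "card {a\<in>{1..d i}. \<not> (\<forall>k\<in>K. P k i a)} \<le> (\<Sum>k\<in>K. card {a\<in>{1..d i}. \<not> P k i a})"
      using card_UN_le[OF assms(1)] by metis
    then have "real (card {a\<in>{1..d i}. \<not> (\<forall>k\<in>K. P k i a)})
        \<le> (\<Sum>k\<in>K. real (card {a\<in>{1..d i}. \<not> P k i a}))" by (simp flip: of_nat_sum)
    also have "\<dots> \<le> (\<Sum>k\<in>K. ?\<eta> * d i)" using i by (intro sum_mono) auto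
    also have "\<dots> = (card K * ?\<eta>) * d i" by simp
    also have "\<dots> \<le> \<eta> * d i" using \<eta> by (intro mult_right_mono) (auto simp: field_simps)
    finally show "real (card {a\<in>{1..d i}. \<not> (\<forall>k\<in>K. P k i a)}) \<le> \<eta> * d i" .
  qed
qed

text \<open>Only finitely many instances of multiplicativity and freeness are involved, so all of
  them hold at once at most points, and these points are the centres. The set \<open>E\<close> adds
  the elements by which tiles are to be moved when points of the model are constructed.\<close>

lemma sofic_tileable:
  fixes \<epsilon> :: real
  assumes "group G" and sofic: "sofic_approximation G d \<sigma>" and \<epsilon>: "0 < \<epsilon>" "\<epsilon> \<le> 1/2"
    and tiles: "invariant_tiles G F n \<epsilon>" and E: "finite E" "E \<subseteq> carrier G"
  shows "\<forall>\<^sub>F i in sequentially. \<exists>B. tileable G (\<sigma> i) {1..d i} B F n \<epsilon> \<and>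
    (\<forall>c\<in>B. \<forall>s\<in>E. \<forall>k<n. \<forall>t\<in>F k. \<sigma> i s (\<sigma> i t c) = \<sigma> i (s \<otimes>\<^bsub>G\<^esub> t) c)"
proof -
  interpret group G by fact
  have F: "finite (F i)" "F i \<noteq> {}" "F i \<subseteq> carrier G" if "i < n" for i
    using tiles that by (auto simp: invariant_tiles_def finite_nonempty_subsets_def)
  define K where "K = insert \<one>\<^bsub>G\<^esub> (E \<union> (\<Union>i<n. F i \<union> m_inv G ` F i))"
  have K: "finite K" "K \<subseteq> carrier G" using F E inv_closed by (auto simp: K_def subset_iff)
  have FK: "s \<in> K" "inv\<^bsub>G\<^esub> s \<in> K" "s \<in> carrier G" if "i < n" "s \<in> F i" for i s
    using F(3) that by (auto simp: K_def)
  have perm: "\<sigma> i g permutes {1..d i}" if "g \<in> carrier G" for i g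
    using sofic that by (auto simp: sofic_approximation_def)
  \<comment> \<open>The Boolean index merges the two kinds of condition into one finite
    conjunction.\<close>
  define good where "good i a \<longleftrightarrow> (\<forall>b\<in>{True, False}. \<forall>s\<in>K. \<forall>t\<in>K.
    if b then \<sigma> i s (\<sigma> i t a) = \<sigma> i (s \<otimes>\<^bsub>G\<^esub> t) a else s \<noteq> t \<longrightarrow> \<sigma> i s a \<noteq> \<sigma> i t a)" for i a
  have "almost_everywhere d good"
    unfolding good_def
  proof (intro almost_everywhere_ball K)
    fix b s t assume "s \<in> K" "t \<in> K"
    then have st: "s \<in> carrier G" "t \<in> carrier G" using K by auto
    have "almost_everywhere d (\<lambda>i a. \<sigma> i s (\<sigma> i t a) = \<sigma> i (s \<otimes>\<^bsub>G\<^esub> t) a)"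
      using sofic st by (intro almost_everywhereI_density) (auto simp: sofic_approximation_def)
    moreover have "almost_everywhere d (\<lambda>i a. s \<noteq> t \<longrightarrow> \<sigma> i s a \<noteq> \<sigma> i t a)"
    proof (cases "s = t")
      case True
      then show ?thesis by (simp add: almost_everywhere_def)
    next
      case False
      then show ?thesis
        using sofic st by (intro almost_everywhereI_density) (auto simp: sofic_approximation_def)
    qed
    ultimately show "almost_everywhere d (\<lambda>i a. if b then \<sigma> i s (\<sigma> i t a) = \<sigma> i (s \<otimes>\<^bsub>G\<^esub> t) a
      else s \<noteq> t \<longrightarrow> \<sigma> i s a \<noteq> \<sigma> i t a)" by (cases b) simp_all
  qed simp
  then have "\<forall>\<^sub>F i in sequentially. real (card {a\<in>{1..d i}. \<not> good i a}) \<le> \<epsilon> * d i"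
    using \<epsilon> by (simp add: almost_everywhere_def)
  then show ?thesis
  proof (rule eventually_mono)
    fix i assume i: "real (card {a\<in>{1..d i}. \<not> good i a}) \<le> \<epsilon> * d i"
    define B where "B = {c\<in>{1..d i}. good i c}"
    have mult: "\<sigma> i s (\<sigma> i t c) = \<sigma> i (s \<otimes>\<^bsub>G\<^esub> t) c" and free: "s \<noteq> t \<Longrightarrow> \<sigma> i s c \<noteq> \<sigma> i t c"
      if "c \<in> B" "s \<in> K" "t \<in> K" for s t c
      using that by (auto simp: B_def good_def)
    \<comment> \<open>The unit acts only approximately as the identity. At a good point
      multiplicativity makes it idempotent, and a permutation then fixes the point.\<close>
    have one: "\<sigma> i \<one>\<^bsub>G\<^esub> c = c" if "c \<in> B" for c
    proof -
      have "\<sigma> i \<one>\<^bsub>G\<^esub> (\<sigma> i \<one>\<^bsub>G\<^esub> c) = \<sigma> i \<one>\<^bsub>G\<^esub> c" using mult[OF that, of "\<one>\<^bsub>G\<^esub>" "\<one>\<^bsub>G\<^esub>"] by (simp add: K_def)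
      then show ?thesis using permutes_inj[OF perm[OF one_closed, of i]] by (simp add: inj_eq)
    qed
    have "card B + card {a\<in>{1..d i}. \<not> good i a} = card {1..d i}"
      unfolding B_def by (rule card_filter_add_card_filter_not) simp
    then have cardB: "(1 - \<epsilon>) * card {1..d i} \<le> card B" using i by (simp add: algebra_simps)
    have "tileable G (\<sigma> i) {1..d i} B F n \<epsilon>"
    proof
      show "\<sigma> i s c \<in> {1..d i}" if "k < n" "s \<in> F k" "c \<in> B" for k s c
        using permutes_in_image[OF perm[OF FK(3)[OF that(1,2)]]] that(3) by (simp add: B_def)
      show "inj_on (\<lambda>s. \<sigma> i s c) (F k)" if "k < n" "c \<in> B" for k c
        using free[OF that(2)] FK(1)[OF that(1)] by (meson inj_onI)
      show "inj_on (\<sigma> i s) B" if "k < n" "s \<in> F k" for k s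
        using permutes_inj_on[OF perm[OF FK(3)[OF that]]] .
      show "c = \<sigma> i (inv\<^bsub>G\<^esub> s \<otimes>\<^bsub>G\<^esub> t) c'" if "k < j" "j < n" "s \<in> F j" "t \<in> F k" "c \<in> B" "c' \<in> B"
          "\<sigma> i s c = \<sigma> i t c'" for k j s t c c'
      proof -
        have k: "k < n" using that by simp
        \<comment> \<open>Multiplicativity is applied only at the centres \<open>c\<close> and
          \<open>c'\<close> themselves, never at the point where the tiles meet, which need not be
          good.\<close>
        have "c = \<sigma> i (inv\<^bsub>G\<^esub> s) (\<sigma> i s c)"
          using mult[OF that(5) FK(2)[OF that(2,3)] FK(1)[OF that(2,3)]] one[OF that(5)]
            FK(3)[OF that(2,3)] by simp
        also have "\<dots> = \<sigma> i (inv\<^bsub>G\<^esub> s \<otimes>\<^bsub>G\<^esub> t) c'"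
          using mult[OF that(6) FK(2)[OF that(2,3)] FK(1)[OF k that(4)]] that(7) by simp
        finally show ?thesis .
      qed
      show "card ((\<lambda>(s, t). inv\<^bsub>G\<^esub> s \<otimes>\<^bsub>G\<^esub> t) ` (F j \<times> F k) - F k) \<le> \<epsilon> * card (F k)"
        if "k < j" "j < n" for k j
      proof -
        have "(\<lambda>(s, t). inv\<^bsub>G\<^esub> s \<otimes>\<^bsub>G\<^esub> t) ` (F j \<times> F k) = (\<lambda>(s, t). s \<otimes>\<^bsub>G\<^esub> t) ` (m_inv G ` F j \<times> F k)"
          by force
        then show ?thesis using tiles that by (simp add: invariant_tiles_def product_boundary_def)
      qed
    qed (use \<epsilon> F cardB in \<open>auto simp: B_def\<close>)
    moreover have "\<sigma> i s (\<sigma> i t c) = \<sigma> i (s \<otimes>\<^bsub>G\<^esub> t) c" if "c \<in> B" "s \<in> E" "k < n" "t \<in> F k" for c s k t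
      using that FK by (intro mult) (auto simp: K_def)
    ultimately show "\<exists>B. tileable G (\<sigma> i) {1..d i} B F n \<epsilon> \<and>
        (\<forall>c\<in>B. \<forall>s\<in>E. \<forall>k<n. \<forall>t\<in>F k. \<sigma> i s (\<sigma> i t c) = \<sigma> i (s \<otimes>\<^bsub>G\<^esub> t) c)" by blast
  qed
qed

section \<open>Finite open covers of a compact metric space\<close>

lemma finite_open_covers_finite_cover: "\<U> \<in> finite_open_covers \<Longrightarrow> finite_cover \<U>"
  by (auto simp: finite_open_covers_def finite_cover_def)

lemma finite_ball_cover:
  fixes r :: real
  assumes "compact (UNIV :: 'x::metric_space set)" "0 < r"
  shows "\<exists>\<U>\<in>finite_open_covers. \<forall>A\<in>\<U>. \<exists>x :: 'x. A = ball x r"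
proof -
  have "(UNIV :: 'x set) \<subseteq> \<Union> (range (\<lambda>x. ball x r))" using assms(2) by auto
  then obtain \<U> where \<U>: "\<U> \<subseteq> range (\<lambda>x :: 'x. ball x r)" "finite \<U>" "UNIV \<subseteq> \<Union>\<U>"
    using compactE[OF assms(1), of "range (\<lambda>x. ball x r)"] by (metis imageE open_ball)
  then have "\<U> \<in> finite_open_covers" by (auto simp: finite_open_covers_def)
  then show ?thesis using \<U>(1) by blast
qed

lemma finite_open_cover_Lebesgue:
  fixes \<W> :: "'x::metric_space set set"
  assumes "compact (UNIV :: 'x set)" "\<W> \<in> finite_open_covers"
  shows "\<exists>r>0. \<exists>w. \<forall>x. w x \<in> \<W> \<and> ball x r \<subseteq> w x"
proof -
  have W: "(UNIV :: 'x set) \<subseteq> \<Union>\<W>" "\<And>A. A \<in> \<W> \<Longrightarrow> open A" using assms(2) by (auto simp: finite_open_covers_def)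
  from Heine_Borel_lemma[OF assms(1) W] obtain r
    where "0 < r" "\<And>x. x \<in> (UNIV :: 'x set) \<Longrightarrow> \<exists>G\<in>\<W>. ball x r \<subseteq> G" by blast
  then have "\<forall>x. \<exists>G. G \<in> \<W> \<and> ball x r \<subseteq> G" by blast
  from choice[OF this] \<open>0 < r\<close> show ?thesis by blast
qed

text \<open>Half of the Lebesgue number is spent on the radius of the balls, the other half is the
  margin \<gamma>. It is applied once to the conditioning cover of orbits, giving that of the model,
  and once to the covering family of the model, giving that of orbits.\<close>

lemma shrunken_open_cover:
  fixes \<W> :: "'x::metric_space set set"
  assumes "compact (UNIV :: 'x set)" "\<W> \<in> finite_open_covers"
  shows "\<exists>\<U>\<in>finite_open_covers. \<exists>\<gamma>>0. \<exists>e. \<forall>A\<in>\<U>. e A \<in> \<W> \<and> (\<forall>z\<in>A. \<forall>y. dist y z < \<gamma> \<longrightarrow> y \<in> e A)"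
proof -
  obtain r w where r: "0 < r" "\<And>x. w x \<in> \<W>" "\<And>x. ball x r \<subseteq> w x"
    using finite_open_cover_Lebesgue[OF assms] by blast
  obtain \<U> where \<U>: "\<U> \<in> finite_open_covers" "\<forall>A\<in>\<U>. \<exists>x :: 'x. A = ball x (r/2)"
    using finite_ball_cover[OF assms(1), of "r/2"] r(1) by auto
  from bchoice[OF \<U>(2)] obtain x where x: "\<And>A. A \<in> \<U> \<Longrightarrow> A = ball (x A) (r/2)" by blast
  have "y \<in> w (x A)" if "A \<in> \<U>" "z \<in> A" "dist y z < r/2" for A y z
  proof -
    have "z \<in> ball (x A) (r/2)" using x[OF that(1)] that(2) by blast
    then have "dist (x A) y < r"
      using that(3) dist_triangle_half_r[of z "x A" r y] by (simp add: dist_commute)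
    then show ?thesis using r(3) by (meson mem_ball subsetD)
  qed
  then have "\<forall>A\<in>\<U>. w (x A) \<in> \<W> \<and> (\<forall>z\<in>A. \<forall>y. dist y z < r/2 \<longrightarrow> y \<in> w (x A))"
    using r(2) by blast
  moreover have "0 < r/2" using r(1) by simp
  ultimately show ?thesis using \<U>(1)
    by (intro bexI[of _ \<U>] exI[of _ "r/2"] exI[of _ "\<lambda>A. w (x A)"] conjI)
qed

text \<open>Two points in one ball of half the Lebesgue number are within the Lebesgue number of
  each other. The element \<open>e x\<close> depends on the point \<open>x\<close> only and contains
  its whole star.\<close>

lemma star_refinement:
  fixes \<W> :: "'x::metric_space set set"
  assumes "compact (UNIV :: 'x set)" "\<W> \<in> finite_open_covers"
  shows "\<exists>\<U>\<in>finite_open_covers. \<exists>e. \<forall>x. e x \<in> \<W> \<and> (\<forall>A\<in>\<U>. \<forall>y. x \<in> A \<longrightarrow> y \<in> A \<longrightarrow> y \<in> e x)"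
proof -
  obtain r w where r: "0 < r" "\<And>x. w x \<in> \<W>" "\<And>x. ball x r \<subseteq> w x"
    using finite_open_cover_Lebesgue[OF assms] by blast
  obtain \<U> where \<U>: "\<U> \<in> finite_open_covers" "\<forall>A\<in>\<U>. \<exists>x :: 'x. A = ball x (r/2)"
    using finite_ball_cover[OF assms(1), of "r/2"] r(1) by auto
  have key: "y \<in> w x" if "A \<in> \<U>" "x \<in> A" "y \<in> A" for A x y
  proof -
    from bspec[OF \<U>(2) that(1)] obtain z where z: "A = ball z (r/2)" ..
    have "dist z x < r/2" "dist z y < r/2" using that(2,3) unfolding z by simp_all
    then have "dist x y < r" by (rule dist_triangle_half_r)
    then show ?thesis using r(3) by (meson mem_ball subsetD)
  qed
  have "\<forall>x. w x \<in> \<W> \<and> (\<forall>A\<in>\<U>. \<forall>y. x \<in> A \<longrightarrow> y \<in> A \<longrightarrow> y \<in> w x)"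
    by (intro allI conjI r(2) ballI impI) (erule (2) key)
  then show ?thesis using \<U>(1) by (intro bexI[of _ \<U>] exI[of _ w])
qed

section \<open>Exceptional coordinates of points of a model\<close>

lemma sofic_model_iff:
  assumes "finite F" "F \<noteq> {}"
  shows "x \<in> sofic_model \<phi> F \<delta> d \<tau> \<longleftrightarrow> x \<in> {1..d} \<rightarrow>\<^sub>E UNIV \<and>
    (\<forall>s\<in>F. sqrt (\<Sum>j=1..d. 1 / real d * (dist (\<phi> s (x j)) (x (\<tau> s j)))\<^sup>2) < \<delta>)"
  using assms by (auto simp: sofic_model_def)

text \<open>Exponential Markov bound: each counted \<open>Z\<close> satisfies
  \<open>1 \<le> exp (t * (\<kappa> * card D - card Z))\<close>, and the sum of this over all
  subsets is computed by the binomial formula. Taking \<open>t\<close> large first and \<kappa>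
  small afterwards makes the rate arbitrarily small.\<close>

lemma card_small_subsets:
  fixes \<kappa> t :: real
  assumes "finite D" "0 \<le> t"
  shows "card {Z. Z \<subseteq> D \<and> card Z \<le> \<kappa> * card D} \<le> exp (card D * (t * \<kappa> + exp (- t)))"
proof -
  let ?\<Z> = "{Z. Z \<subseteq> D \<and> card Z \<le> \<kappa> * card D}"
  have "real (card ?\<Z>) = (\<Sum>Z\<in>?\<Z>. 1)" by simp
  also have "\<dots> \<le> (\<Sum>Z\<in>?\<Z>. exp (t * (\<kappa> * card D)) * exp (- t) ^ card Z)"
  proof (rule sum_mono)
    fix Z assume Z: "Z \<in> ?\<Z>"
    have "exp (t * (\<kappa> * card D)) * exp (- t) ^ card Z = exp (t * (\<kappa> * card D - card Z))"
      by (simp add: exp_of_nat_mult[symmetric] exp_add[symmetric] algebra_simps)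
    then show "1 \<le> exp (t * (\<kappa> * card D)) * exp (- t) ^ card Z" using Z assms(2) by simp
  qed
  also have "\<dots> \<le> (\<Sum>Z\<in>Pow D. exp (t * (\<kappa> * card D)) * exp (- t) ^ card Z)"
    using assms(1) by (intro sum_mono2) auto
  also have "\<dots> = exp (t * (\<kappa> * card D)) * (\<Sum>Z\<in>Pow D. exp (- t) ^ card Z)" by (simp add: sum_distrib_left)
  also have "(\<Sum>Z\<in>Pow D. exp (- t) ^ card Z) = (exp (- t) + 1) ^ card D"
    using prod_add[OF assms(1), of "\<lambda>_. exp (- t)" "\<lambda>_. 1"] by simp
  also have "\<dots> \<le> exp (exp (- t)) ^ card D"
    using exp_ge_add_one_self[of "exp (- t)"] by (intro power_mono) (auto simp: add.commute add_pos_pos less_imp_le)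
  also have "exp (t * (\<kappa> * card D)) * exp (exp (- t)) ^ card D = exp (card D * (t * \<kappa> + exp (- t)))"
    by (simp add: exp_of_nat_mult[symmetric] exp_add[symmetric] algebra_simps)
  finally show ?thesis by simp
qed

text \<open>Chebyshev's inequality for each \<open>s\<close>, followed by a union bound over
  \<open>L\<close>.\<close>

lemma card_far_from_equivariant:
  fixes x :: "nat \<Rightarrow> 'x::metric_space"
  assumes x: "x \<in> sofic_model \<phi> L \<delta> N \<tau>" and L: "finite L" "L \<noteq> {}" and "0 < \<gamma>" "0 < N"
  shows "card {j\<in>{1..N}. \<exists>s\<in>L. \<gamma> \<le> dist (\<phi> s (x j)) (x (\<tau> s j))} \<le> card L * (\<delta>\<^sup>2 / \<gamma>\<^sup>2) * N"
proof -
  let ?far = "\<lambda>s. {j\<in>{1..N}. \<gamma> \<le> dist (\<phi> s (x j)) (x (\<tau> s j))}"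
  have far: "real (card (?far s)) \<le> \<delta>\<^sup>2 / \<gamma>\<^sup>2 * N" if s: "s \<in> L" for s
  proof -
    let ?f = "\<lambda>j. 1 / real N * (dist (\<phi> s (x j)) (x (\<tau> s j)))\<^sup>2"
    have "card (?far s) * (1 / N * \<gamma>\<^sup>2) = (\<Sum>j\<in>?far s. 1 / N * \<gamma>\<^sup>2)" by simp
    also have "\<dots> \<le> (\<Sum>j\<in>?far s. ?f j)"
      using \<open>0 < \<gamma>\<close> by (intro sum_mono mult_left_mono power_mono) auto
    also have "\<dots> \<le> (\<Sum>j=1..N. ?f j)" by (intro sum_mono2) auto
    also have "\<dots> = (sqrt (\<Sum>j=1..N. ?f j))\<^sup>2" by (simp add: sum_nonneg)
    also have "\<dots> \<le> \<delta>\<^sup>2"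
    proof (rule power_mono)
      show "sqrt (\<Sum>j=1..N. ?f j) \<le> \<delta>" using x s by (simp add: sofic_model_iff[OF L] less_imp_le)
    qed (simp add: sum_nonneg)
    finally show ?thesis using \<open>0 < \<gamma>\<close> \<open>0 < N\<close> by (simp add: field_simps)
  qed
  have "{j\<in>{1..N}. \<exists>s\<in>L. \<gamma> \<le> dist (\<phi> s (x j)) (x (\<tau> s j))} = (\<Union>s\<in>L. ?far s)" by auto
  then have "card {j\<in>{1..N}. \<exists>s\<in>L. \<gamma> \<le> dist (\<phi> s (x j)) (x (\<tau> s j))} \<le> (\<Sum>s\<in>L. card (?far s))"
    using card_UN_le[OF L(1)] by metis
  then have "real (card {j\<in>{1..N}. \<exists>s\<in>L. \<gamma> \<le> dist (\<phi> s (x j)) (x (\<tau> s j))}) \<le> (\<Sum>s\<in>L. real (card (?far s)))"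
    by (simp flip: of_nat_sum)
  also have "\<dots> \<le> (\<Sum>s\<in>L. \<delta>\<^sup>2 / \<gamma>\<^sup>2 * N)" using far by (rule sum_mono)
  finally show ?thesis by simp
qed

section \<open>Covering numbers of sofic models\<close>

text \<open>In a separated set of maximal cardinality no point of \<open>S\<close> can be added, so
  every point of \<open>S\<close> is close to some \<open>y\<close> in the set and lies, coordinate
  by coordinate, in the star of \<open>y\<close>. One choice from \<W> for each \<open>y\<close>
  therefore covers \<open>S\<close>.\<close>

lemma (in finite_cover) exists_separated:
  assumes J: "finite J"
    and e: "\<And>x. e x \<in> \<W>" "\<And>A x y. A \<in> \<U> \<Longrightarrow> x \<in> A \<Longrightarrow> y \<in> A \<Longrightarrow> y \<in> e x"
  shows "\<exists>Y\<subseteq>S. finite Y \<and> joint_cover_number \<pi> \<W> J S \<le> card Y \<and>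
    (\<forall>y\<in>Y. \<forall>y'\<in>Y. \<forall>q\<in>Pi J (\<lambda>_. \<U>). (\<forall>j\<in>J. \<pi> j y \<in> q j \<and> \<pi> j y' \<in> q j) \<longrightarrow> y = y')"
proof -
  define close where "close y y' \<longleftrightarrow> (\<exists>q\<in>Pi J (\<lambda>_. \<U>). \<forall>j\<in>J. \<pi> j y \<in> q j \<and> \<pi> j y' \<in> q j)" for y y'
  define sep where "sep Y \<longleftrightarrow> Y \<subseteq> S \<and> (\<forall>y\<in>Y. \<forall>y'\<in>Y. close y y' \<longrightarrow> y = y')" for Y
  obtain u where u: "\<And>y. y \<in> u y" "\<And>y. u y \<in> \<U>" using cover_choice[OF covers] by blast
  have close_refl: "close x x" for x
    unfolding close_def by (rule bexI[of _ "\<lambda>j. u (\<pi> j x)"]) (use u in auto)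
  have close_e: "\<pi> j y' \<in> e (\<pi> j y)" if cl: "close y y'" and j: "j \<in> J" for y y' j
  proof -
    obtain q where q: "q \<in> Pi J (\<lambda>_. \<U>)" "\<forall>j\<in>J. \<pi> j y \<in> q j \<and> \<pi> j y' \<in> q j"
      using cl unfolding close_def by (elim bexE)
    show ?thesis by (rule e(2)[of "q j"]) (use q j in auto)
  qed
  have bound: "card Y \<le> joint_cover_number \<pi> \<U> J S" and fin: "finite Y" if sepY: "sep Y" for Y
  proof -
    have YS: "\<And>y. y \<in> Y \<Longrightarrow> y \<in> S" using sepY by (auto simp: sep_def)
    have eq: "y = y'" if "y \<in> Y" "y' \<in> Y" "q \<in> Pi J (\<lambda>_. \<U>)"
      "\<And>j. j \<in> J \<Longrightarrow> \<pi> j y \<in> q j \<and> \<pi> j y' \<in> q j" for y y' q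
    proof -
      have "close y y'" unfolding close_def using that(3,4) by (intro bexI[of _ q] ballI)
      then show ?thesis using sepY that(1,2) by (simp add: sep_def)
    qed
    show "card Y \<le> joint_cover_number \<pi> \<U> J S"
      by (rule joint_cover_number_ge_separated(1)[OF J, where z="\<lambda>y. y"]) (erule YS, rule eq)
    show "finite Y"
      by (rule joint_cover_number_ge_separated(2)[OF J, where z="\<lambda>y. y" and \<pi>=\<pi> and S=S]) (erule YS, rule eq)
  qed
  \<comment> \<open>Separated sets inject into a family realising the covering number for \<U>,
    which bounds their cardinality even if \<open>S\<close> is infinite.\<close>
  have "\<exists>Y. sep Y \<and> (\<forall>Y'. sep Y' \<longrightarrow> card Y' \<le> card Y)"
    by (rule ex_has_greatest_nat[of sep "{}" card "Suc (joint_cover_number \<pi> \<U> J S)"])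
      (use bound in \<open>auto simp: sep_def less_Suc_eq_le\<close>)
  then obtain Y where Y: "sep Y" "\<And>Y'. sep Y' \<Longrightarrow> card Y' \<le> card Y" by blast
  have "joint_cover_number \<pi> \<W> J S \<le> card ((\<lambda>y j. e (\<pi> j y)) ` Y)"
  proof (rule joint_cover_number_le)
    show "finite ((\<lambda>y j. e (\<pi> j y)) ` Y)" using fin[OF Y(1)] by simp
    show "(\<lambda>y j. e (\<pi> j y)) ` Y \<subseteq> Pi J (\<lambda>_. \<W>)" using e(1) by auto
    fix x assume x: "x \<in> S"
    have "\<exists>y\<in>Y. close y x"
    proof (rule ccontr)
      assume far: "\<not> ?thesis"
      then have "x \<notin> Y" using close_refl by blast
      have "close x y \<Longrightarrow> close y x" for y by (auto simp: close_def)
      then have "sep (insert x Y)" using far Y(1) x unfolding sep_def by blast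
      from Y(2)[OF this] show False using \<open>x \<notin> Y\<close> fin[OF Y(1)] by simp
    qed
    then obtain y where "y \<in> Y" "close y x" ..
    then show "\<exists>q\<in>(\<lambda>y j. e (\<pi> j y)) ` Y. \<forall>j\<in>J. \<pi> j x \<in> q j"
      using close_e by (intro bexI[of _ "\<lambda>j. e (\<pi> j y)"]) auto
  qed
  also have "\<dots> \<le> card Y" using fin[OF Y(1)] by (rule card_image_le)
  finally have "joint_cover_number \<pi> \<W> J S \<le> card Y" .
  moreover have "y = y'" if "y \<in> Y" "y' \<in> Y" "q \<in> Pi J (\<lambda>_. \<U>)" "\<forall>j\<in>J. \<pi> j y \<in> q j \<and> \<pi> j y' \<in> q j" for y y' q
  proof -
    have "close y y'" unfolding close_def using that(4,3) by (rule bexI)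
    then show ?thesis using Y(1) that(1,2) by (simp add: sep_def)
  qed
  moreover have "Y \<subseteq> S" using Y(1) by (simp add: sep_def)
  ultimately show ?thesis using fin[OF Y(1)] by (intro exI[of _ Y] conjI ballI impI) auto
qed

locale metric_covered_action = covered_action G \<phi> \<W>\<^sub>1 \<W>\<^sub>2
  for G :: "('g, 'b) monoid_scheme" (structure)
    and \<phi> :: "'g \<Rightarrow> 'x::metric_space \<Rightarrow> 'x" and \<W>\<^sub>1 \<W>\<^sub>2 :: "'x set set"
begin

text \<open>The exponent collects four costs: \<open>t * \<kappa> + exp (- t)\<close> for guessing
  the bad coordinates, \<open>a * (1 + 2 * \<epsilon>)\<close> for the tiles, and, each with the
  trivial cost per coordinate, \<open>6 * \<epsilon>\<close> for the uncovered part and \<kappa>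
  times the total size of the shapes for tiles with a bad centre.\<close>

lemma model_cover_number_le:
  fixes \<epsilon> \<kappa> t \<delta> \<gamma> a :: real
  assumes tl: "tileable G \<tau> {1..N} B F n \<epsilon>"
    and qt: "quasi_tiling \<tau> {1..N} B F n \<epsilon> (6 * \<epsilon>) I T" and N: "0 < N"
    and L: "finite L" "L \<noteq> {}" "\<And>i. i < n \<Longrightarrow> F i \<subseteq> L"
    and cover: "finite_cover \<U>\<^sub>1"
    and e\<^sub>1: "\<And>A. A \<in> \<W>\<^sub>1 \<Longrightarrow> e\<^sub>1 A \<in> \<U>\<^sub>1" "\<And>A y z. A \<in> \<W>\<^sub>1 \<Longrightarrow> z \<in> A \<Longrightarrow> dist y z < \<gamma> \<Longrightarrow> y \<in> e\<^sub>1 A"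
    and e\<^sub>2: "\<And>A. A \<in> \<U>\<^sub>2 \<Longrightarrow> e\<^sub>2 A \<in> \<W>\<^sub>2" "\<And>A y z. A \<in> \<U>\<^sub>2 \<Longrightarrow> z \<in> A \<Longrightarrow> dist y z < \<gamma> \<Longrightarrow> y \<in> e\<^sub>2 A"
    and \<gamma>: "0 < \<gamma>" and \<kappa>: "card L * (\<delta>\<^sup>2 / \<gamma>\<^sup>2) \<le> \<kappa>" and t: "0 \<le> t"
    and mF: "\<And>i. i < n \<Longrightarrow> m (F i) \<le> a * card (F i)" and a: "0 \<le> a"
    and V: "V \<in> Pi {1..N} (\<lambda>_. \<U>\<^sub>2)"
  shows "joint_cover_number (\<lambda>j x. x j) \<U>\<^sub>1 {1..N} (sofic_model \<phi> L \<delta> N \<tau> \<inter> Pi\<^sub>E {1..N} V)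
    \<le> exp (N * (t * \<kappa> + exp (- t) + a * (1 + 2 * \<epsilon>) + (6 * \<epsilon> + \<kappa> * (\<Sum>i<n. card (F i))) * ln (card \<U>\<^sub>1)))"
proof -
  interpret tileable G \<tau> "{1..N}" B F n \<epsilon> by fact
  interpret u1: finite_cover \<U>\<^sub>1 by fact
  note I = I_less[OF qt le_refl] I_centre[OF qt le_refl] T_subset[OF qt le_refl] finite_I[OF qt le_refl]
    finite_T[OF qt le_refl]
  let ?\<pi> = "\<lambda>j x. x j"
  let ?S = "sofic_model \<phi> L \<delta> N \<tau> \<inter> Pi\<^sub>E {1..N} V"
  let ?L = "ln (real (card \<U>\<^sub>1))" let ?Q = "\<Sum>i<n. card (F i)"
  define far where "far x = {j\<in>{1..N}. \<exists>s\<in>L. \<gamma> \<le> dist (\<phi> s (x j)) (x (\<tau> s j))}" for x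
  define \<Z> where "\<Z> = {Z. Z \<subseteq> {1..N} \<and> card Z \<le> \<kappa> * card {1..N}}"
  define b where "b = a * (1 + 2 * \<epsilon>) + (6 * \<epsilon> + \<kappa> * ?Q) * ?L"
  have \<kappa>0: "0 \<le> \<kappa>" using \<kappa> by (rule order_trans[rotated]) simp
  have L0: "0 \<le> ?L" using u1.card_cover_ge_1 by simp
  have fin\<Z>: "finite \<Z>" by (rule finite_subset[of _ "Pow {1..N}"]) (auto simp: \<Z>_def)
  have far: "far x \<in> \<Z>" if "x \<in> ?S" for x
  proof -
    have "card (far x) \<le> card L * (\<delta>\<^sup>2 / \<gamma>\<^sup>2) * N"
      unfolding far_def using that by (intro card_far_from_equivariant L \<gamma> N) auto
    also have "\<dots> \<le> \<kappa> * N" using \<kappa> by (intro mult_right_mono) auto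
    finally show ?thesis by (auto simp: \<Z>_def far_def)
  qed
  \<comment> \<open>With \<open>Z\<close> fixed, all points in question are close to orbits on the
    same tiles, those centred outside \<open>Z\<close>. The pieces for different \<open>Z\<close>
    overlap, which is harmless for an upper bound.\<close>
  have block: "real (joint_cover_number ?\<pi> \<U>\<^sub>1 {1..N} {x\<in>?S. far x \<subseteq> Z}) \<le> exp (N * b)"
    if Z: "Z \<in> \<Z>" for Z
  proof -
    let ?S' = "{x\<in>?S. far x \<subseteq> Z}"
    define J where "J p = (\<lambda>s. \<tau> s (snd p)) ` T p" for p
    define I' where "I' = {p\<in>I. snd p \<notin> Z}"
    define R where "R = {1..N} - (\<Union>p\<in>I'. J p)"
    have finI': "finite I'" using I(4) by (simp add: I'_def)
    have finJ: "finite (J p)" if "p \<in> I" for p using I(5)[OF that] by (simp add: J_def)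
    have JN: "J p \<subseteq> {1..N}" if "p \<in> I" for p
      using act_in[OF I(1)[OF that] _ I(2)[OF that]] I(3)[OF that] unfolding J_def by blast
    have tile: "joint_cover_number ?\<pi> \<U>\<^sub>1 (J p) ?S' \<le> max_cover_number (F (fst p))" if p: "p \<in> I'" for p
    proof -
      have pI: "p \<in> I" "snd p \<notin> Z" using p by (auto simp: I'_def)
      \<comment> \<open>The orbit point \<open>\<phi> s (x (snd p))\<close> is close to a coordinate
        in \<open>V\<close>, so it lies in the enlarged set. The condition is imposed on the full
        shape, while only the coordinates of \<open>T p\<close> have to be covered; this avoids any
        appeal to monotonicity of \<open>m\<close>.\<close>
      define w where "w s = e\<^sub>2 (V (\<tau> s (snd p)))" for s
      have cN: "snd p \<in> {1..N}" using I(2)[OF pI(1)] BD by blast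
      have near: "dist (\<phi> s (x (snd p))) (x (\<tau> s (snd p))) < \<gamma>" if "x \<in> ?S'" "s \<in> F (fst p)" for x s
      proof -
        have "snd p \<notin> far x" using that(1) pI(2) by blast
        then show ?thesis using cN L(3)[OF I(1)[OF pI(1)]] that(2) by (auto simp: far_def not_le)
      qed
      have VU: "V (\<tau> s (snd p)) \<in> \<U>\<^sub>2" if "s \<in> F (fst p)" for s
        using V act_in[OF I(1)[OF pI(1)] that I(2)[OF pI(1)]] by blast
      have xV: "x (\<tau> s (snd p)) \<in> V (\<tau> s (snd p))" if "x \<in> ?S'" "s \<in> F (fst p)" for x s
        using that(1) act_in[OF I(1)[OF pI(1)] that(2) I(2)[OF pI(1)]] by blast
      have "joint_cover_number ?\<pi> \<U>\<^sub>1 (J p) ?S' \<le> joint_cover_number \<phi> \<W>\<^sub>1 (F (fst p)) (cell (F (fst p)) w)"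
        unfolding J_def
      proof (rule u1.joint_cover_number_transfer[where f="\<lambda>x. x (snd p)" and r=e\<^sub>1])
        show "finite (F (fst p))" using F(1) I(1)[OF pI(1)] .
        show "inj_on (\<lambda>s. \<tau> s (snd p)) (T p)" using inj_T[OF qt le_refl pI(1)] .
        show "T p \<subseteq> F (fst p)" using I(3)[OF pI(1)] .
        show "x (snd p) \<in> cell (F (fst p)) w" if "x \<in> ?S'" for x
          unfolding cell_def w_def using e\<^sub>2(2)[OF VU xV[OF that] near[OF that]] by blast
        show "x (\<tau> s (snd p)) \<in> e\<^sub>1 A" if "x \<in> ?S'" "s \<in> T p" "A \<in> \<W>\<^sub>1" "\<phi> s (x (snd p)) \<in> A" for x s A
          using e\<^sub>1(2)[OF that(3,4)] near[OF that(1)] I(3)[OF pI(1)] that(2) by (metis dist_commute subsetD)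
      qed (use cover\<^sub>1 e\<^sub>1(1) in auto)
      also have "\<dots> \<le> max_cover_number (F (fst p))"
        using F(1) I(1)[OF pI(1)] VU e\<^sub>2(1) by (intro joint_cover_number_le_max) (auto simp: w_def)
      finally show ?thesis .
    qed
    have "R \<subseteq> ({1..N} - (\<Union>p\<in>I. J p)) \<union> (\<Union>p\<in>I - I'. J p)" by (auto simp: R_def)
    then have "card R \<le> card (({1..N} - (\<Union>p\<in>I. J p)) \<union> (\<Union>p\<in>I - I'. J p))"
      using I(4) finJ by (intro card_mono) auto
    also have "\<dots> \<le> card ({1..N} - (\<Union>p\<in>I. J p)) + card (\<Union>p\<in>I - I'. J p)" by (rule card_Un_le)
    also have "card (\<Union>p\<in>I - I'. J p) \<le> (\<Sum>p\<in>I - I'. card (J p))" using I(4) by (intro card_UN_le) auto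
    also have "\<dots> \<le> (\<Sum>p\<in>I - I'. card (F (fst p)))"
    proof (rule sum_mono)
      fix p assume p: "p \<in> I - I'"
      then have "p \<in> I" by blast
      have "card (J p) \<le> card (T p)" unfolding J_def using I(5)[OF \<open>p \<in> I\<close>] by (rule card_image_le)
      also have "\<dots> \<le> card (F (fst p))" using I(1,3)[OF \<open>p \<in> I\<close>] F(1) by (intro card_mono) auto
      finally show "card (J p) \<le> card (F (fst p))" .
    qed
    \<comment> \<open>A bad centre can occur at most once for each shape, so it spoils at most as
      many coordinates as all shapes have elements together.\<close>
    also have "\<dots> \<le> (\<Sum>p\<in>{..<n} \<times> Z. card (F (fst p)))"
    proof (rule sum_mono2)
      show "finite ({..<n} \<times> Z)" using Z finite_subset by (auto simp: \<Z>_def)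
      show "I - I' \<subseteq> {..<n} \<times> Z" using I(1) by (auto simp: I'_def mem_Times_iff)
    qed simp
    also have "\<dots> = (\<Sum>i<n. \<Sum>c\<in>Z. card (F i))"
      by (simp only: sum.cartesian_product case_prod_unfold)
    also have "\<dots> = card Z * ?Q" by (simp add: sum_distrib_left)
    finally have cardR: "real (card R) \<le> card ({1..N} - (\<Union>p\<in>I. J p)) + card Z * ?Q"
      by (simp flip: of_nat_add of_nat_mult)
    have "real (card Z) * ?Q \<le> (\<kappa> * N) * ?Q"
      using Z by (intro mult_right_mono) (auto simp: \<Z>_def sum_nonneg)
    then have cardR: "real (card R) \<le> (6 * \<epsilon> + \<kappa> * ?Q) * N"
      using cardR card_uncovered[OF qt le_refl] by (simp add: J_def algebra_simps)
    have "{1..N} = (\<Union>p\<in>I'. J p) \<union> R" using JN by (auto simp: R_def I'_def)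
    then have "joint_cover_number ?\<pi> \<U>\<^sub>1 {1..N} ?S' = joint_cover_number ?\<pi> \<U>\<^sub>1 ((\<Union>p\<in>I'. J p) \<union> R) ?S'" by (rule arg_cong)
    also have "\<dots> \<le> joint_cover_number ?\<pi> \<U>\<^sub>1 (\<Union>p\<in>I'. J p) ?S' * joint_cover_number ?\<pi> \<U>\<^sub>1 R ?S'"
      using finI' finJ by (intro u1.joint_cover_number_Un) (auto simp: R_def I'_def)
    also have "\<dots> \<le> (\<Prod>p\<in>I'. joint_cover_number ?\<pi> \<U>\<^sub>1 (J p) ?S') * card \<U>\<^sub>1 ^ card R"
      using finI' finJ
      by (intro mult_le_mono u1.joint_cover_number_UNION u1.joint_cover_number_le_power) (auto simp: R_def I'_def)
    also have "\<dots> \<le> (\<Prod>p\<in>I'. max_cover_number (F (fst p))) * card \<U>\<^sub>1 ^ card R"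
      using tile by (intro mult_le_mono prod_mono) auto
    finally have "real (joint_cover_number ?\<pi> \<U>\<^sub>1 {1..N} ?S')
        \<le> (\<Prod>p\<in>I'. real (max_cover_number (F (fst p)))) * real (card \<U>\<^sub>1) ^ card R"
      by (simp flip: of_nat_prod of_nat_power of_nat_mult)
    also have "(\<Prod>p\<in>I'. real (max_cover_number (F (fst p)))) = (\<Prod>p\<in>I'. exp (m (F (fst p))))"
    proof (rule prod.cong[OF refl])
      fix p assume "p \<in> I'"
      then have "1 \<le> max_cover_number (F (fst p))" using F(1) I(1) by (intro max_cover_number_ge_1) (auto simp: I'_def)
      then show "real (max_cover_number (F (fst p))) = exp (m (F (fst p)))" by simp
    qed
    also have "real (card \<U>\<^sub>1) ^ card R = exp (card R * ?L)"
      using u1.card_cover_ge_1 by (simp add: exp_of_nat_mult)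
    also have "(\<Prod>p\<in>I'. exp (m (F (fst p)))) * exp (card R * ?L) = exp ((\<Sum>p\<in>I'. m (F (fst p))) + card R * ?L)"
      using finI' by (simp add: exp_sum exp_add)
    also have "\<dots> \<le> exp (N * b)"
    proof -
      have "(\<Sum>p\<in>I'. m (F (fst p))) \<le> (\<Sum>p\<in>I. m (F (fst p)))"
        using I(4) F(1) I(1) m_nonneg by (intro sum_mono2) (auto simp: I'_def)
      also have "\<dots> \<le> (\<Sum>p\<in>I. a * card (F (fst p)))" by (intro sum_mono mF I(1))
      also have "\<dots> = a * (\<Sum>p\<in>I. card (F (fst p)))" by (simp add: sum_distrib_left)
      also have "\<dots> \<le> a * ((1 + 2 * \<epsilon>) * card {1..N})"
        using sum_card_F_le_add[OF qt le_refl] a by (rule mult_left_mono)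
      finally have 1: "(\<Sum>p\<in>I'. m (F (fst p))) \<le> a * (1 + 2 * \<epsilon>) * N" by simp
      have "card R * ?L \<le> (6 * \<epsilon> + \<kappa> * ?Q) * N * ?L" using cardR L0 by (rule mult_right_mono)
      moreover have "N * b = a * (1 + 2 * \<epsilon>) * N + (6 * \<epsilon> + \<kappa> * ?Q) * N * ?L"
        unfolding b_def by (simp only: ring_distribs mult.commute[of "real N"] mult.assoc mult.left_commute[of "real N"])
      ultimately have "(\<Sum>p\<in>I'. m (F (fst p))) + card R * ?L \<le> N * b" using 1 by linarith
      then show ?thesis by simp
    qed
    finally show ?thesis .
  qed
  have "?S \<subseteq> (\<Union>Z\<in>\<Z>. {x\<in>?S. far x \<subseteq> Z})" using far by blast
  then have "joint_cover_number ?\<pi> \<U>\<^sub>1 {1..N} ?S \<le> joint_cover_number ?\<pi> \<U>\<^sub>1 {1..N} (\<Union>Z\<in>\<Z>. {x\<in>?S. far x \<subseteq> Z})"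
    by (intro u1.joint_cover_number_mono) auto
  also have "\<dots> \<le> (\<Sum>Z\<in>\<Z>. joint_cover_number ?\<pi> \<U>\<^sub>1 {1..N} {x\<in>?S. far x \<subseteq> Z})"
    using fin\<Z> by (intro u1.joint_cover_number_Union_points) auto
  finally have "real (joint_cover_number ?\<pi> \<U>\<^sub>1 {1..N} ?S)
      \<le> (\<Sum>Z\<in>\<Z>. real (joint_cover_number ?\<pi> \<U>\<^sub>1 {1..N} {x\<in>?S. far x \<subseteq> Z}))"
    by (simp flip: of_nat_sum)
  also have "\<dots> \<le> (\<Sum>Z\<in>\<Z>. exp (N * b))" using block by (rule sum_mono)
  also have "\<dots> = card \<Z> * exp (N * b)" by simp
  also have "\<dots> \<le> exp (N * (t * \<kappa> + exp (- t))) * exp (N * b)"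
    using card_small_subsets[of "{1..N}" t \<kappa>] t by (intro mult_right_mono) (auto simp: \<Z>_def)
  also have "\<dots> = exp (N * (t * \<kappa> + exp (- t) + b))" by (simp add: exp_add[symmetric] distrib_left)
  finally show ?thesis by (simp add: b_def add.assoc)
qed

text \<open>On every trimmed tile a worst cell and a separated subset of it are chosen, and
  arbitrary combinations of these orbit pieces are glued to points of the model. In the exponent,
  \<open>6 * h\<close> is the loss from uncovered coordinates; the remaining terms are the deficit
  \<epsilon> of the shapes and the cost of trimming, both over a total size of at most
  \<open>2 * N\<close>.\<close>

lemma model_cover_number_ge:
  fixes \<epsilon> \<delta> h \<Delta> :: real
  assumes tl: "tileable G \<tau> {1..N} B F n \<epsilon>"
    and qt: "quasi_tiling \<tau> {1..N} B F n \<epsilon> (6 * \<epsilon>) I T" and N: "0 < N"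
    and E: "finite E" "E \<noteq> {}" "E \<subseteq> carrier G"
    and FG: "\<And>i. i < n \<Longrightarrow> F i \<subseteq> carrier G"
    and mult: "\<And>c s k t. c \<in> B \<Longrightarrow> s \<in> E \<Longrightarrow> k < n \<Longrightarrow> t \<in> F k \<Longrightarrow> \<tau> s (\<tau> t c) = \<tau> (s \<otimes> t) c"
    and inv_E: "\<And>i. i < n \<Longrightarrow> card (product_boundary G E (F i)) \<le> \<epsilon> * card (F i)"
    and cover: "finite_cover \<U>\<^sub>1"
    and e: "\<And>x. e x \<in> \<W>\<^sub>1" "\<And>A x y. A \<in> \<U>\<^sub>1 \<Longrightarrow> x \<in> A \<Longrightarrow> y \<in> A \<Longrightarrow> y \<in> e x"
    and \<Delta>: "\<And>x y :: 'x. dist x y \<le> \<Delta>" "sqrt (10 * \<epsilon>) * \<Delta> < \<delta>"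
    and mF: "\<And>i. i < n \<Longrightarrow> (h - \<epsilon>) * card (F i) \<le> m (F i)" and h: "0 \<le> h"
  shows "\<exists>V\<in>{1..N} \<rightarrow>\<^sub>E \<W>\<^sub>2. exp (N * (h - \<epsilon> * (6 * h + 2 + 2 * ln (card \<W>\<^sub>1)))) \<le>
    joint_cover_number (\<lambda>j x. x j) \<U>\<^sub>1 {1..N} (sofic_model \<phi> E \<delta> N \<tau> \<inter> Pi\<^sub>E {1..N} V)"
proof -
  interpret group G by (rule is_group)
  interpret tileable G \<tau> "{1..N}" B F n \<epsilon> by fact
  interpret u1: finite_cover \<U>\<^sub>1 by fact
  note I = I_less[OF qt le_refl] I_centre[OF qt le_refl] T_subset[OF qt le_refl] finite_I[OF qt le_refl]
    finite_T[OF qt le_refl]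
  let ?\<pi> = "\<lambda>j x. x j"
  let ?L = "ln (real (card \<W>\<^sub>1))"
  define J where "J p = (\<lambda>s. \<tau> s (snd p)) ` T p" for p
  define cov where "cov = (\<Union>p\<in>I. J p)"
  have covN: "cov \<subseteq> {1..N}" using covered_subset[OF qt le_refl] by (simp add: cov_def J_def)

  have "\<forall>p\<in>I. \<exists>w. w \<in> T p \<rightarrow>\<^sub>E \<W>\<^sub>2 \<and> joint_cover_number \<phi> \<W>\<^sub>1 (T p) (cell (T p) w) = max_cover_number (T p)"
    using max_cover_number_attained[OF I(5)] by blast
  from bchoice[OF this] obtain w where w: "\<And>p. p \<in> I \<Longrightarrow> w p \<in> T p \<rightarrow>\<^sub>E \<W>\<^sub>2"
      "\<And>p. p \<in> I \<Longrightarrow> joint_cover_number \<phi> \<W>\<^sub>1 (T p) (cell (T p) (w p)) = max_cover_number (T p)" by blast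
  have "\<forall>p\<in>I. \<exists>Y\<subseteq>cell (T p) (w p). finite Y \<and> max_cover_number (T p) \<le> card Y \<and>
      (\<forall>y\<in>Y. \<forall>y'\<in>Y. \<forall>q\<in>Pi (T p) (\<lambda>_. \<U>\<^sub>1). (\<forall>s\<in>T p. \<phi> s y \<in> q s \<and> \<phi> s y' \<in> q s) \<longrightarrow> y = y')"
  proof
    fix p assume p: "p \<in> I"
    show "\<exists>Y\<subseteq>cell (T p) (w p). finite Y \<and> max_cover_number (T p) \<le> card Y \<and>
      (\<forall>y\<in>Y. \<forall>y'\<in>Y. \<forall>q\<in>Pi (T p) (\<lambda>_. \<U>\<^sub>1). (\<forall>s\<in>T p. \<phi> s y \<in> q s \<and> \<phi> s y' \<in> q s) \<longrightarrow> y = y')"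
      using u1.exists_separated[of "T p" e \<W>\<^sub>1 "cell (T p) (w p)" \<phi>, OF I(5)[OF p] e] w(2)[OF p] by simp
  qed
  from bchoice[OF this] obtain Y where Y: "\<forall>p\<in>I. Y p \<subseteq> cell (T p) (w p) \<and> finite (Y p) \<and>
      max_cover_number (T p) \<le> card (Y p) \<and>
      (\<forall>y\<in>Y p. \<forall>y'\<in>Y p. \<forall>q\<in>Pi (T p) (\<lambda>_. \<U>\<^sub>1). (\<forall>s\<in>T p. \<phi> s y \<in> q s \<and> \<phi> s y' \<in> q s) \<longrightarrow> y = y')" ..
  have Ycell: "\<phi> s y \<in> w p s" if "p \<in> I" "y \<in> Y p" "s \<in> T p" for p y s
  proof -
    have "y \<in> cell (T p) (w p)" using Y that(1,2) by blast
    then show ?thesis using that(3) by (simp add: cell_def)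
  qed
  have finY: "finite (Y p)" and cardY: "max_cover_number (T p) \<le> card (Y p)" if "p \<in> I" for p
    using Y that by auto
  have Ysep: "y = y'" if "p \<in> I" "y \<in> Y p" "y' \<in> Y p" "q \<in> Pi (T p) (\<lambda>_. \<U>\<^sub>1)"
    "\<And>s. s \<in> T p \<Longrightarrow> \<phi> s y \<in> q s \<and> \<phi> s y' \<in> q s" for p y y' q
  proof -
    have *: "\<forall>y\<in>Y p. \<forall>y'\<in>Y p. \<forall>q\<in>Pi (T p) (\<lambda>_. \<U>\<^sub>1). (\<forall>s\<in>T p. \<phi> s y \<in> q s \<and> \<phi> s y' \<in> q s) \<longrightarrow> y = y'"
      using Y that(1) by simp
    have "\<forall>s\<in>T p. \<phi> s y \<in> q s \<and> \<phi> s y' \<in> q s" using that(5) by simp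
    with *[rule_format, OF that(2,3,4)] show ?thesis by simp
  qed

  \<comment> \<open>\<open>ps\<close> inverts the coordinates of the tiling: each covered
    \<open>j\<close> determines its tile and its position in it, by disjointness of the tiles and
    injectivity within a tile.\<close>
  have "\<forall>j\<in>cov. \<exists>ps. fst ps \<in> I \<and> snd ps \<in> T (fst ps) \<and> j = \<tau> (snd ps) (snd (fst ps))"
    by (force simp: cov_def J_def)
  from bchoice[OF this] obtain ps where ps: "\<forall>j\<in>cov. fst (ps j) \<in> I \<and> snd (ps j) \<in> T (fst (ps j)) \<and>
      j = \<tau> (snd (ps j)) (snd (fst (ps j)))" ..
  have ps_eq: "ps (\<tau> s (snd p)) = (p, s)" if "p \<in> I" "s \<in> T p" for p s
  proof -
    let ?j = "\<tau> s (snd p)"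
    have j: "?j \<in> cov" using that by (auto simp: cov_def J_def)
    obtain p' s' where ps': "ps ?j = (p', s')" by (cases "ps ?j")
    have p': "p' \<in> I" "s' \<in> T p'" "?j = \<tau> s' (snd p')" using ps j ps' by force+
    have "?j \<in> J p" unfolding J_def using that(2) by (rule imageI)
    moreover have "?j \<in> J p'" unfolding J_def p'(3) using p'(2) by (rule imageI)
    ultimately have "?j \<in> J p \<inter> J p'" ..
    then have "p = p'"
      using disjoint_tiles[OF qt le_refl] that(1) p'(1) unfolding disjoint_family_on_def J_def by blast
    moreover have "s = s'"
      using inj_onD[OF inj_T[OF qt le_refl that(1)]] p' that(2) \<open>p = p'\<close> by blast
    ultimately show ?thesis using ps' by simp
  qed
  have \<tau>_cov: "\<tau> s (snd p) \<in> cov" if "p \<in> I" "s \<in> T p" for p s using that by (auto simp: cov_def J_def)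

  \<comment> \<open>An arbitrary filler for the uncovered coordinates, together with a cover element
    containing it.\<close>
  define x0 :: 'x where "x0 = undefined"
  have "x0 \<in> \<Union>\<W>\<^sub>2" by (simp add: c2.covers)
  then obtain W0 where W0: "x0 \<in> W0" "W0 \<in> \<W>\<^sub>2" by (elim UnionE)
  define X where "X y = (\<lambda>j\<in>{1..N}. if j \<in> cov then \<phi> (snd (ps j)) (y (fst (ps j))) else x0)" for y
  define V where "V = (\<lambda>j\<in>{1..N}. if j \<in> cov then w (fst (ps j)) (snd (ps j)) else W0)"
  have X_tile: "X y (\<tau> s (snd p)) = \<phi> s (y p)" if "p \<in> I" "s \<in> T p" for y p s
    using \<tau>_cov[OF that] covN ps_eq[OF that] by (auto simp: X_def)
  have V: "V \<in> {1..N} \<rightarrow>\<^sub>E \<W>\<^sub>2"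
  proof (rule PiE_I)
    fix j assume "j \<in> {1..N}"
    show "V j \<in> \<W>\<^sub>2"
    proof (cases "j \<in> cov")
      case True
      then have "fst (ps j) \<in> I" "snd (ps j) \<in> T (fst (ps j))" using ps by auto
      then have "w (fst (ps j)) (snd (ps j)) \<in> \<W>\<^sub>2" using w(1) by blast
      then show ?thesis using True \<open>j \<in> {1..N}\<close> by (simp add: V_def)
    next
      case False
      then show ?thesis using W0 \<open>j \<in> {1..N}\<close> by (simp add: V_def)
    qed
  qed (auto simp: V_def)
  have XV: "X y \<in> Pi\<^sub>E {1..N} V" if y: "y \<in> Pi\<^sub>E I Y" for y
  proof (rule PiE_I)
    fix j assume j: "j \<in> {1..N}"
    show "X y j \<in> V j"
    proof (cases "j \<in> cov")
      case True
      then have "fst (ps j) \<in> I" "snd (ps j) \<in> T (fst (ps j))" using ps by auto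
      then have "\<phi> (snd (ps j)) (y (fst (ps j))) \<in> w (fst (ps j)) (snd (ps j))" using Ycell y by blast
      then show ?thesis using True j by (simp add: V_def X_def)
    next
      case False
      then show ?thesis using W0 j by (simp add: V_def X_def)
    qed
  qed (auto simp: X_def)

  \<comment> \<open>Equivariance under \<open>g\<close> can fail only off the tiles, or at a
    position \<open>s\<close> whose product \<open>g \<otimes> s\<close> leaves the trimmed tile.
    This gives \<open>6 * \<epsilon>\<close> plus the relative boundary
    \<open>2 * \<epsilon>\<close> of shapes with total size at most \<open>2 * N\<close>.\<close>
  have bad: "card {j\<in>{1..N}. \<phi> g (X y j) \<noteq> X y (\<tau> g j)} \<le> 10 * \<epsilon> * N" if g: "g \<in> E" for g y
  proof -
    define Bd where "Bd p = {s\<in>T p. g \<otimes> s \<notin> T p}" for p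
    have gG: "g \<in> carrier G" using g E by blast
    have TG: "T p \<subseteq> carrier G" if "p \<in> I" for p using I(1,3)[OF that] FG by blast
    have cardBd: "card (Bd p) \<le> 2 * \<epsilon> * card (F (fst p))" if p: "p \<in> I" for p
    proof -
      have fin: "finite (product_boundary G E (F (fst p)))"
        unfolding product_boundary_def using E F(1)[OF I(1)[OF p]] by simp
      have "card (Bd p) \<le> card (product_boundary G E (F (fst p)) \<union> (F (fst p) - T p))"
      proof (rule card_inj_on_le)
        show "inj_on (\<lambda>s. g \<otimes> s) (Bd p)"
          by (rule inj_on_subset[OF inj_on_cmult[OF gG]]) (use TG[OF p] in \<open>auto simp: Bd_def\<close>)
        show "(\<lambda>s. g \<otimes> s) ` Bd p \<subseteq> product_boundary G E (F (fst p)) \<union> (F (fst p) - T p)"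
          using g I(3)[OF p] by (force simp: Bd_def product_boundary_def)
        show "finite (product_boundary G E (F (fst p)) \<union> (F (fst p) - T p))"
          using fin F(1)[OF I(1)[OF p]] by simp
      qed
      also have "\<dots> \<le> card (product_boundary G E (F (fst p))) + card (F (fst p) - T p)" by (rule card_Un_le)
      finally show ?thesis
        using inv_E[OF I(1)[OF p]] card_F_Diff_T[OF qt le_refl p] by linarith
    qed
    have "{j\<in>{1..N}. \<phi> g (X y j) \<noteq> X y (\<tau> g j)} \<subseteq> ({1..N} - cov) \<union> (\<Union>p\<in>I. (\<lambda>s. \<tau> s (snd p)) ` Bd p)"
    proof
      fix j assume j: "j \<in> {j\<in>{1..N}. \<phi> g (X y j) \<noteq> X y (\<tau> g j)}"
      show "j \<in> ({1..N} - cov) \<union> (\<Union>p\<in>I. (\<lambda>s. \<tau> s (snd p)) ` Bd p)"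
      proof (cases "j \<in> cov")
        case True
        then obtain p s where p: "p \<in> I" "s \<in> T p" "j = \<tau> s (snd p)" by (auto simp: cov_def J_def)
        have "g \<otimes> s \<notin> T p"
        proof
          assume gs: "g \<otimes> s \<in> T p"
          have "\<tau> g j = \<tau> (g \<otimes> s) (snd p)"
            unfolding p(3) using I(1,2)[OF p(1)] I(3)[OF p(1)] p(2) g by (intro mult) auto
          then have "X y (\<tau> g j) = \<phi> (g \<otimes> s) (y p)" using X_tile[OF p(1) gs] by simp
          also have "\<dots> = \<phi> g (X y j)"
            using \<phi>_mult[OF gG] TG[OF p(1)] p(2) X_tile[OF p(1,2)] p(3) by (metis subsetD)
          finally show False using j by simp
        qed
        then show ?thesis using p by (auto simp: Bd_def)
      next
        case False
        then show ?thesis using j by simp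
      qed
    qed
    then have "card {j\<in>{1..N}. \<phi> g (X y j) \<noteq> X y (\<tau> g j)}
        \<le> card (({1..N} - cov) \<union> (\<Union>p\<in>I. (\<lambda>s. \<tau> s (snd p)) ` Bd p))"
      using I(4,5) by (intro card_mono) (auto simp: Bd_def)
    also have "\<dots> \<le> card ({1..N} - cov) + card (\<Union>p\<in>I. (\<lambda>s. \<tau> s (snd p)) ` Bd p)" by (rule card_Un_le)
    also have "card (\<Union>p\<in>I. (\<lambda>s. \<tau> s (snd p)) ` Bd p) \<le> (\<Sum>p\<in>I. card ((\<lambda>s. \<tau> s (snd p)) ` Bd p))"
      using I(4) by (rule card_UN_le)
    also have "\<dots> \<le> (\<Sum>p\<in>I. card (Bd p))"
      using I(5) by (intro sum_mono card_image_le) (auto simp: Bd_def)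
    finally have "real (card {j\<in>{1..N}. \<phi> g (X y j) \<noteq> X y (\<tau> g j)})
        \<le> card ({1..N} - cov) + (\<Sum>p\<in>I. real (card (Bd p)))"
      by (simp flip: of_nat_sum)
    moreover have "(\<Sum>p\<in>I. real (card (Bd p))) \<le> (\<Sum>p\<in>I. 2 * \<epsilon> * card (F (fst p)))"
      using cardBd by (rule sum_mono)
    moreover have "(\<Sum>p\<in>I. 2 * \<epsilon> * card (F (fst p))) = 2 * \<epsilon> * (\<Sum>p\<in>I. card (F (fst p)))"
      by (simp add: sum_distrib_left)
    moreover have "2 * \<epsilon> * (\<Sum>p\<in>I. card (F (fst p))) \<le> 2 * \<epsilon> * (2 * real (card {1..N}))"
      using sum_card_F_le_double[OF qt le_refl] \<epsilon> by (intro mult_left_mono) auto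
    moreover have "card ({1..N} - cov) \<le> 6 * \<epsilon> * N"
      using card_uncovered[OF qt le_refl] by (simp add: cov_def J_def)
    ultimately show ?thesis by simp
  qed
  have Xmodel: "X y \<in> sofic_model \<phi> E \<delta> N \<tau>" for y
    unfolding sofic_model_iff[OF E(1,2)]
  proof (intro conjI ballI)
    show "X y \<in> {1..N} \<rightarrow>\<^sub>E UNIV" by (simp add: X_def)
    fix g assume g: "g \<in> E"
    let ?bad = "{j\<in>{1..N}. \<phi> g (X y j) \<noteq> X y (\<tau> g j)}"
    have \<Delta>0: "0 \<le> \<Delta>" using \<Delta>(1)[of x0 x0] by simp
    \<comment> \<open>Elsewhere the distance is exactly \<open>0\<close>, so the mean square error
      is at most the fraction of bad coordinates times the squared diameter bound.\<close>
    have "(\<Sum>j=1..N. 1 / real N * (dist (\<phi> g (X y j)) (X y (\<tau> g j)))\<^sup>2)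
        = (\<Sum>j\<in>?bad. 1 / real N * (dist (\<phi> g (X y j)) (X y (\<tau> g j)))\<^sup>2)"
      by (rule sum.mono_neutral_right) auto
    also have "\<dots> \<le> (\<Sum>j\<in>?bad. 1 / real N * \<Delta>\<^sup>2)"
      using \<Delta>(1) by (intro sum_mono mult_left_mono power_mono) auto
    also have "\<dots> = card ?bad * (1 / real N * \<Delta>\<^sup>2)" by simp
    also have "\<dots> \<le> (10 * \<epsilon> * N) * (1 / real N * \<Delta>\<^sup>2)" using bad[OF g] by (intro mult_right_mono) auto
    also have "\<dots> = 10 * \<epsilon> * \<Delta>\<^sup>2" using N by simp
    finally have "sqrt (\<Sum>j=1..N. 1 / real N * (dist (\<phi> g (X y j)) (X y (\<tau> g j)))\<^sup>2) \<le> sqrt (10 * \<epsilon> * \<Delta>\<^sup>2)"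
      by (rule real_sqrt_le_mono)
    also have "\<dots> = sqrt (10 * \<epsilon>) * \<Delta>" using \<Delta>0 by (simp add: real_sqrt_mult)
    also have "\<dots> < \<delta>" by (rule \<Delta>(2))
    finally show "sqrt (\<Sum>j=1..N. 1 / real N * (dist (\<phi> g (X y j)) (X y (\<tau> g j)))\<^sup>2) < \<delta>" .
  qed

  \<comment> \<open>If two glued points share \<open>q\<close>, they share its restriction to each
    tile, where separation forces equal choices. Hence the cardinalities multiply.\<close>
  have "card (Pi\<^sub>E I Y) \<le> joint_cover_number ?\<pi> \<U>\<^sub>1 {1..N} (sofic_model \<phi> E \<delta> N \<tau> \<inter> Pi\<^sub>E {1..N} V)"
  proof (rule u1.joint_cover_number_ge_separated(1)[where z=X])
    show "X y \<in> sofic_model \<phi> E \<delta> N \<tau> \<inter> Pi\<^sub>E {1..N} V" if "y \<in> Pi\<^sub>E I Y" for y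
      using Xmodel XV[OF that] by simp
    fix y y' q assume y: "y \<in> Pi\<^sub>E I Y" "y' \<in> Pi\<^sub>E I Y" and q: "q \<in> Pi {1..N} (\<lambda>_. \<U>\<^sub>1)"
      "\<And>j. j \<in> {1..N} \<Longrightarrow> X y j \<in> q j \<and> X y' j \<in> q j"
    show "y = y'"
    proof (rule PiE_ext[OF y])
      fix p assume p: "p \<in> I"
      show "y p = y' p"
      proof (rule Ysep[OF p])
        show "y p \<in> Y p" "y' p \<in> Y p" using y p by auto
        show "(\<lambda>s. q (\<tau> s (snd p))) \<in> Pi (T p) (\<lambda>_. \<U>\<^sub>1)" using q(1) \<tau>_cov[OF p] covN by blast
        show "\<phi> s (y p) \<in> q (\<tau> s (snd p)) \<and> \<phi> s (y' p) \<in> q (\<tau> s (snd p))" if "s \<in> T p" for s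
          using q(2)[of "\<tau> s (snd p)"] \<tau>_cov[OF p that] covN X_tile[OF p that] by auto
      qed
    qed
  qed simp
  moreover have "card (Pi\<^sub>E I Y) = (\<Prod>p\<in>I. card (Y p))" using I(4) by (rule card_PiE)
  moreover have "(\<Prod>p\<in>I. max_cover_number (T p)) \<le> (\<Prod>p\<in>I. card (Y p))" using cardY by (intro prod_mono) auto
  ultimately have "(\<Prod>p\<in>I. max_cover_number (T p))
      \<le> joint_cover_number ?\<pi> \<U>\<^sub>1 {1..N} (sofic_model \<phi> E \<delta> N \<tau> \<inter> Pi\<^sub>E {1..N} V)" by simp
  then have "(\<Prod>p\<in>I. real (max_cover_number (T p)))
      \<le> joint_cover_number ?\<pi> \<U>\<^sub>1 {1..N} (sofic_model \<phi> E \<delta> N \<tau> \<inter> Pi\<^sub>E {1..N} V)" by (simp flip: of_nat_prod)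
  moreover have "(\<Prod>p\<in>I. real (max_cover_number (T p))) = exp (\<Sum>p\<in>I. m (T p))"
  proof -
    have "(\<Prod>p\<in>I. real (max_cover_number (T p))) = (\<Prod>p\<in>I. exp (m (T p)))"
    proof (rule prod.cong[OF refl])
      fix p assume "p \<in> I"
      then have "1 \<le> max_cover_number (T p)" using I(5) by (intro max_cover_number_ge_1)
      then show "real (max_cover_number (T p)) = exp (m (T p))" by simp
    qed
    then show ?thesis using I(4) by (simp add: exp_sum)
  qed
  moreover have "N * (h - \<epsilon> * (6 * h + 2 + 2 * ?L)) \<le> (\<Sum>p\<in>I. m (T p))"
  proof -
    have L0: "0 \<le> ?L" using c1.card_cover_ge_1 by simp
    let ?\<Sigma> = "real (\<Sum>p\<in>I. card (F (fst p)))"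
    have "(h - \<epsilon> - \<epsilon> * ?L) * ?\<Sigma> = (\<Sum>p\<in>I. (h - \<epsilon> - \<epsilon> * ?L) * card (F (fst p)))"
      by (simp add: sum_distrib_left)
    also have "\<dots> \<le> (\<Sum>p\<in>I. m (T p))"
    proof (rule sum_mono)
      fix p assume p: "p \<in> I"
      \<comment> \<open>Subadditivity replaces the missing monotonicity: \<open>m\<close> of the
        trimmed tile falls below \<open>m\<close> of the shape by at most the trivial bound for the
        removed elements.\<close>
      have "F (fst p) = T p \<union> (F (fst p) - T p)" using I(3)[OF p] by blast
      then have "m (F (fst p)) \<le> m (T p) + m (F (fst p) - T p)"
        using m_Un[OF I(5)[OF p], of "F (fst p) - T p"] F(1)[OF I(1)[OF p]] by simp
      also have "m (F (fst p) - T p) \<le> card (F (fst p) - T p) * ?L"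
        using F(1)[OF I(1)[OF p]] by (intro m_le_card) simp
      also have "\<dots> \<le> \<epsilon> * card (F (fst p)) * ?L"
        using card_F_Diff_T[OF qt le_refl p] L0 by (rule mult_right_mono)
      finally show "(h - \<epsilon> - \<epsilon> * ?L) * card (F (fst p)) \<le> m (T p)"
        using mF[OF I(1)[OF p]] by (simp add: algebra_simps)
    qed
    finally have 1: "(h - \<epsilon> - \<epsilon> * ?L) * ?\<Sigma> \<le> (\<Sum>p\<in>I. m (T p))" .
    have 2: "h * ((1 - 6 * \<epsilon>) * N) \<le> h * ?\<Sigma>"
      using sum_card_F_ge[OF qt le_refl] h by (intro mult_left_mono) auto
    have 3: "(\<epsilon> + \<epsilon> * ?L) * ?\<Sigma> \<le> (\<epsilon> + \<epsilon> * ?L) * (2 * N)"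
      using sum_card_F_le_double[OF qt le_refl] \<epsilon> L0 by (intro mult_left_mono) auto
    have "N * (h - \<epsilon> * (6 * h + 2 + 2 * ?L)) = h * ((1 - 6 * \<epsilon>) * N) - (\<epsilon> + \<epsilon> * ?L) * (2 * N)"
      by (simp add: algebra_simps)
    also have "\<dots> \<le> h * ?\<Sigma> - (\<epsilon> + \<epsilon> * ?L) * ?\<Sigma>" using 2 3 by linarith
    also have "\<dots> = (h - \<epsilon> - \<epsilon> * ?L) * ?\<Sigma>" by (simp only: left_diff_distrib distrib_right diff_diff_add)
    finally show ?thesis using 1 by linarith
  qed
  moreover from this have "exp (N * (h - \<epsilon> * (6 * h + 2 + 2 * ?L))) \<le> exp (\<Sum>p\<in>I. m (T p))" by simp
  ultimately have "exp (N * (h - \<epsilon> * (6 * h + 2 + 2 * ?L)))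
      \<le> joint_cover_number ?\<pi> \<U>\<^sub>1 {1..N} (sofic_model \<phi> E \<delta> N \<tau> \<inter> Pi\<^sub>E {1..N} V)" by linarith
  then show ?thesis using V by (rule bexI)
qed

end

section \<open>Comparison of the entropies\<close>

lemma sofic_max_cover_number_cases:
  fixes \<phi> :: "'g \<Rightarrow> 'x::metric_space \<Rightarrow> 'x" and \<U>\<^sub>1 \<U>\<^sub>2 :: "'x set set"
    and F :: "'g set" and \<delta> :: real and N :: nat and \<tau> :: "'g \<Rightarrow> nat \<Rightarrow> nat"
  assumes "finite_cover \<U>\<^sub>2"
  defines "M \<equiv> MAX V\<in>cover_power \<U>\<^sub>2 N. cover_number (cover_power \<U>\<^sub>1 N) (sofic_model \<phi> F \<delta> N \<tau> \<inter> V)"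
    and "c \<equiv> \<lambda>V. joint_cover_number (\<lambda>j x. x j) \<U>\<^sub>1 {1..N} (sofic_model \<phi> F \<delta> N \<tau> \<inter> Pi\<^sub>E {1..N} V)"
  shows "V \<in> {1..N} \<rightarrow>\<^sub>E \<U>\<^sub>2 \<Longrightarrow> c V \<le> M" "\<exists>V\<in>{1..N} \<rightarrow>\<^sub>E \<U>\<^sub>2. M = c V"
proof -
  let ?A = "{1..N} \<rightarrow>\<^sub>E \<U>\<^sub>2"
  have fin: "finite (c ` ?A)"
    using finite_cover.finite_cover[OF assms(1)] by (simp add: finite_PiE)
  have ne: "c ` ?A \<noteq> {}"
    using finite_cover.cover_nonempty[OF assms(1)] by (simp add: PiE_eq_empty_iff)
  have "cover_number (cover_power \<U>\<^sub>1 N) (sofic_model \<phi> F \<delta> N \<tau> \<inter> Pi\<^sub>E {1..N} V) = c V" for V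
    unfolding c_def by (rule cover_number_cover_power) (auto simp: sofic_model_def)
  then have M: "M = Max (c ` ?A)" by (simp add: M_def cover_power_def image_image)
  show "c V \<le> M" if "V \<in> ?A" using fin that by (simp add: M)
  show "\<exists>V\<in>?A. M = c V" using Max_in[OF fin ne] M by auto
qed

lemma normalized_log_card_le:
  fixes y :: real
  assumes "real k \<le> exp (N * y)" "0 < N"
  shows "ereal (1 / real N) * log_card k \<le> ereal y"
proof -
  have "log_card k \<le> ereal (N * y)" using assms(1) by (simp only: log_card_le_iff_exp)
  then have "ereal (1 / real N) * log_card k \<le> ereal (1 / real N) * ereal (N * y)"
    by (intro ereal_mult_left_mono) auto
  also have "\<dots> = ereal y" using assms(2) by simp
  finally show ?thesis .
qed

lemma normalized_log_card_ge:
  fixes y :: real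
  assumes "exp (N * y) \<le> real k" "0 < N"
  shows "ereal y \<le> ereal (1 / real N) * log_card k"
proof -
  have k: "0 < real k" using assms(1) exp_gt_zero[of "N * y"] by linarith
  then have "N * y \<le> ln (real k)" using assms(1) by (simp add: ln_ge_iff)
  then show ?thesis using k assms(2) by (simp add: log_card_def field_simps)
qed

locale compact_sofic_action =
  fixes G :: "('g, 'b) monoid_scheme" (structure)
    and \<phi> :: "'g \<Rightarrow> 'x::metric_space \<Rightarrow> 'x"
    and d :: "nat \<Rightarrow> nat" and \<sigma> :: "nat \<Rightarrow> 'g \<Rightarrow> nat \<Rightarrow> nat" and Fs :: "nat \<Rightarrow> 'g set"
  assumes action: "group_action G UNIV \<phi>"
    and folner: "folner_sequence G Fs" and sofic: "sofic_approximation G d \<sigma>"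
    and compact_X: "compact (UNIV :: 'x set)"
begin

lemma metric_covered_actionI:
  assumes "\<W>\<^sub>1 \<in> finite_open_covers" "\<W>\<^sub>2 \<in> finite_open_covers"
  shows "metric_covered_action G \<phi> \<W>\<^sub>1 \<W>\<^sub>2"
  using action assms by (simp add: metric_covered_action_def covered_action_def finite_open_covers_finite_cover)

lemma eventually_d_pos: "\<forall>\<^sub>F i in sequentially. 0 < d i"
proof -
  have "filterlim d at_top sequentially" using sofic by (simp add: sofic_approximation_def)
  then have "\<forall>\<^sub>F i in sequentially. 1 \<le> d i" by (simp add: filterlim_at_top)
  then show ?thesis by (rule eventually_mono) simp
qed

text \<open>The quantifier order matters: \<open>\<U>\<^sub>2\<close> depends on
  \<open>\<W>\<^sub>2\<close> only, so the supremum over \<open>\<U>\<^sub>1\<close> can be taken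
  afterwards.\<close>

lemma sofic_cond_entropy_le_amenable:
  assumes \<W>\<^sub>2: "\<W>\<^sub>2 \<in> finite_open_covers"
  shows "\<exists>\<U>\<^sub>2\<in>finite_open_covers. \<forall>\<U>\<^sub>1\<in>finite_open_covers. \<exists>\<W>\<^sub>1\<in>finite_open_covers.
    sofic_cond_entropy G \<phi> d \<sigma> \<U>\<^sub>1 \<U>\<^sub>2 \<le> amenable_cond_entropy \<phi> Fs \<W>\<^sub>1 \<W>\<^sub>2"
proof -
  obtain \<U>\<^sub>2 \<gamma>\<^sub>2 e\<^sub>2 where \<U>\<^sub>2: "\<U>\<^sub>2 \<in> finite_open_covers" and \<gamma>\<^sub>2: "0 < \<gamma>\<^sub>2"
    and e\<^sub>2: "\<forall>A\<in>\<U>\<^sub>2. e\<^sub>2 A \<in> \<W>\<^sub>2 \<and> (\<forall>z\<in>A. \<forall>y. dist y z < \<gamma>\<^sub>2 \<longrightarrow> y \<in> e\<^sub>2 A)"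
    using shrunken_open_cover[OF compact_X \<W>\<^sub>2] by (elim bexE exE conjE) (rule that)
  have "\<exists>\<W>\<^sub>1\<in>finite_open_covers. sofic_cond_entropy G \<phi> d \<sigma> \<U>\<^sub>1 \<U>\<^sub>2 \<le> amenable_cond_entropy \<phi> Fs \<W>\<^sub>1 \<W>\<^sub>2"
    if \<U>\<^sub>1: "\<U>\<^sub>1 \<in> finite_open_covers" for \<U>\<^sub>1
  proof -
    obtain \<W>\<^sub>1 \<gamma>\<^sub>1 e\<^sub>1 where \<W>\<^sub>1: "\<W>\<^sub>1 \<in> finite_open_covers" and \<gamma>\<^sub>1: "0 < \<gamma>\<^sub>1"
      and e\<^sub>1: "\<forall>A\<in>\<W>\<^sub>1. e\<^sub>1 A \<in> \<U>\<^sub>1 \<and> (\<forall>z\<in>A. \<forall>y. dist y z < \<gamma>\<^sub>1 \<longrightarrow> y \<in> e\<^sub>1 A)"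
      using shrunken_open_cover[OF compact_X \<U>\<^sub>1] by (elim bexE exE conjE) (rule that)
    interpret metric_covered_action G \<phi> \<W>\<^sub>1 \<W>\<^sub>2 using \<W>\<^sub>1 \<W>\<^sub>2 by (rule metric_covered_actionI)
    interpret group G by (rule is_group)
    have cover\<^sub>1: "finite_cover \<U>\<^sub>1" and cover\<^sub>2: "finite_cover \<U>\<^sub>2"
      using \<U>\<^sub>1 \<U>\<^sub>2 by (simp_all add: finite_open_covers_finite_cover)
    obtain h where h: "(\<lambda>k. m (Fs k) / card (Fs k)) \<longlonglongrightarrow> h" "0 \<le> h"
      "amenable_cond_entropy \<phi> Fs \<W>\<^sub>1 \<W>\<^sub>2 = ereal h"
      using amenable_cond_entropy_limit[OF folner] by blast
    have "sofic_cond_entropy G \<phi> d \<sigma> \<U>\<^sub>1 \<U>\<^sub>2 \<le> ereal h + ereal \<eta>" if \<eta>: "0 < \<eta>" for \<eta> :: real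
    proof -
      define L\<^sub>1 where "L\<^sub>1 = ln (real (card \<U>\<^sub>1))"
      have L\<^sub>1: "0 \<le> L\<^sub>1" using finite_cover.card_cover_ge_1[OF cover\<^sub>1] by (simp add: L\<^sub>1_def)
      \<comment> \<open>\<open>t * \<kappa>\<close>, \<open>exp (- t)\<close>, the excess of the
        shapes over \<open>h\<close>, and \<open>2 * \<epsilon>\<^sup>2\<close> contribute at most
        \<epsilon> each; the overlap of the shapes gives \<open>2 * h * \<epsilon>\<close>, the
        coordinates without a good tile \<open>7 * \<epsilon> * L\<^sub>1\<close>.\<close>
      define \<epsilon> where "\<epsilon> = min (1/2) (\<eta> / (4 + 2 * h + 7 * L\<^sub>1))"
      have den: "0 < 4 + 2 * h + 7 * L\<^sub>1" using h(2) L\<^sub>1 by simp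
      have \<epsilon>0: "0 < \<epsilon>" using \<eta> den by (simp add: \<epsilon>_def)
      have \<epsilon>2: "\<epsilon> \<le> 1/2" and \<epsilon>_le: "\<epsilon> \<le> \<eta> / (4 + 2 * h + 7 * L\<^sub>1)"
        unfolding \<epsilon>_def by (rule min.cobounded1, rule min.cobounded2)
      have \<epsilon>\<eta>: "\<epsilon> * (4 + 2 * h + 7 * L\<^sub>1) \<le> \<eta>" using \<epsilon>_le den by (simp add: pos_le_divide_eq)
      have "\<forall>\<^sub>F k in sequentially. m (Fs k) / card (Fs k) < h + \<epsilon>"
        using h(1) \<epsilon>0 by (intro order_tendstoD(2)) auto
      then have "\<forall>\<^sub>F k in sequentially. m (Fs k) \<le> (h + \<epsilon>) * card (Fs k)"
      proof (rule eventually_mono)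
        fix k assume "m (Fs k) / card (Fs k) < h + \<epsilon>"
        then show "m (Fs k) \<le> (h + \<epsilon>) * card (Fs k)"
          using folner_sequence_finite(4)[OF folner, of k] by (simp add: pos_divide_less_eq)
      qed
      then obtain n F where tiles: "invariant_tiles G F n \<epsilon>"
          "\<forall>i<n. \<exists>k. m (Fs k) \<le> (h + \<epsilon>) * card (Fs k) \<and> F i = Fs k"
        using folner_invariant_tiles[OF is_group folner \<epsilon>0 \<epsilon>2] by blast
      have mF: "m (F i) \<le> (h + \<epsilon>) * card (F i)" if "i < n" for i using tiles(2) that by auto
      define L where "L = insert \<one> (\<Union>i<n. F i)"
      have L: "L \<in> finite_nonempty_subsets G" "finite L" "L \<noteq> {}" "\<And>i. i < n \<Longrightarrow> F i \<subseteq> L"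
        using tiles(1) by (auto simp: L_def invariant_tiles_def finite_nonempty_subsets_def)
      define Q where "Q = real (\<Sum>i<n. card (F i))"
      \<comment> \<open>The constants are chosen after the shapes: \<kappa> has to beat both
        \<open>t\<close> and the total size \<open>Q\<close> of the shapes, and \<delta> is then
        solved from
        \<open>card L * (\<delta>\<^sup>2 / \<gamma>\<^sup>2) = \<kappa>\<close>.\<close>
      define t where "t = - ln \<epsilon>"
      define \<kappa> where "\<kappa> = \<epsilon> / (1 + t + Q)"
      define \<gamma> where "\<gamma> = min \<gamma>\<^sub>1 \<gamma>\<^sub>2"
      define \<delta> where "\<delta> = \<gamma> * sqrt (\<kappa> / card L)"
      have Q: "0 \<le> Q" unfolding Q_def by (rule of_nat_0_le_iff)
      have t: "0 \<le> t" using \<epsilon>0 \<epsilon>2 by (simp add: t_def)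
      have exp_t: "exp (- t) = \<epsilon>" using \<epsilon>0 by (simp add: t_def)
      have \<kappa>: "0 < \<kappa>" "t * \<kappa> \<le> \<epsilon>" "\<kappa> * Q \<le> \<epsilon>"
        using \<epsilon>0 t Q by (auto simp: \<kappa>_def field_simps add_pos_nonneg)
      have \<gamma>: "0 < \<gamma>" "\<gamma> \<le> \<gamma>\<^sub>1" "\<gamma> \<le> \<gamma>\<^sub>2" using \<gamma>\<^sub>1 \<gamma>\<^sub>2 by (auto simp: \<gamma>_def)
      have cardL: "0 < card L" using L(2,3) by (simp add: card_gt_0_iff)
      have \<delta>: "0 < \<delta>" "card L * (\<delta>\<^sup>2 / \<gamma>\<^sup>2) \<le> \<kappa>"
        using \<gamma>(1) \<kappa>(1) cardL by (simp_all add: \<delta>_def power_mult_distrib)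
      let ?rate = "t * \<kappa> + exp (- t) + (h + \<epsilon>) * (1 + 2 * \<epsilon>) + (6 * \<epsilon> + \<kappa> * Q) * L\<^sub>1"
      have rate: "?rate \<le> h + \<eta>"
      proof -
        have "(6 * \<epsilon> + \<kappa> * Q) * L\<^sub>1 \<le> 7 * \<epsilon> * L\<^sub>1" using \<kappa>(3) L\<^sub>1 by (intro mult_right_mono) auto
        moreover have "\<epsilon> * \<epsilon> \<le> \<epsilon> * (1/2)" using \<epsilon>0 \<epsilon>2 by (intro mult_left_mono) auto
        ultimately have "?rate \<le> h + \<epsilon> * (4 + 2 * h + 7 * L\<^sub>1)"
          using \<kappa>(2) exp_t by (simp add: algebra_simps)
        then show ?thesis using \<epsilon>\<eta> by linarith
      qed
      let ?term = "\<lambda>i. ereal (1 / real (d i)) * log_card (MAX V\<in>cover_power \<U>\<^sub>2 (d i).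
        cover_number (cover_power \<U>\<^sub>1 (d i)) (sofic_model \<phi> L \<delta> (d i) (\<sigma> i) \<inter> V))"
      have "\<forall>\<^sub>F i in sequentially. \<exists>B. tileable G (\<sigma> i) {1..d i} B F n \<epsilon> \<and>
          (\<forall>c\<in>B. \<forall>s\<in>{}. \<forall>k<n. \<forall>t\<in>F k. \<sigma> i s (\<sigma> i t c) = \<sigma> i (s \<otimes> t) c)"
        using sofic_tileable[OF is_group sofic \<epsilon>0 \<epsilon>2 tiles(1), of "{}"] by simp
      then have "\<forall>\<^sub>F i in sequentially. ?term i \<le> ereal (h + \<eta>)"
        using eventually_d_pos
      proof eventually_elim
        case (elim i)
        then obtain B where tl: "tileable G (\<sigma> i) {1..d i} B F n \<epsilon>" by blast
        obtain I T where qt: "quasi_tiling (\<sigma> i) {1..d i} B F n \<epsilon> (6 * \<epsilon>) I T"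
          using tileable.quasi_tiling_exists_small[OF tl] tiles(1) by (auto simp: invariant_tiles_def)
        obtain V where V: "V \<in> {1..d i} \<rightarrow>\<^sub>E \<U>\<^sub>2"
          and max: "(MAX V\<in>cover_power \<U>\<^sub>2 (d i).
            cover_number (cover_power \<U>\<^sub>1 (d i)) (sofic_model \<phi> L \<delta> (d i) (\<sigma> i) \<inter> V)) =
            joint_cover_number (\<lambda>j x. x j) \<U>\<^sub>1 {1..d i} (sofic_model \<phi> L \<delta> (d i) (\<sigma> i) \<inter> Pi\<^sub>E {1..d i} V)"
          by (rule bexE[OF sofic_max_cover_number_cases(2)[OF cover\<^sub>2]])
        have "joint_cover_number (\<lambda>j x. x j) \<U>\<^sub>1 {1..d i} (sofic_model \<phi> L \<delta> (d i) (\<sigma> i) \<inter> Pi\<^sub>E {1..d i} V)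
            \<le> exp (d i * (t * \<kappa> + exp (- t) + (h + \<epsilon>) * (1 + 2 * \<epsilon>) +
              (6 * \<epsilon> + \<kappa> * (\<Sum>i<n. card (F i))) * ln (card \<U>\<^sub>1)))"
        proof (rule model_cover_number_le[OF tl qt elim(2) L(2,3,4) cover\<^sub>1 _ _ _ _ \<gamma>(1) \<delta>(2) t mF])
          show "e\<^sub>1 A \<in> \<U>\<^sub>1" if "A \<in> \<W>\<^sub>1" for A using e\<^sub>1 that by simp
          show "e\<^sub>2 A \<in> \<W>\<^sub>2" if "A \<in> \<U>\<^sub>2" for A using e\<^sub>2 that by simp
          show "y \<in> e\<^sub>1 A" if "A \<in> \<W>\<^sub>1" "z \<in> A" "dist y z < \<gamma>" for A y z using e\<^sub>1 that \<gamma>(2) by simp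
          show "y \<in> e\<^sub>2 A" if "A \<in> \<U>\<^sub>2" "z \<in> A" "dist y z < \<gamma>" for A y z using e\<^sub>2 that \<gamma>(3) by simp
          show "V \<in> Pi {1..d i} (\<lambda>_. \<U>\<^sub>2)" using V by (simp add: PiE_def)
        qed (use h(2) \<epsilon>0 in auto)
        also have "\<dots> \<le> exp (d i * (h + \<eta>))"
          using rate unfolding Q_def L\<^sub>1_def by (simp add: mult_left_mono)
        finally show ?case unfolding max using elim(2) by (intro normalized_log_card_le)
      qed
      then have "limsup ?term \<le> ereal (h + \<eta>)" by (rule Limsup_bounded)
      moreover have "sofic_cond_entropy G \<phi> d \<sigma> \<U>\<^sub>1 \<U>\<^sub>2 \<le> limsup ?term"
        unfolding sofic_cond_entropy_def using L(1) \<delta>(1) by (intro INF_lower2[OF L(1)] INF_lower) auto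
      ultimately show ?thesis by simp
    qed
    then have "sofic_cond_entropy G \<phi> d \<sigma> \<U>\<^sub>1 \<U>\<^sub>2 \<le> ereal h" by (rule ereal_le_epsilon2)
    then show ?thesis unfolding h(3)[symmetric] using \<W>\<^sub>1 by (rule bexI)
  qed
  then have "\<forall>\<U>\<^sub>1\<in>finite_open_covers. \<exists>\<W>\<^sub>1\<in>finite_open_covers.
      sofic_cond_entropy G \<phi> d \<sigma> \<U>\<^sub>1 \<U>\<^sub>2 \<le> amenable_cond_entropy \<phi> Fs \<W>\<^sub>1 \<W>\<^sub>2" ..
  then show ?thesis using \<U>\<^sub>2 by (rule bexI)
qed

text \<open>The cover \<open>\<U>\<^sub>1\<close> is fixed before \<open>E\<close> and \<delta>, and
  the bound holds for all of these, so it survives both infima. It even holds for the lower limit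
  along the sofic approximation.\<close>

lemma amenable_cond_entropy_le_sofic:
  assumes \<W>\<^sub>1: "\<W>\<^sub>1 \<in> finite_open_covers" and \<W>\<^sub>2: "\<W>\<^sub>2 \<in> finite_open_covers"
  shows "\<exists>\<U>\<^sub>1\<in>finite_open_covers.
    amenable_cond_entropy \<phi> Fs \<W>\<^sub>1 \<W>\<^sub>2 \<le> sofic_cond_entropy G \<phi> d \<sigma> \<U>\<^sub>1 \<W>\<^sub>2"
proof -
  obtain \<U>\<^sub>1 e where \<U>\<^sub>1: "\<U>\<^sub>1 \<in> finite_open_covers"
    and e: "\<forall>x. e x \<in> \<W>\<^sub>1 \<and> (\<forall>A\<in>\<U>\<^sub>1. \<forall>y. x \<in> A \<longrightarrow> y \<in> A \<longrightarrow> y \<in> e x)"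
    using star_refinement[OF compact_X \<W>\<^sub>1] by (elim bexE exE) (rule that)
  interpret metric_covered_action G \<phi> \<W>\<^sub>1 \<W>\<^sub>2 using \<W>\<^sub>1 \<W>\<^sub>2 by (rule metric_covered_actionI)
  have cover\<^sub>1: "finite_cover \<U>\<^sub>1" using \<U>\<^sub>1 by (rule finite_open_covers_finite_cover)
  obtain h where h: "(\<lambda>k. m (Fs k) / card (Fs k)) \<longlonglongrightarrow> h" "0 \<le> h"
    "amenable_cond_entropy \<phi> Fs \<W>\<^sub>1 \<W>\<^sub>2 = ereal h"
    using amenable_cond_entropy_limit[OF folner] by blast
  have "ereal h \<le> limsup (\<lambda>i. ereal (1 / real (d i)) * log_card (MAX V\<in>cover_power \<W>\<^sub>2 (d i).
      cover_number (cover_power \<U>\<^sub>1 (d i)) (sofic_model \<phi> E \<delta> (d i) (\<sigma> i) \<inter> V)))" (is "_ \<le> limsup ?term")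
    if E: "E \<in> finite_nonempty_subsets G" and \<delta>: "0 < \<delta>" for E and \<delta> :: real
  proof (rule ereal_le_epsilon2)
    fix \<eta> :: real assume \<eta>: "0 < \<eta>"
    have E': "finite E" "E \<noteq> {}" "E \<subseteq> carrier G" using E by (auto simp: finite_nonempty_subsets_def)
    define L where "L = ln (real (card \<W>\<^sub>1))"
    have L: "0 \<le> L" using c1.card_cover_ge_1 by (simp add: L_def)
    define \<Delta> where "\<Delta> = diameter (UNIV :: 'x set)"
    have \<Delta>: "dist x y \<le> \<Delta>" for x y :: 'x
      unfolding \<Delta>_def using compact_imp_bounded[OF compact_X] by (intro diameter_bounded_bound) auto
    have \<Delta>0: "0 \<le> \<Delta>" using \<Delta>[of undefined undefined] by simp
    \<comment> \<open>The first quotient controls the loss in the exponent, the second the mean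
      square error \<open>10 * \<epsilon> * \<Delta>\<^sup>2\<close>; the summand \<open>1\<close>
      next to \<open>\<Delta>\<^sup>2\<close> makes the comparison with
      \<open>\<delta>\<^sup>2\<close> strict.\<close>
    define \<epsilon> where "\<epsilon> = min (1/2) (min (\<eta> / (6 * h + 2 + 2 * L)) (\<delta>\<^sup>2 / (10 * (\<Delta>\<^sup>2 + 1))))"
    have den: "0 < 6 * h + 2 + 2 * L" "0 < 10 * (\<Delta>\<^sup>2 + 1)"
      using h(2) L by (simp_all add: add_nonneg_pos)
    have \<epsilon>0: "0 < \<epsilon>" using \<eta> den \<delta> by (simp add: \<epsilon>_def)
    have \<epsilon>2: "\<epsilon> \<le> 1/2" and \<epsilon>_le: "\<epsilon> \<le> \<eta> / (6 * h + 2 + 2 * L)" "\<epsilon> \<le> \<delta>\<^sup>2 / (10 * (\<Delta>\<^sup>2 + 1))"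
      unfolding \<epsilon>_def by (rule min.cobounded1, rule min.coboundedI2, rule min.cobounded1,
        rule min.coboundedI2, rule min.cobounded2)
    have \<epsilon>\<eta>: "\<epsilon> * (6 * h + 2 + 2 * L) \<le> \<eta>" using \<epsilon>_le(1) den by (simp add: pos_le_divide_eq)
    have "10 * \<epsilon> * \<Delta>\<^sup>2 < \<epsilon> * (10 * (\<Delta>\<^sup>2 + 1))" using \<epsilon>0 by (simp add: algebra_simps)
    also have "\<dots> \<le> \<delta>\<^sup>2" using \<epsilon>_le(2) den(2) by (simp only: pos_le_divide_eq)
    finally have "sqrt (10 * \<epsilon> * \<Delta>\<^sup>2) < \<delta>" using \<delta> real_sqrt_less_mono by fastforce
    then have \<epsilon>\<Delta>: "sqrt (10 * \<epsilon>) * \<Delta> < \<delta>" using \<Delta>0 by (simp add: real_sqrt_mult)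
    \<comment> \<open>Besides having nearly the right entropy, the shapes must be almost invariant
      under the set \<open>E\<close> that defines the model.\<close>
    let ?P = "\<lambda>k. (h - \<epsilon>) * card (Fs k) \<le> m (Fs k) \<and>
      real (card (product_boundary G E (Fs k))) \<le> \<epsilon> * card (Fs k)"
    have "\<forall>\<^sub>F k in sequentially. h - \<epsilon> < m (Fs k) / card (Fs k)"
      using h(1) \<epsilon>0 by (intro order_tendstoD(1)) auto
    then have "\<forall>\<^sub>F k in sequentially. ?P k"
      using folner_boundary_small[OF folner E'(1,3) \<epsilon>0]
    proof eventually_elim
      case (elim k)
      then show ?case using folner_sequence_finite(4)[OF folner, of k] by (simp add: pos_less_divide_eq)
    qed
    then obtain n F where tiles: "invariant_tiles G F n \<epsilon>" "\<forall>i<n. \<exists>k. ?P k \<and> F i = Fs k"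
      using folner_invariant_tiles[OF is_group folner \<epsilon>0 \<epsilon>2] by blast
    have F: "(h - \<epsilon>) * card (F i) \<le> m (F i)"
        "real (card (product_boundary G E (F i))) \<le> \<epsilon> * card (F i)" "F i \<subseteq> carrier G" if "i < n" for i
      using tiles(2) that folner_sequence_finite(3)[OF folner] by auto
    have "\<forall>\<^sub>F i in sequentially. ereal (h - \<eta>) \<le> ?term i"
      using sofic_tileable[OF is_group sofic \<epsilon>0 \<epsilon>2 tiles(1) E'(1,3)] eventually_d_pos
    proof eventually_elim
      case (elim i)
      then obtain B where tl: "tileable G (\<sigma> i) {1..d i} B F n \<epsilon>"
        and mult: "\<forall>c\<in>B. \<forall>s\<in>E. \<forall>k<n. \<forall>t\<in>F k. \<sigma> i s (\<sigma> i t c) = \<sigma> i (s \<otimes> t) c" by blast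
      obtain I T where qt: "quasi_tiling (\<sigma> i) {1..d i} B F n \<epsilon> (6 * \<epsilon>) I T"
        using tileable.quasi_tiling_exists_small[OF tl] tiles(1) by (auto simp: invariant_tiles_def)
      have "\<exists>V\<in>{1..d i} \<rightarrow>\<^sub>E \<W>\<^sub>2. exp (d i * (h - \<epsilon> * (6 * h + 2 + 2 * ln (card \<W>\<^sub>1)))) \<le>
        joint_cover_number (\<lambda>j x. x j) \<U>\<^sub>1 {1..d i} (sofic_model \<phi> E \<delta> (d i) (\<sigma> i) \<inter> Pi\<^sub>E {1..d i} V)"
      proof (rule model_cover_number_ge[OF tl qt elim(2) E' F(3) _ F(2) cover\<^sub>1 _ _ \<Delta> \<epsilon>\<Delta> F(1) h(2)])
        show "\<sigma> i s (\<sigma> i t c) = \<sigma> i (s \<otimes> t) c" if "c \<in> B" "s \<in> E" "k < n" "t \<in> F k" for c s k t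
          using mult that by simp
        show "e x \<in> \<W>\<^sub>1" for x using e by simp
        show "y \<in> e x" if "A \<in> \<U>\<^sub>1" "x \<in> A" "y \<in> A" for A x y using e that by simp
      qed
      then obtain V where V: "V \<in> {1..d i} \<rightarrow>\<^sub>E \<W>\<^sub>2"
        "exp (d i * (h - \<epsilon> * (6 * h + 2 + 2 * ln (card \<W>\<^sub>1)))) \<le>
        joint_cover_number (\<lambda>j x. x j) \<U>\<^sub>1 {1..d i} (sofic_model \<phi> E \<delta> (d i) (\<sigma> i) \<inter> Pi\<^sub>E {1..d i} V)" ..
      have "d i * (h - \<eta>) \<le> d i * (h - \<epsilon> * (6 * h + 2 + 2 * ln (card \<W>\<^sub>1)))"
        using \<epsilon>\<eta> by (intro mult_left_mono) (auto simp: L_def)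
      then have "exp (d i * (h - \<eta>)) \<le> exp (d i * (h - \<epsilon> * (6 * h + 2 + 2 * ln (card \<W>\<^sub>1))))" by simp
      also note V(2)
      also have "real (joint_cover_number (\<lambda>j x. x j) \<U>\<^sub>1 {1..d i} (sofic_model \<phi> E \<delta> (d i) (\<sigma> i) \<inter> Pi\<^sub>E {1..d i} V))
          \<le> real (MAX V\<in>cover_power \<W>\<^sub>2 (d i).
            cover_number (cover_power \<U>\<^sub>1 (d i)) (sofic_model \<phi> E \<delta> (d i) (\<sigma> i) \<inter> V))"
        using sofic_max_cover_number_cases(1)[OF cover\<^sub>2 V(1)] by (rule of_nat_mono)
      finally show ?case using elim(2) by (rule normalized_log_card_ge)
    qed
    then have "ereal (h - \<eta>) \<le> liminf ?term" by (rule Liminf_bounded)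
    also have "\<dots> \<le> limsup ?term" by (rule Liminf_le_Limsup) simp
    finally have "ereal (h - \<eta>) + ereal \<eta> \<le> limsup ?term + ereal \<eta>" by (rule add_right_mono)
    then show "ereal h \<le> limsup ?term + ereal \<eta>" by simp
  qed
  then have "ereal h \<le> sofic_cond_entropy G \<phi> d \<sigma> \<U>\<^sub>1 \<W>\<^sub>2"
    unfolding sofic_cond_entropy_def by (intro INF_greatest) auto
  then show ?thesis unfolding h(3)[symmetric] using \<U>\<^sub>1 by (rule bexI)
qed

text \<open>This turns the inequalities \<open>\<le> 0\<close> on the sofic side into equalities on
  the amenable side.\<close>

lemma amenable_cover_entropy_nonneg:
  assumes "\<V> \<in> finite_open_covers"
  shows "0 \<le> amenable_cover_entropy \<phi> Fs \<V>"
proof -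
  interpret metric_covered_action G \<phi> \<V> \<V> using assms assms by (rule metric_covered_actionI)
  obtain h where "0 \<le> h" "amenable_cond_entropy \<phi> Fs \<V> \<V> = ereal h"
    using amenable_cond_entropy_limit[OF folner] by blast
  then have "0 \<le> amenable_cond_entropy \<phi> Fs \<V> \<V>" by simp
  then show ?thesis unfolding amenable_cover_entropy_def using assms by (rule SUP_upper2[rotated])
qed

lemma amenable_cover_entropy_le_sofic:
  assumes "\<V> \<in> finite_open_covers"
  shows "amenable_cover_entropy \<phi> Fs \<V> \<le> sofic_cover_entropy G \<phi> d \<sigma> \<V>"
  unfolding amenable_cover_entropy_def sofic_cover_entropy_def
proof (rule SUP_mono)
  fix \<W> :: "'x set set" assume "\<W> \<in> finite_open_covers"
  then show "\<exists>\<U>\<in>finite_open_covers. amenable_cond_entropy \<phi> Fs \<W> \<V> \<le> sofic_cond_entropy G \<phi> d \<sigma> \<U> \<V>"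
    using assms by (rule amenable_cond_entropy_le_sofic)
qed

lemma sofic_cover_entropy_le_amenable:
  assumes "\<V> \<in> finite_open_covers"
  shows "\<exists>\<U>\<in>finite_open_covers. sofic_cover_entropy G \<phi> d \<sigma> \<U> \<le> amenable_cover_entropy \<phi> Fs \<V>"
proof -
  obtain \<U> where \<U>: "\<U> \<in> finite_open_covers"
    and le: "\<forall>\<U>\<^sub>1\<in>finite_open_covers. \<exists>\<W>\<^sub>1\<in>finite_open_covers.
      sofic_cond_entropy G \<phi> d \<sigma> \<U>\<^sub>1 \<U> \<le> amenable_cond_entropy \<phi> Fs \<W>\<^sub>1 \<V>"
    using sofic_cond_entropy_le_amenable[OF assms] ..
  have "sofic_cover_entropy G \<phi> d \<sigma> \<U> \<le> amenable_cover_entropy \<phi> Fs \<V>"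
    unfolding amenable_cover_entropy_def sofic_cover_entropy_def using le by (intro SUP_mono) simp
  then show ?thesis using \<U> by (rule bexI)
qed

text \<open>For a single conditioning cover one of the two comparisons needs a refinement; the
  infimum over all covers absorbs it.\<close>

lemma sofic_tail_entropy_eq_amenable: "sofic_tail_entropy G \<phi> d \<sigma> = amenable_tail_entropy \<phi> Fs"
  unfolding sofic_tail_entropy_def amenable_tail_entropy_def
proof (rule antisym)
  show "(INF \<U>\<in>finite_open_covers. sofic_cover_entropy G \<phi> d \<sigma> \<U>)
      \<le> (INF \<V>\<in>finite_open_covers. amenable_cover_entropy \<phi> Fs \<V>)"
    by (rule INF_mono) (rule sofic_cover_entropy_le_amenable)
  show "(INF \<V>\<in>finite_open_covers. amenable_cover_entropy \<phi> Fs \<V>)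
      \<le> (INF \<U>\<in>finite_open_covers. sofic_cover_entropy G \<phi> d \<sigma> \<U>)"
    by (rule INF_mono) (use amenable_cover_entropy_le_sofic in blast)
qed

end

theorem theorem6p1:
  fixes G :: "('g, 'b) monoid_scheme"
    and \<phi> :: "'g \<Rightarrow> 'x::metric_space \<Rightarrow> 'x"
    and d :: "nat \<Rightarrow> nat"
    and \<sigma> :: "nat \<Rightarrow> 'g \<Rightarrow> nat \<Rightarrow> nat"
    and Fs :: "nat \<Rightarrow> 'g set"
  assumes "group G"
    and "countable (carrier G)"
    and amenable: "folner_sequence G Fs"
    and sofic: "sofic_approximation G d \<sigma>"
    and "compact (UNIV :: 'x set)"
    and "group_action G (UNIV :: 'x set) \<phi>"
    and continuous: "\<And>g. g \<in> carrier G \<Longrightarrow> continuous_on UNIV (\<phi> g)"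
  shows "(asymptotically_h_expansive G \<phi> d \<sigma> \<longleftrightarrow> amenable_tail_entropy \<phi> Fs = 0) \<and>
    (h_expansive G \<phi> d \<sigma> \<longleftrightarrow> (\<exists>\<V>\<in>finite_open_covers. amenable_cover_entropy \<phi> Fs \<V> = 0))"
proof -
  interpret compact_sofic_action G \<phi> d \<sigma> Fs
    using assms by (simp add: compact_sofic_action_def)
  have "0 \<le> amenable_tail_entropy \<phi> Fs"
    unfolding amenable_tail_entropy_def by (intro INF_greatest amenable_cover_entropy_nonneg)
  then have "asymptotically_h_expansive G \<phi> d \<sigma> \<longleftrightarrow> amenable_tail_entropy \<phi> Fs = 0"
    unfolding asymptotically_h_expansive_def sofic_tail_entropy_eq_amenable by auto
  moreover have "h_expansive G \<phi> d \<sigma> \<longleftrightarrow> (\<exists>\<V>\<in>finite_open_covers. amenable_cover_entropy \<phi> Fs \<V> = 0)"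
    unfolding h_expansive_def
  proof
    assume "\<exists>\<U>\<in>finite_open_covers. sofic_cover_entropy G \<phi> d \<sigma> \<U> \<le> 0"
    then obtain \<U> where \<U>: "\<U> \<in> finite_open_covers" "sofic_cover_entropy G \<phi> d \<sigma> \<U> \<le> 0" ..
    have "amenable_cover_entropy \<phi> Fs \<U> = 0"
      using amenable_cover_entropy_le_sofic[OF \<U>(1)] \<U>(2) amenable_cover_entropy_nonneg[OF \<U>(1)]
      by (intro antisym) auto
    then show "\<exists>\<V>\<in>finite_open_covers. amenable_cover_entropy \<phi> Fs \<V> = 0" using \<U>(1) by (rule bexI)
  next
    assume "\<exists>\<V>\<in>finite_open_covers. amenable_cover_entropy \<phi> Fs \<V> = 0"
    then obtain \<V> where \<V>: "\<V> \<in> finite_open_covers" "amenable_cover_entropy \<phi> Fs \<V> = 0" ..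
    show "\<exists>\<U>\<in>finite_open_covers. sofic_cover_entropy G \<phi> d \<sigma> \<U> \<le> 0"
      using sofic_cover_entropy_le_amenable[OF \<V>(1)] \<V>(2) by simp
  qed
  ultimately show ?thesis by (rule conjI)
qed

end
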